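(* For every $\varepsilon,\delta>0$, every integer $d\geq 4$ with $d\geq \delta^{-2}\varepsilon^{-1}$, and $\mathbb{X}^d=\mathbb{R}^d$ or $\mathbb{X}^d=\mathbb{C}^d$, every orthonormal basis $B$ of $\mathbb{X}^d$ is $\varepsilon$-$\delta$-uniform on $\mathbb{S}(\mathbb{X}^d)$; that is, for every Borel set $A\subseteq\mathbb{S}(\mathbb{X}^d)$, $$\mathbb{P}\biggl(\Bigl|\frac{\#(B\cap R(A))}{\#B}-u(A)\Bigr|\leq\delta\biggr)\geq 1-\varepsilon,$$ where $R$ is a random element of the group $G$ with distribution $u_G$.
   Context: $\mathbb{X}^d$ denotes $\mathbb{R}^d$ or $\mathbb{C}^d$ with its standard inner product; $\mathbb{S}(\mathbb{X}^d)$ is its unit sphere; $u$ is the uniform probability measure (normalized surface area) on $\mathbb{S}(\mathbb{X}^d)$. $G$ is the orthogonal group $O(d)$ if $\mathbb{X}^d=\mathbb{R}^d$ and the unitary group $U(d)$ if $\mathbb{X}^d=\mathbb{C}^d$; $u_G$ is the normalized Haar measure on $G$. $R(A)=\{R(a):a\in A\}$, and $\#S$ is the number of elements of a finite set $S$. Definition: for $\varepsilon,\delta>0$, a finite set $B\subseteq\mathbb{S}(\mathbb{X}^d)$ is called $\varepsilon$-$\delta$-uniform on $\mathbb{S}(\mathbb{X}^d)$ iff for every Borel set $A\subseteq\mathbb{S}(\mathbb{X}^d)$, $\mathbb{P}\bigl(\bigl|\#(B\cap R(A))/\#B-u(A)\bigr|\leq\delta\bigr)\geq 1-\varepsilon$,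 where $R$ is $u_G$-distributed. *)

theory Defs
  imports "HOL-Probability.Probability"
begin

text \<open>
  Surface area on the unit sphere, in the standard polar-coordinates form: the area of \<open>A\<close> is
  the dimension times the Lebesgue volume of the cone \<open>{r x | 0 < r \<le> 1, x \<in> A}\<close>, which is the
  preimage of \<open>A\<close> under the radial projection \<open>sgn\<close> of the punctured ball
  (see \<open>emeasure_surface_area\<close> below).
  For \<open>complex ^ 'n\<close> the dimension is the real one, \<open>2 * CARD('n)\<close>.
\<close>

definition surface_area :: "'a::euclidean_space measure" where
  "surface_area = scale_measure (of_nat DIM('a))
     (distr (restrict_space lborel (cball 0 1 - {0})) (restrict_space borel (sphere 0 1)) sgn)"

definition uniform_sphere :: "'a::euclidean_space measure" where
  "uniform_sphere = uniform_measure surface_area (sphere 0 1)"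

lemma sets_surface_area [simp]:
  "sets (surface_area :: 'a::euclidean_space measure) = sets (restrict_space borel (sphere 0 1))"
  by (simp add: surface_area_def)

lemma emeasure_surface_area:
  fixes A :: "'a::euclidean_space set"
  assumes A: "A \<in> sets borel" "A \<subseteq> sphere 0 1"
  shows "emeasure surface_area A
    = of_nat DIM('a) * emeasure lborel {r *\<^sub>R x | r x. 0 < r \<and> r \<le> 1 \<and> x \<in> A}"
proof -
  let ?D = "cball 0 1 - {0} :: 'a set"
  have D: "?D \<in> sets borel" by auto
  have "sgn \<in> borel_measurable (restrict_space borel ?D)"
    unfolding sgn_div_norm by (intro measurable_restrict_space1) measurable
  then have m: "sgn \<in> restrict_space lborel ?D \<rightarrow>\<^sub>M restrict_space borel (sphere (0::'a) 1)"
    by (auto intro!: measurable_restrict_space2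
        simp: space_restrict_space norm_sgn measurable_cong_sets[OF sets_restrict_space_cong[OF sets_lborel] refl])
  have A': "A \<in> sets (restrict_space borel (sphere 0 1))"
    using A by (auto simp: sets_restrict_space)
  have eq: "sgn -` A \<inter> ?D = {r *\<^sub>R x | r x. 0 < r \<and> r \<le> 1 \<and> x \<in> A}" (is "?L = ?R")
  proof (intro set_eqI iffI)
    fix y assume "y \<in> ?L"
    then show "y \<in> ?R"
      by (auto intro!: exI[of _ "norm y"] exI[of _ "sgn y"] simp: sgn_div_norm)
  next
    fix y assume "y \<in> ?R"
    then obtain r x where "y = r *\<^sub>R x" "0 < r" "r \<le> 1" "x \<in> A" by auto
    then show "y \<in> ?L" using A(2)
      by (auto simp: sgn_scaleR sgn_div_norm subset_iff)
  qed
  have "emeasure surface_area A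
      = of_nat DIM('a) * emeasure (restrict_space lborel ?D) (sgn -` A \<inter> ?D)"
    unfolding surface_area_def using emeasure_distr[OF m A']
    by (simp add: space_restrict_space)
  also have "\<dots> = of_nat DIM('a) * emeasure lborel (sgn -` A \<inter> ?D)"
    by (subst emeasure_restrict_space) auto
  finally show ?thesis by (simp only: eq)
qed

lemma prob_space_uniform_sphere: "prob_space (uniform_sphere :: 'a::euclidean_space measure)"
proof -
  let ?C = "{r *\<^sub>R x | r x. 0 < r \<and> r \<le> 1 \<and> x \<in> sphere (0::'a) 1}"
  have C: "?C = cball 0 1 - {0}"
  proof (intro set_eqI iffI)
    fix y :: 'a assume "y \<in> cball 0 1 - {0}"
    then show "y \<in> ?C"
      by (auto intro!: exI[of _ "norm y"] exI[of _ "sgn y"] simp: sgn_div_norm)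
  qed auto
  have "emeasure lborel (cball 0 1 - {0::'a}) = emeasure lborel (cball (0::'a) 1)"
    by (subst emeasure_Diff) auto
  then have e: "emeasure surface_area (sphere (0::'a) 1)
      = of_nat DIM('a) * emeasure lborel (cball (0::'a) 1)"
    using emeasure_surface_area[of "sphere (0::'a) 1"] C by simp
  have "emeasure lborel (cball (0::'a) 1) \<noteq> 0"
  proof -
    have "unit_ball_vol (real DIM('a)) \<noteq> 0"
      using unit_ball_vol_pos[of "real DIM('a)"] by linarith
    then show ?thesis by (simp add: emeasure_cball)
  qed
  moreover have "emeasure lborel (cball (0::'a) 1) \<noteq> \<infinity>"
    by (simp add: emeasure_cball)
  ultimately show ?thesis
    unfolding uniform_sphere_def e[symmetric]
    by (intro prob_space_uniform_measure) (auto simp: e ennreal_mult_eq_top_iff)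
qed

definition hermitian_inner :: "complex ^ 'n \<Rightarrow> complex ^ 'n \<Rightarrow> complex" where
  "hermitian_inner x y = (\<Sum>i\<in>UNIV. x $ i * cnj (y $ i))"

definition conj_transpose :: "complex ^ 'n ^ 'm \<Rightarrow> complex ^ 'm ^ 'n" where
  "conj_transpose U = (\<chi> i j. cnj (U $ j $ i))"

definition unitary_matrix :: "complex ^ 'n ^ 'n \<Rightarrow> bool" where
  "unitary_matrix U \<longleftrightarrow> conj_transpose U ** U = mat 1 \<and> U ** conj_transpose U = mat 1"

definition orthogonal_group :: "(real ^ 'n ^ 'n) set" where
  "orthogonal_group = {Q. orthogonal_matrix Q}"

definition unitary_group :: "(complex ^ 'n ^ 'n) set" where
  "unitary_group = {U. unitary_matrix U}"

definition real_orthonormal_basis :: "(real ^ 'n) set \<Rightarrow> bool" where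
  "real_orthonormal_basis B \<longleftrightarrow>
     independent B \<and> span B = UNIV \<and>
     (\<forall>x\<in>B. \<forall>y\<in>B. x \<bullet> y = (if x = y then 1 else 0))"

text \<open>Here \<open>vec.span\<close> is the span over the complex scalars, unlike \<open>span\<close>.\<close>

definition complex_orthonormal_basis :: "(complex ^ 'n) set \<Rightarrow> bool" where
  "complex_orthonormal_basis B \<longleftrightarrow>
     vec.independent B \<and> vec.span B = UNIV \<and>
     (\<forall>x\<in>B. \<forall>y\<in>B. hermitian_inner x y = (if x = y then 1 else 0))"

text \<open>
  \<open>normalized_haar G \<mu>\<close>: \<open>\<mu>\<close> is a normalized (left) Haar measure on the compact matrix group \<open>G\<close>.
  Regularity holds automatically for finite Borel measures on a compact metrizable group, and so
  does right invariance; there is exactly one such \<open>\<mu>\<close>.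
\<close>

definition normalized_haar ::
  "('k::{semiring_1, topological_space} ^ 'n ^ 'n) set \<Rightarrow> ('k ^ 'n ^ 'n) measure \<Rightarrow> bool" where
  "normalized_haar G \<mu> \<longleftrightarrow>
     sets \<mu> = sets (restrict_space borel G) \<and> prob_space \<mu> \<and>
     (\<forall>g\<in>G. distr \<mu> \<mu> (\<lambda>R. g ** R) = \<mu>)"

text \<open>
  The argument \<open>\<mu>\<close> is the distribution of the random group element \<open>R\<close>, so that the probability of
  an event about \<open>R\<close> is its \<open>\<mu>\<close>-measure.
\<close>

definition eps_delta_uniform ::
  "('k::{semiring_1, euclidean_space} ^ 'n ^ 'n) measure \<Rightarrow> real \<Rightarrow> real \<Rightarrow> ('k ^ 'n) set \<Rightarrow> bool" where
  "eps_delta_uniform \<mu> \<epsilon> \<delta> B \<longleftrightarrow>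
     finite B \<and> B \<subseteq> sphere 0 1 \<and>
     (\<forall>A. A \<in> sets borel \<longrightarrow> A \<subseteq> sphere 0 1 \<longrightarrow>
        measure \<mu> {R \<in> space \<mu>.
            \<bar>real (card (B \<inter> (\<lambda>x. R *v x) ` A)) / real (card B) - measure uniform_sphere A\<bar> \<le> \<delta>}
          \<ge> 1 - \<epsilon>)"

end

theory Submission
  imports Defs
begin

text \<open>
  With \<open>R\<close> Haar distributed, the frequency in question is distributed like the mean of the
  indicators \<open>1\<^sub>A (R b)\<close>, \<open>b \<in> B\<close>, so by Chebyshev it suffices that its variance is at most
  \<open>1 / d\<close>. Since each indicator has variance at most \<open>1 / 4\<close>, this follows once
  \<open>E (g (R b) g (R b')) \<le> 3 / (d - 1) E g\<^sup>2\<close> for orthogonal unit vectors \<open>b, b'\<close> and every bounded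
  \<open>g\<close> of mean zero on the sphere.

  The left-hand side is \<open>\<langle>g, T g\<rangle>\<close>, where \<open>T g x\<close> averages \<open>g\<close> over the unit sphere of the
  orthogonal complement of \<open>x\<close>. The operator \<open>T\<close> has no kernel, but \<open>T\<^sup>2\<close> has the kernel
  \<open>C (1 - p)\<^bsup>-\<beta>/2\<^esup>\<close> with \<open>p = |\<langle>x, y\<rangle>|\<^sup>2\<close> and \<open>\<beta>\<close> the real dimension of the scalars. On functions
  of mean zero the constant term of its expansion in \<open>p\<close> vanishes, the linear term is an operator
  of norm \<open>O(1 / d\<^sup>2)\<close> by a fourth moment computation, and the remainder is nonnegative with
  integral \<open>O(1 / d\<^sup>2)\<close>. Hence \<open>T\<close> has norm at most \<open>3 / (d - 1)\<close>, and Cauchy-Schwarz concludes.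

  The real and the complex case are treated together, for a scalar field with a conjugation.
\<close>

section \<open>Isometry groups over a field with conjugation\<close>

text \<open>The constant 3 is dictated by the variance count: d diagonal terms of size \<sigma> and
  d (d - 1) off-diagonal terms of size at most 3 \<sigma> / (d - 1) add up to 4 d \<sigma>, and
  \<sigma> <= 1 / 4 leaves exactly the 1 / d that Chebyshev turns into the hypothesis on d. The
  order 1 / d of the norm bound is the right one: averaging |<y, e>|^2 over unit y orthogonal to x
  shows that |<x, e>|^2 - 1 / d is an eigenfunction of T with eigenvalue -1 / (d - 1).

  The obstacle is that orthogonal pairs form a null set, while g, an indicator minus its mean, has
  no regularity to exploit; composing T with itself spreads the singular measure into a density. The
  expansion must pass the linear term: p has mean 1 / d, so a remainder of first order would bound T
  only by O(d^(-1/2)), whereas p^2 has mean O(1 / d^2).\<close>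

locale conjugation =
  fixes cj :: "'k::{real_normed_field,euclidean_space} \<Rightarrow> 'k"
  assumes cj_add: "cj (x + y) = cj x + cj y"
    and cj_mult: "cj (x * y) = cj x * cj y"
    and cj_cj [simp]: "cj (cj x) = x"
    and mult_cj: "x * cj x = of_real ((norm x)\<^sup>2)"
begin

text \<open>Real linearity of \<open>cj\<close> is not an axiom; it is forced by
  \<open>mult_cj\<close>, by cancelling r in r * cj r = r^2.\<close>

lemma cj_of_real [simp]: "cj (of_real r) = of_real r"
proof (cases "r = 0")
  case True
  then show ?thesis using cj_add[of 0 0] by simp
next
  case False
  have "of_real r * cj (of_real r) = (of_real r * of_real r :: 'k)"
    using mult_cj[of "of_real r"] by (simp add: power2_eq_square)
  then show ?thesis using False by simp
qed

lemma cj_0 [simp]: "cj 0 = 0" and cj_1 [simp]: "cj 1 = 1"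
  using cj_of_real[of 0] cj_of_real[of 1] by simp_all

lemma cj_minus: "cj (- x) = - cj x"
  using cj_mult[of "of_real (-1)" x] by (simp del: cj_of_real add: cj_of_real[of "-1", simplified])

lemma cj_diff: "cj (x - y) = cj x - cj y"
  using cj_add[of x "- y"] by (simp add: cj_minus)

lemma cj_sum: "cj (sum f A) = (\<Sum>i\<in>A. cj (f i))"
  by (induction A rule: infinite_finite_induct) (auto simp: cj_add)

lemma cj_eq_0_iff [simp]: "cj x = 0 \<longleftrightarrow> x = 0"
  by (metis cj_0 cj_cj)

lemma norm_cj [simp]: "norm (cj x) = norm x"
proof -
  have "(of_real ((norm (cj x))\<^sup>2) :: 'k) = of_real ((norm x)\<^sup>2)"
    using mult_cj[of x] mult_cj[of "cj x"] by (simp add: mult.commute)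
  then have "(norm (cj x))\<^sup>2 = (norm x)\<^sup>2" by (simp only: of_real_eq_iff)
  then show ?thesis by simp
qed

lemma bounded_linear_cj: "bounded_linear cj"
proof (rule bounded_linear_intro[where K = 1])
  fix r x show "cj (r *\<^sub>R x) = r *\<^sub>R cj x"
    unfolding scaleR_conv_of_real[where 'a='k] cj_mult by simp
qed (simp_all add: cj_add)

lemma borel_measurable_cj [measurable]: "cj \<in> borel_measurable borel"
  by (intro borel_measurable_continuous_onI linear_continuous_on bounded_linear_cj)

definition herm :: "'k ^ 'n \<Rightarrow> 'k ^ 'n \<Rightarrow> 'k" where
  "herm x y = (\<Sum>i\<in>UNIV. x $ i * cj (y $ i))"

definition adj :: "'k ^ 'n ^ 'm \<Rightarrow> 'k ^ 'm ^ 'n" where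
  "adj U = (\<chi> i j. cj (U $ j $ i))"

definition isometry_group :: "('k ^ 'n ^ 'n) set" where
  "isometry_group = {U. adj U ** U = mat 1 \<and> U ** adj U = mat 1}"

lemma herm_add_left: "herm (x + y) z = herm x z + herm y z"
  by (simp add: herm_def algebra_simps sum.distrib)

lemma herm_diff_left: "herm (x - y) z = herm x z - herm y z"
  by (simp add: herm_def algebra_simps sum_subtractf)

lemma herm_scale_left: "herm (c *s x) z = c * herm x z"
  by (simp add: herm_def algebra_simps sum_distrib_left)

lemma cj_herm: "cj (herm x y) = herm y x"
  by (simp add: herm_def cj_sum cj_mult mult.commute)

lemma herm_add_right: "herm z (x + y) = herm z x + herm z y"
  by (simp add: herm_def algebra_simps sum.distrib cj_add)

lemma herm_diff_right: "herm z (x - y) = herm z x - herm z y"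
  by (simp add: herm_def algebra_simps sum_subtractf cj_diff)

lemma herm_scale_right: "herm z (c *s x) = cj c * herm z x"
  by (simp add: herm_def algebra_simps sum_distrib_left cj_mult)

lemma herm_0_left [simp]: "herm 0 x = 0" and herm_0_right [simp]: "herm x 0 = 0"
  by (simp_all add: herm_def)

lemma scaleR_eq_scale: "r *\<^sub>R x = of_real r *s (x :: 'k ^ 'n)"
  by (simp add: vec_eq_iff scaleR_conv_of_real[where 'a='k])

lemma herm_scaleR_left: "herm (r *\<^sub>R x) y = of_real r * herm x y"
  by (simp add: scaleR_eq_scale herm_scale_left)

lemma herm_scaleR_right: "herm x (r *\<^sub>R y) = of_real r * herm x y"
  by (simp add: scaleR_eq_scale herm_scale_right)

lemma herm_axis_right: "herm x (axis i 1) = x $ i"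
proof -
  have "herm x (axis i 1) = (\<Sum>k\<in>UNIV. if k = i then x $ k else 0)"
    unfolding herm_def axis_def by (intro sum.cong) auto
  then show ?thesis by simp
qed

lemma norm_vec_power2: "(norm x)\<^sup>2 = (\<Sum>i\<in>UNIV. (norm (x $ i))\<^sup>2)"
  for x :: "'k ^ 'n"
  by (simp add: norm_vec_def L2_set_def sum_nonneg)

lemma herm_self: "herm x x = of_real ((norm x)\<^sup>2)"
  unfolding norm_vec_power2 herm_def mult_cj by simp

lemma norm_eq_1_if_herm_self:
  assumes "herm x x = 1"
  shows "norm x = 1"
proof -
  have "(of_real ((norm x)\<^sup>2) :: 'k) = of_real 1"
    unfolding herm_self[symmetric] using assms by simp
  then have "(norm x)\<^sup>2 = 1" by (simp only: of_real_eq_iff)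
  then show ?thesis by (metis norm_ge_zero power2_eq_1_iff le_minus_one_simps(3))
qed

lemma norm_axis_one [simp]: "norm (axis i 1 :: 'k ^ 'n) = 1"
  by (rule norm_eq_1_if_herm_self) (simp add: herm_axis_right)

lemma herm_mult_vec_left: "herm (U *v x) y = herm x (adj U *v y)"
proof -
  have "herm (U *v x) y = (\<Sum>i\<in>UNIV. \<Sum>j\<in>UNIV. U $ i $ j * x $ j * cj (y $ i))"
    by (simp add: herm_def matrix_vector_mult_def sum_distrib_right)
  also have "\<dots> = (\<Sum>j\<in>UNIV. \<Sum>i\<in>UNIV. U $ i $ j * x $ j * cj (y $ i))"
    by (rule sum.swap)
  also have "\<dots> = herm x (adj U *v y)"
    by (simp add: herm_def matrix_vector_mult_def adj_def cj_sum cj_mult sum_distrib_left mult_ac)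
  finally show ?thesis .
qed

lemma adj_adj [simp]: "adj (adj U) = U"
  by (simp add: adj_def vec_eq_iff)

lemma adj_mult: "adj (U ** V) = adj V ** adj U"
  by (simp add: adj_def matrix_matrix_mult_def vec_eq_iff cj_sum cj_mult mult.commute)

lemma adj_mem_isometry_group: "U \<in> isometry_group \<Longrightarrow> adj U \<in> isometry_group"
  by (auto simp: isometry_group_def)

lemma mult_mem_isometry_group:
  assumes "U \<in> isometry_group" "V \<in> isometry_group"
  shows "U ** V \<in> isometry_group"
proof -
  have "adj V ** adj U ** (U ** V) = adj V ** (adj U ** U) ** V"
       "U ** V ** (adj V ** adj U) = U ** (V ** adj V) ** adj U"
    by (simp_all add: matrix_mul_assoc)
  then show ?thesis using assms by (simp add: isometry_group_def adj_mult)
qed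

lemma mult_vec_scaleR: "V *v (r *\<^sub>R x) = r *\<^sub>R (V *v x)" for V :: "'k ^ 'n ^ 'n"
  unfolding scaleR_eq_scale by (rule vector_scalar_commute)

context
  fixes U :: "'k ^ 'n ^ 'n"
  assumes U: "U \<in> isometry_group"
begin

lemma adj_mult_vec_cancel: "adj U *v (U *v x) = x" and mult_vec_adj_cancel: "U *v (adj U *v x) = x"
  using U by (simp_all add: isometry_group_def matrix_vector_mul_assoc)

lemma herm_isometry: "herm (U *v x) (U *v y) = herm x y"
  by (simp add: herm_mult_vec_left adj_mult_vec_cancel)

lemma norm_isometry: "norm (U *v x) = norm x"
proof -
  have "(of_real ((norm (U *v x))\<^sup>2) :: 'k) = of_real ((norm x)\<^sup>2)"
    unfolding herm_self[symmetric] by (rule herm_isometry)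
  then have "(norm (U *v x))\<^sup>2 = (norm x)\<^sup>2" by (simp only: of_real_eq_iff)
  then show ?thesis by simp
qed

lemma orthogonal_transformation_isometry: "orthogonal_transformation ((*v) U)"
  unfolding orthogonal_transformation
  by (auto intro!: linearI simp: norm_isometry matrix_vector_right_distrib mult_vec_scaleR)

end

text \<open>The reflection \<open>I - w w\<^sup>* / \<langle>x, w\<rangle>\<close> along \<open>w = x - y\<close>; over the complex numbers the
  coefficient is not real, but the matrix is still unitary.\<close>

lemma isometry_exchanging:
  fixes x y :: "'k ^ 'n"
  assumes x: "norm x = 1" and y: "norm y = 1"
  obtains U where "U \<in> isometry_group" "U *v x = y" "\<And>z. herm z x = herm z y \<Longrightarrow> U *v z = z"
proof (cases "x = y")
  case True
  have "mat 1 \<in> (isometry_group :: ('k ^ 'n ^ 'n) set)"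
  proof -
    have "adj (mat 1 :: 'k ^ 'n ^ 'n) = mat 1" by (simp add: adj_def vec_eq_iff mat_def)
    then show ?thesis by (simp add: isometry_group_def)
  qed
  then show ?thesis using True by (intro that[of "mat 1"]) auto
next
  case False
  define w where "w = x - y"
  define a where "a = herm x w"
  define U where "U = (\<chi> i j. (if i = j then 1 else 0) - w $ i * cj (w $ j) / a)"
  \<comment> \<open>This is where x and y being unit vectors enters. It makes a nonzero, and it is
    the identity that collapses the composite of \<open>adj U\<close> and \<open>U\<close>
    below.\<close>
  have hw: "herm w w = a + cj a"
  proof -
    have "herm x x = 1" "herm y y = 1" using x y by (simp_all add: herm_self)
    then show ?thesis
      by (simp add: a_def w_def cj_herm cj_diff herm_diff_left herm_diff_right)
  qed
  have "herm w w \<noteq> 0" using False by (simp add: herm_self w_def)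
  then have a0: "a \<noteq> 0" using hw by auto
  have Uz: "U *v z = z - (herm z w / a) *s w" for z
  proof -
    have "(U *v z) $ i = z $ i - herm z w / a * w $ i" for i
    proof -
      have "(U *v z) $ i = (\<Sum>j\<in>UNIV. (if i = j then z $ j else 0) - z $ j * cj (w $ j) * (w $ i / a))"
        unfolding U_def matrix_vector_mult_def by (auto intro!: sum.cong simp: algebra_simps)
      also have "\<dots> = z $ i - herm z w * (w $ i / a)"
        by (simp add: sum_subtractf herm_def sum_distrib_right sum_divide_distrib)
      finally show ?thesis by simp
    qed
    then show ?thesis by (simp add: vec_eq_iff)
  qed
  have aU: "adj U *v z = z - (herm z w / cj a) *s w" for z
  proof -
    have "(adj U *v z) $ i = z $ i - herm z w / cj a * w $ i" for i
    proof -
      have c: "cj (u / a) = cj u / cj a" for u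
        using cj_mult[of "u / a" a] a0 by (simp add: field_simps)
      have "(adj U *v z) $ i = (\<Sum>j\<in>UNIV. (if i = j then z $ j else 0) - z $ j * cj (w $ j) * (w $ i / cj a))"
        unfolding U_def adj_def matrix_vector_mult_def
        by (auto intro!: sum.cong simp: algebra_simps cj_diff cj_mult c)
      also have "\<dots> = z $ i - herm z w * (w $ i / cj a)"
        by (simp add: sum_subtractf herm_def sum_distrib_right sum_divide_distrib)
      finally show ?thesis by simp
    qed
    then show ?thesis by (simp add: vec_eq_iff)
  qed
  have "adj U *v (U *v z) = z" for z
    unfolding Uz aU herm_diff_left herm_scale_left hw using a0
    by (simp add: vec_eq_iff field_simps)
  then have "adj U ** U = mat 1"
    by (simp add: matrix_eq matrix_vector_mul_assoc)
  then have "U \<in> isometry_group"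
    using matrix_left_right_inverse[of U "adj U"] by (simp add: isometry_group_def)
  moreover have "U *v x = y"
    unfolding Uz using a0 by (simp add: a_def w_def)
  moreover have "U *v z = z" if "herm z x = herm z y" for z
    unfolding Uz using that by (simp add: w_def herm_diff_right)
  ultimately show ?thesis using that by blast
qed

text \<open>Two successive exchanges: x is moved to x', then the image of y to y'. The second one
  fixes x' because x' has the same inner product with both of its points. Hence an invariant
  function of two unit vectors depends only on their inner product.\<close>

lemma isometry_pair:
  fixes x y x' y' :: "'k ^ 'n"
  assumes "norm x = 1" "norm y = 1" "norm x' = 1" "norm y' = 1" "herm x y = herm x' y'"
  obtains U where "U \<in> isometry_group" "U *v x = x'" "U *v y = y'"
proof -
  obtain V where V: "V \<in> isometry_group" "V *v x = x'"
    using isometry_exchanging assms by metis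
  have n: "norm (V *v y) = 1" using norm_isometry[OF V(1), of y] assms(2) by simp
  obtain W where W: "W \<in> isometry_group" "W *v (V *v y) = y'"
     "\<And>z. herm z (V *v y) = herm z y' \<Longrightarrow> W *v z = z"
    using isometry_exchanging[OF n assms(4)] by metis
  have "W *v x' = x'"
    using W(3) herm_isometry[OF V(1), of x y] V(2) assms(5) by simp
  then show ?thesis
    using that[of "W ** V"] V W mult_mem_isometry_group[OF W(1) V(1)]
    by (simp add: matrix_vector_mul_assoc[symmetric])
qed

end

section \<open>Orthogonal invariance of Lebesgue measure\<close>

lemma nn_integral_lborel_plus:
  fixes f :: "'a::euclidean_space \<Rightarrow> ennreal"
  assumes [measurable]: "f \<in> borel_measurable borel"
  shows "(\<integral>\<^sup>+x. f (x + a) \<partial>lborel) = (\<integral>\<^sup>+x. f x \<partial>lborel)"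
  by (subst (2) lborel_distr_plus[of a, symmetric]) (simp add: nn_integral_distr add.commute)

lemma nn_integral_lborel_uminus:
  fixes f :: "'a::euclidean_space \<Rightarrow> ennreal"
  assumes [measurable]: "f \<in> borel_measurable borel"
  shows "(\<integral>\<^sup>+x. f (- x) \<partial>lborel) = (\<integral>\<^sup>+x. f x \<partial>lborel)"
  by (subst (2) lborel_affine[of "-1" 0]) (simp_all add: nn_integral_distr nn_integral_density)

text \<open>The usual uniqueness argument for translation invariant measures, normalised on the unit
  ball, which \<open>f\<close> preserves.\<close>

lemma lborel_distr_orthogonal_transformation:
  fixes f :: "'a::euclidean_space \<Rightarrow> 'a"
  assumes f: "orthogonal_transformation f"
  shows "distr lborel borel f = lborel"
proof (rule measure_eqI)
  have fm [measurable]: "f \<in> borel_measurable borel"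
    using f by (intro borel_measurable_continuous_onI linear_continuous_on)
      (simp add: linear_conv_bounded_linear[symmetric] orthogonal_transformation_linear)
  fix A assume "A \<in> sets (distr lborel borel f)"
  then have A [measurable]: "A \<in> sets borel" by simp
  define B where "B = (cball 0 1 :: 'a set)"
  have B [measurable]: "B \<in> sets borel" by (simp add: B_def)
  have fB: "f x \<in> B \<longleftrightarrow> x \<in> B" for x
    by (simp add: B_def orthogonal_transformation_norm[OF f])
  \<comment> \<open>The double integral of \<open>?F\<close> is evaluated in both orders: y first
    gives the image measure of A times the volume of B, x first leads to the volume of A times the
    volume of B.\<close>
  let ?F = "\<lambda>x y. indicator A (f x) * indicator B (f x - y) :: ennreal"
  have "(\<integral>\<^sup>+x. \<integral>\<^sup>+y. ?F x y \<partial>lborel \<partial>lborel) = (\<integral>\<^sup>+x. indicator A (f x) * emeasure lborel B \<partial>lborel)"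
  proof (intro nn_integral_cong)
    fix x
    have "(\<integral>\<^sup>+y. indicator B (f x - y) \<partial>lborel) = (\<integral>\<^sup>+y. indicator B (f x + y) \<partial>lborel)"
      using nn_integral_lborel_uminus[of "\<lambda>y. indicator B (f x + y)"] by simp
    also have "\<dots> = emeasure lborel B"
      using nn_integral_lborel_plus[of "indicator B" "f x"] by (simp add: add.commute)
    finally show "(\<integral>\<^sup>+y. ?F x y \<partial>lborel) = indicator A (f x) * emeasure lborel B"
      by (simp add: nn_integral_cmult)
  qed
  also have "\<dots> = emeasure (distr lborel borel f) A * emeasure lborel B"
    by (simp add: nn_integral_multc nn_integral_distr nn_integral_indicator[symmetric] del: nn_integral_indicator)
  finally have 1: "(\<integral>\<^sup>+x. \<integral>\<^sup>+y. ?F x y \<partial>lborel \<partial>lborel) = \<dots>" .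
  have "(\<integral>\<^sup>+x. \<integral>\<^sup>+y. ?F x y \<partial>lborel \<partial>lborel) = (\<integral>\<^sup>+y. \<integral>\<^sup>+x. ?F x y \<partial>lborel \<partial>lborel)"
    by (rule lborel_pair.Fubini'[symmetric]) measurable
  also have "\<dots> = (\<integral>\<^sup>+y. \<integral>\<^sup>+x. indicator A (f x + y) * indicator B x \<partial>lborel \<partial>lborel)"
  proof (rule nn_integral_cong)
    fix y
    \<comment> \<open>Shifting x by the preimage of y turns \<open>f x - y\<close> into
      \<open>f x\<close>, and then \<open>fB\<close> frees the ball factor from f and y.\<close>
    obtain z where z: "y = f z"
      using orthogonal_transformation_surj[OF f] by (metis surjD)
    have fz: "f (x + z) = f x + y" for x
      using orthogonal_transformation_linear[OF f] z by (simp add: linear_add)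
    have "(\<integral>\<^sup>+x. ?F x y \<partial>lborel) = (\<integral>\<^sup>+x. ?F (x + z) y \<partial>lborel)"
      by (rule nn_integral_lborel_plus[symmetric]) measurable
    then show "(\<integral>\<^sup>+x. ?F x y \<partial>lborel) = (\<integral>\<^sup>+x. indicator A (f x + y) * indicator B x \<partial>lborel)"
      by (simp add: fz indicator_def fB)
  qed
  also have "\<dots> = (\<integral>\<^sup>+x. \<integral>\<^sup>+y. indicator A (f x + y) * indicator B x \<partial>lborel \<partial>lborel)"
    by (rule lborel_pair.Fubini') measurable
  also have "\<dots> = (\<integral>\<^sup>+x. emeasure lborel A * indicator B x \<partial>lborel)"
  proof (intro nn_integral_cong)
    fix x show "(\<integral>\<^sup>+y. indicator A (f x + y) * indicator B x \<partial>lborel) = emeasure lborel A * indicator B x"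
      using nn_integral_lborel_plus[of "indicator A" "f x"]
      by (simp add: nn_integral_multc add.commute)
  qed
  also have "\<dots> = emeasure lborel A * emeasure lborel B"
    by (simp add: nn_integral_cmult)
  finally have "emeasure (distr lborel borel f) A * emeasure lborel B = emeasure lborel A * emeasure lborel B"
    using 1 by simp
  moreover have "emeasure lborel B \<noteq> 0" "emeasure lborel B \<noteq> \<infinity>"
    using unit_ball_vol_pos[of "real DIM('a)"] unfolding B_def by (auto simp: emeasure_cball simp del: unit_ball_vol_pos)
  ultimately show "emeasure (distr lborel borel f) A = emeasure lborel A"
    by (metis ennreal_mult_cancel_left mult.commute infinity_ennreal_def)
qed simp

section \<open>Laws of blocks of coordinates\<close>

text \<open>Both sides have the distribution function r |-> V r^m for r >= 0, the volume of the ball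
  of radius r in dimension m; the density is its derivative, and half-lines generate the Borel
  sets.\<close>

lemma distr_PiM_lborel_norm:
  fixes A :: "'i set"
  assumes A: "finite A" "A \<noteq> {}"
  shows "distr (\<Pi>\<^sub>M i\<in>A. lborel) borel (\<lambda>f. sqrt (\<Sum>i\<in>A. (f i)\<^sup>2)) =
    density lborel (\<lambda>z. ennreal (real (card A) * unit_ball_vol (real (card A)) * z ^ (card A - 1)) * indicator {0..} z)"
    (is "?D = ?E")
proof (rule measure_eqI_generator_eq[where \<Omega> = UNIV and E = "range (\<lambda>r::real. {..r})" and A = "\<lambda>n. {..real n}"])
  define m where "m = card A"
  define V where "V = unit_ball_vol (real m)"
  have m: "m > 0" using A by (simp add: m_def card_gt_0_iff)
  have V: "V > 0" by (simp add: V_def)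
  define N where "N = (\<lambda>f::'i \<Rightarrow> real. sqrt (\<Sum>i\<in>A. (f i)\<^sup>2))"
  have N [measurable]: "N \<in> borel_measurable (\<Pi>\<^sub>M i\<in>A. lborel)"
    unfolding N_def by measurable
  have D: "emeasure ?D {..r} = ennreal (V * r ^ m)" if "r > 0" for r
  proof -
    have "emeasure ?D {..r} = emeasure (\<Pi>\<^sub>M i\<in>A. lborel) (N -` {..r} \<inter> space (\<Pi>\<^sub>M i\<in>A. lborel))"
      unfolding N_def[symmetric] by (rule emeasure_distr) auto
    also have "N -` {..r} = {f. sqrt (\<Sum>i\<in>A. (f i)\<^sup>2) \<le> r}"
      by (auto simp: N_def)
    finally show ?thesis
      using emeasure_cball_aux[OF A(1) that] by (simp add: m_def V_def)
  qed
  \<comment> \<open>The volume formula is at hand only for positive radius, so the point 0 is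
    squeezed by small balls.\<close>
  have D0: "emeasure ?D {..0} = 0"
  proof -
    have "emeasure ?D {..0} \<le> ennreal e" if e: "e > 0" for e
    proof -
      define s where "s = min 1 (e / V)"
      have s: "0 < s" "s \<le> 1" "s \<le> e / V" using e V by (auto simp: s_def)
      have "emeasure ?D {..0} \<le> emeasure ?D {..s}"
        using s by (intro emeasure_mono) auto
      also have "\<dots> = ennreal (V * s ^ m)" using s by (intro D)
      also have "V * s ^ m \<le> V * s"
        using V s m power_decreasing[of 1 m s] by (intro mult_left_mono) auto
      also have "V * s \<le> e" using s V by (simp add: field_simps)
      finally show ?thesis by (simp add: ennreal_leI)
    qed
    then have "emeasure ?D {..0} \<le> 0"
      by - (rule ennreal_le_epsilon, simp)
    then show ?thesis by simp
  qed
  have E: "emeasure ?E {..r} = ennreal (V * r ^ m)" if "r \<ge> 0" for r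
  proof -
    have "emeasure ?E {..r} = (\<integral>\<^sup>+z. ennreal (real m * V * z ^ (m - 1)) * indicator {0..r} z \<partial>lborel)"
      unfolding m_def[symmetric] V_def[symmetric]
      by (subst emeasure_density) (auto intro!: nn_integral_cong simp: indicator_def)
    also have "\<dots> = ennreal (V * r ^ m - V * 0 ^ m)"
    proof (rule nn_integral_FTC_Icc[where F = "\<lambda>z. V * z ^ m"])
      fix x :: real assume "x \<in> {0..r}"
      show "((\<lambda>z. V * z ^ m) has_real_derivative real m * V * x ^ (m - 1)) (at x)"
        by (auto intro!: derivative_eq_intros)
      show "0 \<le> real m * V * x ^ (m - 1)" using V \<open>x \<in> {0..r}\<close> by simp
    qed (use that in auto)
    finally show ?thesis using m by (simp add: zero_power)
  qed
  show "emeasure ?D X = emeasure ?E X" if "X \<in> range (\<lambda>r::real. {..r})" for X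
  proof -
    from that obtain r where X: "X = {..r}" by auto
    consider "r > 0" | "r = 0" | "r < 0" by linarith
    then show ?thesis
    proof cases
      case 1 then show ?thesis using D E X by simp
    next
      case 2 then show ?thesis using D0 E[of 0] X m by (simp add: zero_power)
    next
      case 3
      have "emeasure ?D X \<le> emeasure ?D {..0}" "emeasure ?E X \<le> emeasure ?E {..0}"
        using 3 X by (auto intro!: emeasure_mono)
      then show ?thesis using D0 E[of 0] m by (simp add: zero_power)
    qed
  qed
  show "Int_stable (range (\<lambda>r::real. {..r}))"
    by (auto simp: Int_stable_def intro!: image_eqI[where x = "min _ _"])
  show "sets ?D = sigma_sets UNIV (range (\<lambda>r::real. {..r}))"
       "sets ?E = sigma_sets UNIV (range (\<lambda>r::real. {..r}))"
    by (simp_all add: borel_eq_atMost)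
  show "(\<Union>n. {..real n}) = UNIV" using real_arch_simple by auto
  show "emeasure ?D {..real n} \<noteq> \<infinity>" for n
    using D[of "real n"] D0 by (cases "n = 0") auto
qed auto

lemma nn_integral_PiM_lborel_norm:
  fixes A :: "'i set"
  assumes A: "finite A" "A \<noteq> {}" and [measurable]: "H \<in> borel_measurable borel"
  shows "(\<integral>\<^sup>+f. H (sqrt (\<Sum>i\<in>A. (f i)\<^sup>2)) \<partial>(\<Pi>\<^sub>M i\<in>A. lborel)) =
    ennreal (real (card A) * unit_ball_vol (real (card A))) *
      (\<integral>\<^sup>+z. H z * (ennreal (z ^ (card A - 1)) * indicator {0..} z) \<partial>lborel)"
proof -
  define c where "c = real (card A) * unit_ball_vol (real (card A))"
  have c: "c \<ge> 0" by (simp add: c_def)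
  have "(\<integral>\<^sup>+f. H (sqrt (\<Sum>i\<in>A. (f i)\<^sup>2)) \<partial>(\<Pi>\<^sub>M i\<in>A. lborel)) =
      (\<integral>\<^sup>+z. H z \<partial>distr (\<Pi>\<^sub>M i\<in>A. lborel) borel (\<lambda>f. sqrt (\<Sum>i\<in>A. (f i)\<^sup>2)))"
    by (rule nn_integral_distr[symmetric]) measurable
  also have "\<dots> = (\<integral>\<^sup>+z. ennreal (c * z ^ (card A - 1)) * indicator {0..} z * H z \<partial>lborel)"
    unfolding distr_PiM_lborel_norm[OF A] c_def by (rule nn_integral_density) measurable
  also have "\<dots> = (\<integral>\<^sup>+z. ennreal c * (H z * (ennreal (z ^ (card A - 1)) * indicator {0..} z)) \<partial>lborel)"
    using c by (intro nn_integral_cong) (auto simp: ennreal_mult mult_ac indicator_def)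
  also have "\<dots> = ennreal c * (\<integral>\<^sup>+z. H z * (ennreal (z ^ (card A - 1)) * indicator {0..} z) \<partial>lborel)"
    by (rule nn_integral_cmult) measurable
  finally show ?thesis by (simp add: c_def)
qed

definition coord_proj :: "'a set \<Rightarrow> 'a::euclidean_space \<Rightarrow> 'a" where
  "coord_proj J y = (\<Sum>b\<in>J. (y \<bullet> b) *\<^sub>R b)"

lemma borel_measurable_coord_proj [measurable]: "coord_proj J \<in> borel_measurable borel"
  unfolding coord_proj_def[abs_def] by measurable

lemma norm_sum_Basis:
  assumes "J \<subseteq> Basis"
  shows "norm (\<Sum>b\<in>J. f b *\<^sub>R b :: 'a::euclidean_space) = sqrt (\<Sum>b\<in>J. (f b)\<^sup>2)"
proof -
  have J: "finite J" using assms finite_Basis finite_subset by blast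
  have "(\<Sum>b\<in>J. f b *\<^sub>R b) \<bullet> (\<Sum>b\<in>J. f b *\<^sub>R b) = (\<Sum>b\<in>J. \<Sum>c\<in>J. f b * (f c * (c \<bullet> b)))"
    by (simp add: inner_sum_left inner_sum_right sum_distrib_left)
  also have "\<dots> = (\<Sum>b\<in>J. \<Sum>c\<in>J. if c = b then (f b)\<^sup>2 else 0)"
    using assms by (intro sum.cong) (auto simp: inner_Basis power2_eq_square subset_iff)
  also have "\<dots> = (\<Sum>b\<in>J. (f b)\<^sup>2)" using J by simp
  finally show ?thesis by (simp add: norm_eq_sqrt_inner)
qed

lemma coord_proj_sum:
  assumes "J \<subseteq> Basis"
  shows "coord_proj J (\<Sum>b\<in>Basis. f b *\<^sub>R b :: 'a::euclidean_space) = (\<Sum>b\<in>J. f b *\<^sub>R b)"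
  unfolding coord_proj_def using assms by (intro sum.cong) (auto simp: inner_sum_left_Basis)

lemma diff_coord_proj_sum:
  assumes "J \<subseteq> Basis"
  shows "(\<Sum>b\<in>Basis. f b *\<^sub>R b :: 'a::euclidean_space) - coord_proj J (\<Sum>b\<in>Basis. f b *\<^sub>R b)
    = (\<Sum>b\<in>Basis - J. f b *\<^sub>R b)"
  unfolding coord_proj_sum[OF assms] using assms by (simp add: sum_diff)

text \<open>The two integrals compare the law of a block of coordinates of a uniform point of the unit
  sphere of the orthogonal complement of another block with the law of that block on the full
  sphere. Both become integrals over the block and the norm of the remaining coordinates, whose
  law has a density proportional to a power of the norm; the weight \<open>h\<close> is
  chosen so that the two integrands coincide.\<close>

lemma block_law_comparison:
  fixes J1 J2 :: "'a::euclidean_space set"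
  assumes J: "J1 \<subseteq> Basis" "J2 \<subseteq> Basis" "J1 \<inter> J2 = {}" "J1 \<union> J2 \<noteq> Basis" "card J1 = card J2"
  shows "\<exists>c::real>0. \<exists>h\<in>borel_measurable borel. \<forall>\<Phi>\<in>borel_measurable borel.
      (\<integral>\<^sup>+y. \<Phi> (coord_proj J2 y /\<^sub>R norm (y - coord_proj J1 y)) * indicator {..1} (norm y) \<partial>lborel) =
      ennreal c * (\<integral>\<^sup>+y. \<Phi> (coord_proj J2 y /\<^sub>R norm y) *
         ennreal ((norm y / norm (y - coord_proj J2 y)) ^ card J2) * h (norm y) \<partial>lborel)"
proof -
  interpret product_sigma_finite "\<lambda>_::'a. lborel :: real measure" by standard
  define J3 where "J3 = Basis - (J1 \<union> J2)"
  have fin: "finite J1" "finite J2" "finite J3"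
    using J finite_subset[OF _ finite_Basis] by (auto simp: J3_def)
  have B1: "Basis = J2 \<union> (J3 \<union> J1)" and B2: "Basis - J2 = J3 \<union> J1" and B3: "Basis - J1 = J2 \<union> J3"
    and d: "J2 \<inter> (J3 \<union> J1) = {}" "J3 \<inter> J1 = {}" "J2 \<inter> J3 = {}" and J3: "J3 \<noteq> {}" "J3 \<subseteq> Basis"
    using J by (auto simp: J3_def)
  define \<beta> where "\<beta> = card J2"
  define m where "m = card J3"
  have m: "m > 0" using fin J3 by (simp add: m_def card_gt_0_iff)
  have c31: "card (J3 \<union> J1) = m + \<beta>"
    using d fin J(5) by (simp add: card_Un_disjoint m_def \<beta>_def)
  define S where "S = (\<lambda>J (f::'a \<Rightarrow> real). (\<Sum>b\<in>J. (f b)\<^sup>2))"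
  have S0: "S J f \<ge> 0" for J f by (simp add: S_def sum_nonneg)
  have S_meas: "S J \<in> borel_measurable (\<Pi>\<^sub>M i\<in>I. lborel)" if "J \<subseteq> I" for I J
    unfolding S_def using that by (intro borel_measurable_sum borel_measurable_power) (auto intro: measurable_component_singleton)
  define v where "v = (\<lambda>f::'a \<Rightarrow> real. \<Sum>b\<in>J2. f b *\<^sub>R b)"
  have v_meas: "v \<in> borel_measurable (\<Pi>\<^sub>M i\<in>I. lborel)" if "J2 \<subseteq> I" for I
    unfolding v_def using that by (intro borel_measurable_sum borel_measurable_scaleR) (auto intro: measurable_component_singleton)
  note [measurable] = S_meas[of J1 J1, OF order_refl] S_meas[of J2 J2, OF order_refl] S_meas[of J3 J3, OF order_refl]
    S_meas[of J3 "J3 \<union> J1", OF Un_upper1] S_meas[of J1 "J3 \<union> J1", OF Un_upper2]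
    S_meas[of "J3 \<union> J1" "J3 \<union> J1", OF order_refl] v_meas[of J2, OF order_refl]
  have S_Basis [measurable]: "S (J2 \<union> J3) \<in> borel_measurable (\<Pi>\<^sub>M i\<in>J2 \<union> (J3 \<union> J1). lborel)"
      "S (J3 \<union> J1) \<in> borel_measurable (\<Pi>\<^sub>M i\<in>J2 \<union> (J3 \<union> J1). lborel)"
      "S Basis \<in> borel_measurable (\<Pi>\<^sub>M i\<in>J2 \<union> (J3 \<union> J1). lborel)"
    using B1 by (intro S_meas; blast)+
  have v_Basis [measurable]: "v \<in> borel_measurable (\<Pi>\<^sub>M i\<in>J2 \<union> (J3 \<union> J1). lborel)"
    by (intro v_meas) auto
  have S_Un: "S (I \<union> K) f = S I f + S K f" if "I \<inter> K = {}" "finite I" "finite K" for I K f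
    using that by (simp add: S_def sum.union_disjoint)
  have S_merge1: "S J (merge I K (f, g)) = S J f" if "J \<subseteq> I" for I J K f g
    unfolding S_def using that by (intro sum.cong) (auto simp: merge_def)
  have S_merge2: "S J (merge I K (f, g)) = S J g" if "J \<subseteq> K" "I \<inter> K = {}" for I J K f g
    unfolding S_def using that by (intro sum.cong) (auto simp: merge_def)
  have v_merge: "v (merge J2 K (f, g)) = v f" for K f g
    unfolding v_def by (intro sum.cong) (auto simp: merge_def)
  have S_23: "S (J2 \<union> J3) f = S J2 f + S J3 f" and S_31: "S (J3 \<union> J1) f = S J3 f + S J1 f"
    and S_B: "S Basis f = S J2 f + (S J3 f + S J1 f)" for f
    using d fin by (subst B1 | simp add: S_Un)+
  note fold1 = product_nn_integral_fold[OF d(1) fin(2) finite_UnI[OF fin(3,1)]]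
  note fold2 = product_nn_integral_fold[OF d(2) fin(3,1)]
  have lborel_coords: "(\<integral>\<^sup>+y. F y \<partial>lborel) = (\<integral>\<^sup>+f. F (\<Sum>b\<in>Basis. f b *\<^sub>R b) \<partial>(\<Pi>\<^sub>M i\<in>Basis. lborel))"
    if [measurable]: "F \<in> borel_measurable borel" for F :: "'a \<Rightarrow> ennreal"
    by (subst lborel_eq, rule nn_integral_distr) measurable
  \<comment> \<open>The volume of those J1-coordinates that keep the whole vector in the unit ball
    when the other coordinates have norm s.\<close>
  define h1 where "h1 = (\<lambda>s::real. \<integral>\<^sup>+f. indicator {..1} (sqrt (s\<^sup>2 + S J1 f)) \<partial>(\<Pi>\<^sub>M i\<in>J1. lborel) :: ennreal)"
  have h1 [measurable]: "h1 \<in> borel_measurable borel"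
  proof -
    interpret P1: sigma_finite_measure "\<Pi>\<^sub>M i\<in>J1. (lborel :: real measure)"
      using fin by (intro sigma_finite)
    show ?thesis unfolding h1_def by measurable
  qed
  \<comment> \<open>The right-hand side sees m + \<beta> radial coordinates instead of m. Its
    density z^(m + \<beta> - 1) times the weight (r / z)^\<beta> is r^\<beta> z^(m - 1), so dividing
    by r^\<beta> restores the left-hand integrand.\<close>
  define h where "h = (\<lambda>r. ennreal (inverse (r ^ \<beta>)) * h1 r)"
  have h [measurable]: "h \<in> borel_measurable borel" unfolding h_def by measurable
  \<comment> \<open>\<open>k n\<close> is the area of the unit sphere in dimension n; the constant c
    is a ratio of two such areas.\<close>
  define k where "k = (\<lambda>n. real n * unit_ball_vol (real n))"
  have k: "k n > 0" if "n > 0" for n using that by (simp add: k_def)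
  show ?thesis
  proof (intro exI[of _ "k m / k (m + \<beta>)"] conjI bexI[of _ h] ballI)
    show "k m / k (m + \<beta>) > 0" using m k by simp
    show "h \<in> borel_measurable borel" by (rule h)
    fix \<Phi> :: "'a \<Rightarrow> ennreal" assume [measurable]: "\<Phi> \<in> borel_measurable borel"
    define I where "I = (\<integral>\<^sup>+f. \<integral>\<^sup>+z. \<Phi> (v f /\<^sub>R sqrt (S J2 f + z\<^sup>2)) * h1 (sqrt (S J2 f + z\<^sup>2)) *
        (ennreal (z ^ (m - 1)) * indicator {0..} z) \<partial>lborel \<partial>(\<Pi>\<^sub>M i\<in>J2. lborel))"
    have "(\<integral>\<^sup>+y. \<Phi> (coord_proj J2 y /\<^sub>R norm (y - coord_proj J1 y)) * indicator {..1} (norm y) \<partial>lborel) =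
       (\<integral>\<^sup>+f. \<Phi> (v f /\<^sub>R sqrt (S (J2 \<union> J3) f)) * indicator {..1} (sqrt (S Basis f)) \<partial>(\<Pi>\<^sub>M i\<in>Basis. lborel))"
    proof -
      have F: "(\<lambda>y. \<Phi> (coord_proj J2 y /\<^sub>R norm (y - coord_proj J1 y)) * indicator {..1} (norm y)) \<in> borel_measurable borel"
        by measurable
      show ?thesis
        unfolding lborel_coords[OF F] coord_proj_sum[OF J(2)] diff_coord_proj_sum[OF J(1)] B3
        using J3(2) J by (simp add: norm_sum_Basis v_def S_def)
    qed
    also have "\<dots> = (\<integral>\<^sup>+f. \<integral>\<^sup>+g. \<Phi> (v f /\<^sub>R sqrt (S J2 f + S J3 g)) *
        indicator {..1} (sqrt (S J2 f + S J3 g + S J1 g)) \<partial>(\<Pi>\<^sub>M i\<in>J3 \<union> J1. lborel) \<partial>(\<Pi>\<^sub>M i\<in>J2. lborel))"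
    proof -
      have "(\<lambda>f. \<Phi> (v f /\<^sub>R sqrt (S (J2 \<union> J3) f)) * indicator {..1} (sqrt (S Basis f)))
          \<in> borel_measurable (\<Pi>\<^sub>M i\<in>J2 \<union> (J3 \<union> J1). lborel)" by measurable
      from fold1[OF this] show ?thesis
        using d by (simp add: B1[symmetric] S_23 S_B v_merge S_merge1 S_merge2 add.assoc)
    qed
    also have "\<dots> = (\<integral>\<^sup>+f. \<integral>\<^sup>+g. \<integral>\<^sup>+l. \<Phi> (v f /\<^sub>R sqrt (S J2 f + S J3 g)) *
        indicator {..1} (sqrt (S J2 f + S J3 g + S J1 l)) \<partial>(\<Pi>\<^sub>M i\<in>J1. lborel) \<partial>(\<Pi>\<^sub>M i\<in>J3. lborel) \<partial>(\<Pi>\<^sub>M i\<in>J2. lborel))"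
      by (subst fold2) (use d in \<open>auto simp: S_merge1 S_merge2\<close>)
    also have "\<dots> = (\<integral>\<^sup>+f. \<integral>\<^sup>+g. \<Phi> (v f /\<^sub>R sqrt (S J2 f + S J3 g)) * h1 (sqrt (S J2 f + S J3 g))
         \<partial>(\<Pi>\<^sub>M i\<in>J3. lborel) \<partial>(\<Pi>\<^sub>M i\<in>J2. lborel))"
      using S0 by (simp add: nn_integral_cmult h1_def)
    also have "\<dots> = ennreal (k m) * I"
    proof -
      have "(\<integral>\<^sup>+g. \<Phi> (v f /\<^sub>R sqrt (S J2 f + S J3 g)) * h1 (sqrt (S J2 f + S J3 g)) \<partial>(\<Pi>\<^sub>M i\<in>J3. lborel)) =
          ennreal (k m) * (\<integral>\<^sup>+z. \<Phi> (v f /\<^sub>R sqrt (S J2 f + z\<^sup>2)) * h1 (sqrt (S J2 f + z\<^sup>2)) *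
            (ennreal (z ^ (m - 1)) * indicator {0..} z) \<partial>lborel)" for f
        using nn_integral_PiM_lborel_norm[OF fin(3) J3(1),
          of "\<lambda>z. \<Phi> (v f /\<^sub>R sqrt (S J2 f + z\<^sup>2)) * h1 (sqrt (S J2 f + z\<^sup>2))"] S0[of J3]
        by (simp add: k_def m_def S_def)
      then show ?thesis unfolding I_def by (simp add: nn_integral_cmult)
    qed
    finally have L: "(\<integral>\<^sup>+y. \<Phi> (coord_proj J2 y /\<^sub>R norm (y - coord_proj J1 y)) * indicator {..1} (norm y) \<partial>lborel) = ennreal (k m) * I" .
    have "(\<integral>\<^sup>+y. \<Phi> (coord_proj J2 y /\<^sub>R norm y) *
         ennreal ((norm y / norm (y - coord_proj J2 y)) ^ card J2) * h (norm y) \<partial>lborel) =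
       (\<integral>\<^sup>+f. \<Phi> (v f /\<^sub>R sqrt (S Basis f)) * ennreal ((sqrt (S Basis f) / sqrt (S (J3 \<union> J1) f)) ^ \<beta>) * h (sqrt (S Basis f))
         \<partial>(\<Pi>\<^sub>M i\<in>Basis. lborel))"
    proof -
      have F: "(\<lambda>y. \<Phi> (coord_proj J2 y /\<^sub>R norm y) * ennreal ((norm y / norm (y - coord_proj J2 y)) ^ card J2) * h (norm y))
          \<in> borel_measurable borel"
        by measurable
      show ?thesis
        unfolding lborel_coords[OF F]
        unfolding diff_coord_proj_sum[OF J(2)] B2 \<beta>_def[symmetric]
        unfolding coord_proj_sum[OF J(2)]
        using J3(2) J by (simp add: norm_sum_Basis v_def S_def)
    qed
    also have "\<dots> = (\<integral>\<^sup>+f. \<integral>\<^sup>+g. \<Phi> (v f /\<^sub>R sqrt (S J2 f + S (J3 \<union> J1) g)) *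
        ennreal ((sqrt (S J2 f + S (J3 \<union> J1) g) / sqrt (S (J3 \<union> J1) g)) ^ \<beta>) * h (sqrt (S J2 f + S (J3 \<union> J1) g))
           \<partial>(\<Pi>\<^sub>M i\<in>J3 \<union> J1. lborel) \<partial>(\<Pi>\<^sub>M i\<in>J2. lborel))"
    proof -
      have "(\<lambda>f. \<Phi> (v f /\<^sub>R sqrt (S Basis f)) * ennreal ((sqrt (S Basis f) / sqrt (S (J3 \<union> J1) f)) ^ \<beta>) * h (sqrt (S Basis f)))
          \<in> borel_measurable (\<Pi>\<^sub>M i\<in>J2 \<union> (J3 \<union> J1). lborel)" by measurable
      from fold1[OF this] show ?thesis
        using d by (simp add: B1[symmetric] S_31 S_B v_merge S_merge1 S_merge2)
    qed
    also have "\<dots> = (\<integral>\<^sup>+f. ennreal (k (m + \<beta>)) * (\<integral>\<^sup>+z. \<Phi> (v f /\<^sub>R sqrt (S J2 f + z\<^sup>2)) *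
        ennreal ((sqrt (S J2 f + z\<^sup>2) / z) ^ \<beta>) * h (sqrt (S J2 f + z\<^sup>2)) *
          (ennreal (z ^ (m + \<beta> - 1)) * indicator {0..} z) \<partial>lborel) \<partial>(\<Pi>\<^sub>M i\<in>J2. lborel))"
    proof (rule nn_integral_cong)
      fix f
      have ne: "J3 \<union> J1 \<noteq> {}" using J3 by auto
      show "(\<integral>\<^sup>+g. \<Phi> (v f /\<^sub>R sqrt (S J2 f + S (J3 \<union> J1) g)) *
        ennreal ((sqrt (S J2 f + S (J3 \<union> J1) g) / sqrt (S (J3 \<union> J1) g)) ^ \<beta>) * h (sqrt (S J2 f + S (J3 \<union> J1) g))
           \<partial>(\<Pi>\<^sub>M i\<in>J3 \<union> J1. lborel)) = ennreal (k (m + \<beta>)) * (\<integral>\<^sup>+z. \<Phi> (v f /\<^sub>R sqrt (S J2 f + z\<^sup>2)) *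
        ennreal ((sqrt (S J2 f + z\<^sup>2) / z) ^ \<beta>) * h (sqrt (S J2 f + z\<^sup>2)) *
          (ennreal (z ^ (m + \<beta> - 1)) * indicator {0..} z) \<partial>lborel)"
        using nn_integral_PiM_lborel_norm[OF finite_UnI[OF fin(3,1)] ne,
          of "\<lambda>z. \<Phi> (v f /\<^sub>R sqrt (S J2 f + z\<^sup>2)) *
        ennreal ((sqrt (S J2 f + z\<^sup>2) / z) ^ \<beta>) * h (sqrt (S J2 f + z\<^sup>2))"] S0[of "J3 \<union> J1"]
        unfolding c31 k_def by (simp add: S_def)
    qed
    also have "\<dots> = ennreal (k (m + \<beta>)) * I"
    proof -
      have "(\<integral>\<^sup>+z. \<Phi> (v f /\<^sub>R sqrt (S J2 f + z\<^sup>2)) *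
        ennreal ((sqrt (S J2 f + z\<^sup>2) / z) ^ \<beta>) * h (sqrt (S J2 f + z\<^sup>2)) *
          (ennreal (z ^ (m + \<beta> - 1)) * indicator {0..} z) \<partial>lborel) =
        (\<integral>\<^sup>+z. \<Phi> (v f /\<^sub>R sqrt (S J2 f + z\<^sup>2)) * h1 (sqrt (S J2 f + z\<^sup>2)) *
            (ennreal (z ^ (m - 1)) * indicator {0..} z) \<partial>lborel)" for f
      proof (rule nn_integral_cong_AE)
        \<comment> \<open>The integrands can really differ at z = 0: the quotient there is 0 by
          convention, while z^(m - 1) is 1 for m = 1.\<close>
        have "AE z::real in lborel. z \<noteq> 0" by (rule AE_lborel_singleton)
        then show "AE z in lborel. \<Phi> (v f /\<^sub>R sqrt (S J2 f + z\<^sup>2)) *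
          ennreal ((sqrt (S J2 f + z\<^sup>2) / z) ^ \<beta>) * h (sqrt (S J2 f + z\<^sup>2)) *
            (ennreal (z ^ (m + \<beta> - 1)) * indicator {0..} z) =
          \<Phi> (v f /\<^sub>R sqrt (S J2 f + z\<^sup>2)) * h1 (sqrt (S J2 f + z\<^sup>2)) *
            (ennreal (z ^ (m - 1)) * indicator {0..} z)"
        proof eventually_elim
          fix z :: real assume z: "z \<noteq> 0"
          show "\<Phi> (v f /\<^sub>R sqrt (S J2 f + z\<^sup>2)) *
            ennreal ((sqrt (S J2 f + z\<^sup>2) / z) ^ \<beta>) * h (sqrt (S J2 f + z\<^sup>2)) *
              (ennreal (z ^ (m + \<beta> - 1)) * indicator {0..} z) =
            \<Phi> (v f /\<^sub>R sqrt (S J2 f + z\<^sup>2)) * h1 (sqrt (S J2 f + z\<^sup>2)) *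
              (ennreal (z ^ (m - 1)) * indicator {0..} z)"
          proof (cases "z \<ge> 0")
            case True
            define r where "r = sqrt (S J2 f + z\<^sup>2)"
            have r: "r > 0" using z S0[of J2 f] by (simp add: r_def add_nonneg_pos)
            have "m + \<beta> - 1 = (m - 1) + \<beta>" using m by simp
            then have "(r / z) ^ \<beta> * inverse (r ^ \<beta>) * z ^ (m + \<beta> - 1) = z ^ (m - 1)"
              using r z by (simp add: power_divide power_add field_simps)
            then have "ennreal ((r / z) ^ \<beta>) * ennreal (inverse (r ^ \<beta>)) * ennreal (z ^ (m + \<beta> - 1)) = ennreal (z ^ (m - 1))"
              using r True by (simp add: ennreal_mult[symmetric])
            moreover have "x * a * (b * t) * (e * i) = x * t * ((a * b * e) * i)" for x a b t e i :: ennreal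
              by (simp add: mult_ac)
            ultimately show ?thesis
              unfolding r_def[symmetric] h_def by (simp only:)
          qed simp
        qed
      qed
      then show ?thesis unfolding I_def by (simp add: nn_integral_cmult)
    qed
    finally have R: "(\<integral>\<^sup>+y. \<Phi> (coord_proj J2 y /\<^sub>R norm y) *
         ennreal ((norm y / norm (y - coord_proj J2 y)) ^ card J2) * h (norm y) \<partial>lborel) = ennreal (k (m + \<beta>)) * I" .
    have "ennreal (k m / k (m + \<beta>)) * (ennreal (k (m + \<beta>)) * I) = ennreal (k m) * I"
      using k[OF m] k[of "m + \<beta>"] m by (simp add: mult.assoc[symmetric] ennreal_mult[symmetric])
    then show "(\<integral>\<^sup>+y. \<Phi> (coord_proj J2 y /\<^sub>R norm (y - coord_proj J1 y)) * indicator {..1} (norm y) \<partial>lborel) =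
      ennreal (k m / k (m + \<beta>)) * (\<integral>\<^sup>+y. \<Phi> (coord_proj J2 y /\<^sub>R norm y) *
         ennreal ((norm y / norm (y - coord_proj J2 y)) ^ card J2) * h (norm y) \<partial>lborel)"
      unfolding L R by simp
  qed
qed

section \<open>Haar measure and the uniform measure on the sphere\<close>

lemma borel_measurable_matrix_vector_mult [measurable (raw)]:
  fixes f :: "'x \<Rightarrow> 'k::{real_normed_field,euclidean_space} ^ 'n ^ 'm"
  assumes "f \<in> borel_measurable M" "g \<in> borel_measurable M"
  shows "(\<lambda>x. f x *v g x) \<in> borel_measurable M"
  using assms
  by (rule borel_measurable_continuous_Pair)
     (auto simp: matrix_vector_mult_def intro!: continuous_intros)

lemma borel_measurable_matrix_matrix_mult [measurable (raw)]:
  fixes f :: "'x \<Rightarrow> 'k::{real_normed_field,euclidean_space} ^ 'n ^ 'm" and g :: "'x \<Rightarrow> 'k ^ 'l ^ 'n"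
  assumes "f \<in> borel_measurable M" "g \<in> borel_measurable M"
  shows "(\<lambda>x. f x ** g x) \<in> borel_measurable M"
  using assms
  by (rule borel_measurable_continuous_Pair)
     (auto simp: matrix_matrix_mult_def intro!: continuous_intros)

lemma borel_measurable_vector_scalar_mult [measurable (raw)]:
  fixes f :: "'x \<Rightarrow> 'k::{real_normed_field,euclidean_space}" and g :: "'x \<Rightarrow> 'k ^ 'n"
  assumes "f \<in> borel_measurable M" "g \<in> borel_measurable M"
  shows "(\<lambda>x. f x *s g x) \<in> borel_measurable M"
  using assms
  by (rule borel_measurable_continuous_Pair)
     (auto simp: vector_scalar_mult_def intro!: continuous_intros)

lemma borel_measurable_vec_nth [measurable (raw)]:
  fixes f :: "'x \<Rightarrow> 'k::euclidean_space ^ 'n"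
  assumes "f \<in> borel_measurable M"
  shows "(\<lambda>x. f x $ i) \<in> borel_measurable M"
  using assms
  by (rule borel_measurable_continuous_on[rotated]) (auto intro!: continuous_intros)

lemma borel_measurable_sgn_euclidean [measurable (raw)]:
  fixes f :: "'x \<Rightarrow> 'a::euclidean_space"
  assumes [measurable]: "f \<in> borel_measurable M"
  shows "(\<lambda>x. sgn (f x)) \<in> borel_measurable M"
  unfolding sgn_div_norm by measurable

lemma (in conjugation) borel_measurable_herm [measurable (raw)]:
  assumes [measurable]: "f \<in> borel_measurable M" "g \<in> borel_measurable M"
  shows "(\<lambda>x. herm (f x) (g x)) \<in> borel_measurable M"
  unfolding herm_def by measurable

lemma (in conjugation) borel_measurable_adj [measurable]:
  "(adj :: 'k ^ 'n ^ 'm \<Rightarrow> _) \<in> borel_measurable borel"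
  unfolding adj_def[abs_def]
  by (intro borel_measurable_continuous_onI continuous_intros
      continuous_on_compose2[OF linear_continuous_on[OF bounded_linear_cj]]) auto

text \<open>The measure lives on all matrices and is concentrated on the group only almost
  everywhere, so that measurability is plain Borel measurability. Two-sided invariance is part of
  the interface here and is derived from left invariance when the locale is interpreted.\<close>

locale haar_rotation = conjugation cj + prob_space N
  for cj :: "'k::{real_normed_field,euclidean_space} \<Rightarrow> 'k" and N :: "('k ^ 'n ^ 'n) measure" +
  assumes sets_N [measurable_cong, simp]: "sets N = sets borel"
    and AE_isometry: "AE R in N. R \<in> isometry_group"
    and left_invariant: "U \<in> isometry_group \<Longrightarrow> distr N borel (\<lambda>R. U ** R) = N"
    and right_invariant: "U \<in> isometry_group \<Longrightarrow> distr N borel (\<lambda>R. R ** U) = N"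
    and DIM_le_2: "DIM('k) \<le> 2"
begin

lemma space_N [simp]: "space N = UNIV"
  using sets_eq_imp_space_eq[OF sets_N] by simp

text \<open>The orbit law of one reference axis, with an arbitrary index.
  \<open>distr_mult_vec\<close> shows that any unit vector would do, and
  \<open>measure_uniform_sphere\<close> identifies it with the normalized surface area.\<close>

definition S :: "('k ^ 'n) measure" where
  "S = distr N borel (\<lambda>R. R *v axis undefined 1)"

lemma sets_S [measurable_cong, simp]: "sets S = sets borel" and space_S [simp]: "space S = UNIV"
  by (simp_all add: S_def)

sublocale S: prob_space S
  unfolding S_def by (rule prob_space_distr) measurable

sublocale SS: pair_prob_space S S ..
sublocale NS: pair_prob_space N S ..

lemma distr_right_invariant:
  assumes "U \<in> isometry_group" and [measurable]: "f \<in> N \<rightarrow>\<^sub>M M"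
  shows "distr N M (\<lambda>R. f (R ** U)) = distr N M f"
proof -
  have f: "f \<in> borel \<rightarrow>\<^sub>M M" by measurable
  have "distr N M f = distr (distr N borel (\<lambda>R. R ** U)) M f"
    unfolding right_invariant[OF assms(1)] ..
  also have "\<dots> = distr N M (\<lambda>R. f (R ** U))"
    using f by (subst distr_distr) (auto simp: comp_def)
  finally show ?thesis ..
qed

text \<open>The group is transitive on unit vectors, and right invariance absorbs an isometry
  carrying the reference axis to x.\<close>

lemma distr_mult_vec:
  assumes "norm x = 1"
  shows "distr N borel (\<lambda>R. R *v x) = S"
proof -
  obtain U where U: "U \<in> isometry_group" "U *v axis undefined 1 = x"
    using isometry_exchanging[OF norm_axis_one assms] by metis
  have "distr N borel (\<lambda>R. (R ** U) *v axis undefined 1) = S"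
    unfolding S_def by (rule distr_right_invariant[OF U(1)]) measurable
  then show ?thesis by (simp add: matrix_vector_mul_assoc[symmetric] U(2))
qed

lemma distr_S_mult_vec:
  assumes "U \<in> isometry_group"
  shows "distr S borel ((*v) U) = S"
proof -
  have "distr S borel ((*v) U) = distr N borel (\<lambda>R. (U ** R) *v axis undefined 1)"
    unfolding S_def by (subst distr_distr) (auto simp: comp_def matrix_vector_mul_assoc)
  also have "\<dots> = distr (distr N borel (\<lambda>R. U ** R)) borel (\<lambda>R. R *v axis undefined 1)"
    by (subst distr_distr) (auto simp: comp_def)
  finally show ?thesis by (simp add: left_invariant[OF assms] S_def)
qed

lemma integral_mult_vec:
  fixes f :: "'k ^ 'n \<Rightarrow> real"
  assumes "norm x = 1" and [measurable]: "f \<in> borel_measurable borel"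
  shows "(\<integral>R. f (R *v x) \<partial>N) = (\<integral>y. f y \<partial>S)"
  by (subst distr_mult_vec[OF assms(1), symmetric], subst integral_distr) auto

lemma integral_S_mult_vec:
  fixes f :: "'k ^ 'n \<Rightarrow> real"
  assumes "U \<in> isometry_group" and [measurable]: "f \<in> borel_measurable borel"
  shows "(\<integral>y. f (U *v y) \<partial>S) = (\<integral>y. f y \<partial>S)"
  by (subst (2) distr_S_mult_vec[OF assms(1), symmetric], subst integral_distr) auto

lemma AE_norm_S: "AE y in S. norm y = 1"
  unfolding S_def
proof (subst AE_distr_iff)
  show "AE R in N. norm (R *v axis undefined 1) = 1"
    using AE_isometry by eventually_elim (simp add: norm_isometry)
qed auto

text \<open>Polar coordinates without a Jacobian: by invariance of Lebesgue measure the direction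
  may be rotated by R, hence averaged over R; after Fubini the vector \<open>R *v sgn y\<close> has
  law S for every nonzero y, so direction and radius separate.\<close>

lemma nn_integral_polar:
  fixes F :: "'k ^ 'n \<Rightarrow> ennreal" and h :: "real \<Rightarrow> ennreal"
  assumes [measurable]: "F \<in> borel_measurable borel" "h \<in> borel_measurable borel"
  shows "(\<integral>\<^sup>+y. F (sgn y) * h (norm y) \<partial>lborel) = (\<integral>\<^sup>+y. h (norm y) \<partial>(lborel :: ('k ^ 'n) measure)) * (\<integral>\<^sup>+y. F y \<partial>S)"
proof -
  interpret P: pair_sigma_finite N "lborel :: ('k ^ 'n) measure" ..
  have sgnU: "sgn (U *v y) = U *v sgn y" if "U \<in> isometry_group" for U and y :: "'k ^ 'n"
    unfolding sgn_div_norm norm_isometry[OF that] by (simp add: mult_vec_scaleR)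
  have "(\<integral>\<^sup>+y. F (sgn y) * h (norm y) \<partial>lborel) = (\<integral>\<^sup>+R. (\<integral>\<^sup>+y. F (sgn y) * h (norm y) \<partial>lborel) \<partial>N)"
    by (simp add: emeasure_space_1[unfolded space_N])
  also have "\<dots> = (\<integral>\<^sup>+R. (\<integral>\<^sup>+y. F (R *v sgn y) * h (norm y) \<partial>lborel) \<partial>N)"
  proof (rule nn_integral_cong_AE, use AE_isometry in eventually_elim)
    fix R :: "'k ^ 'n ^ 'n" assume R: "R \<in> isometry_group"
    have "(\<integral>\<^sup>+y. F (sgn y) * h (norm y) \<partial>lborel) = (\<integral>\<^sup>+y. F (sgn y) * h (norm y) \<partial>distr lborel borel ((*v) R))"
      by (simp add: lborel_distr_orthogonal_transformation[OF orthogonal_transformation_isometry[OF R]])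
    also have "\<dots> = (\<integral>\<^sup>+y. F (R *v sgn y) * h (norm y) \<partial>lborel)"
      by (subst nn_integral_distr) (auto simp: sgnU[OF R] norm_isometry[OF R])
    finally show "(\<integral>\<^sup>+y. F (sgn y) * h (norm y) \<partial>lborel) = (\<integral>\<^sup>+y. F (R *v sgn y) * h (norm y) \<partial>lborel)" .
  qed
  also have "\<dots> = (\<integral>\<^sup>+y. (\<integral>\<^sup>+R. F (R *v sgn y) * h (norm y) \<partial>N) \<partial>lborel)"
    by (rule P.Fubini'[symmetric]) measurable
  also have "\<dots> = (\<integral>\<^sup>+y. h (norm y) * (\<integral>\<^sup>+y. F y \<partial>S) \<partial>(lborel :: ('k ^ 'n) measure))"
  proof (rule nn_integral_cong_AE)
    have "AE y::'k^'n in lborel. y \<noteq> 0" by (rule AE_lborel_singleton)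
    then show "AE y in lborel. (\<integral>\<^sup>+R. F (R *v sgn y) * h (norm y) \<partial>N) = h (norm y) * (\<integral>\<^sup>+y. F y \<partial>S)"
    proof eventually_elim
      fix y :: "'k ^ 'n" assume "y \<noteq> 0"
      then have "(\<integral>\<^sup>+y. F y \<partial>S) = (\<integral>\<^sup>+R. F (R *v sgn y) \<partial>N)"
        by (subst distr_mult_vec[of "sgn y", symmetric], simp add: norm_sgn, subst nn_integral_distr) auto
      then show "(\<integral>\<^sup>+R. F (R *v sgn y) * h (norm y) \<partial>N) = h (norm y) * (\<integral>\<^sup>+y. F y \<partial>S)"
        by (simp add: nn_integral_cmult mult.commute)
    qed
  qed
  also have "\<dots> = (\<integral>\<^sup>+y. h (norm y) \<partial>(lborel :: ('k ^ 'n) measure)) * (\<integral>\<^sup>+y. F y \<partial>S)"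
    by (simp add: nn_integral_multc)
  finally show ?thesis .
qed

lemma unit_ball_integral:
  "(\<integral>\<^sup>+y. indicator {..1} (norm y) \<partial>(lborel :: ('k ^ 'n) measure)) = emeasure lborel (cball (0::'k ^ 'n) 1)"
proof -
  have "(\<lambda>y::'k ^ 'n. indicator {..1} (norm y) :: ennreal) = indicator (cball 0 1)"
    by (auto simp: indicator_def fun_eq_iff)
  then show ?thesis by simp
qed

lemma emeasure_unit_ball: "emeasure lborel (cball (0::'k ^ 'n) 1) \<noteq> 0" "emeasure lborel (cball (0::'k ^ 'n) 1) \<noteq> \<infinity>"
  using unit_ball_vol_pos[of "real DIM('k ^ 'n)"]
  by (auto simp: emeasure_cball simp del: unit_ball_vol_pos)

text \<open>The cone over a set is cut out by conditions on direction and radius, so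
  \<open>nn_integral_polar\<close> gives its volume as the ball volume times the S-measure, and the
  normalization removes the constant. The origin drops out because sgn 0 = 0 is not on the
  sphere.\<close>

lemma measure_uniform_sphere:
  fixes A :: "('k ^ 'n) set"
  assumes A [measurable]: "A \<in> sets borel" and sub: "A \<subseteq> sphere 0 1"
  shows "measure uniform_sphere A = measure S A"
proof -
  have cone: "emeasure surface_area B = of_nat DIM('k ^ 'n) * (emeasure lborel (cball (0::'k ^ 'n) 1) * emeasure S B)"
    if B [measurable]: "B \<in> sets borel" and sub: "B \<subseteq> sphere 0 1" for B
  proof -
    have "{r *\<^sub>R x | r x. 0 < r \<and> r \<le> 1 \<and> x \<in> B} = sgn -` B \<inter> cball 0 1" (is "?L = ?R")
    proof (intro set_eqI iffI)
      fix y assume y: "y \<in> ?R"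
      then have "norm (sgn y) = 1" using sub by auto
      then have "y \<noteq> 0" by auto
      with y show "y \<in> ?L"
        by (auto intro!: exI[of _ "norm y"] exI[of _ "sgn y"] simp: sgn_div_norm)
    next
      fix y assume "y \<in> ?L"
      then obtain r x where "y = r *\<^sub>R x" "0 < r" "r \<le> 1" "x \<in> B" by auto
      then show "y \<in> ?R" using sub by (auto simp: sgn_scaleR sgn_div_norm subset_iff)
    qed
    moreover have "sgn -` B \<in> sets borel"
      by (rule measurable_sets_borel[OF _ B]) measurable
    ultimately have "emeasure lborel {r *\<^sub>R x | r x. 0 < r \<and> r \<le> 1 \<and> x \<in> B} =
        (\<integral>\<^sup>+y. indicator (sgn -` B \<inter> cball 0 1) y \<partial>lborel)"
      by (subst nn_integral_indicator) auto
    also have "\<dots> = (\<integral>\<^sup>+y. indicator B (sgn y) * indicator {..1} (norm y) \<partial>lborel)"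
      by (intro nn_integral_cong) (auto simp: indicator_def)
    also have "\<dots> = emeasure lborel (cball (0::'k ^ 'n) 1) * emeasure S B"
      by (subst nn_integral_polar) (auto simp: unit_ball_integral)
    finally show ?thesis using emeasure_surface_area[OF that] by simp
  qed
  have sph: "sphere 0 1 \<in> sets (borel :: ('k ^ 'n) measure)" by simp
  have S1: "emeasure S (sphere 0 1) = 1"
    by (rule S.emeasure_eq_1_AE) (use AE_norm_S in auto)
  define c where "c = of_nat DIM('k ^ 'n) * emeasure lborel (cball (0::'k ^ 'n) 1)"
  have c: "c \<noteq> 0" "c \<noteq> \<infinity>" using emeasure_unit_ball by (auto simp: c_def ennreal_mult_eq_top_iff)
  have "emeasure uniform_sphere A = emeasure surface_area (sphere 0 1 \<inter> A) / emeasure surface_area (sphere (0::'k ^ 'n) 1)"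
    unfolding uniform_sphere_def
    by (rule emeasure_uniform_measure) (use A sub in \<open>auto simp: sets_restrict_space\<close>)
  also have "sphere 0 1 \<inter> A = A" using sub by auto
  also have "emeasure surface_area A / emeasure surface_area (sphere (0::'k ^ 'n) 1) = (c * emeasure S A) / c"
    unfolding cone[OF A sub] cone[OF sph order_refl] S1 c_def by (simp add: mult.assoc)
  also have "\<dots> = emeasure S A"
    using c by (simp add: ennreal_times_divide[symmetric] mult.commute[of c] less_top)
  finally show ?thesis by (simp add: measure_def)
qed

text \<open>With p = |s|^2 this is (1 - p)^(-1/2) over the reals and 1 / (1 - p) over the complex
  numbers. At |s| = 1 the value is 0 by convention, so lower bounds are available only for |s| <
  1.\<close>

definition wt :: "'k \<Rightarrow> real" where
  "wt s = inverse (sqrt (1 - (norm s)\<^sup>2)) ^ DIM('k)"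

lemma borel_measurable_wt [measurable]: "wt \<in> borel_measurable borel"
  unfolding wt_def[abs_def] by measurable

lemma coord_proj_axis: "coord_proj (axis i ` Basis) y = axis i (y $ i)" for y :: "'k ^ 'n"
proof -
  have "coord_proj (axis i ` Basis) y = (\<Sum>b\<in>Basis. axis i ((y $ i \<bullet> b) *\<^sub>R b))"
  proof -
    have ax: "r *\<^sub>R axis i b = (axis i (r *\<^sub>R b) :: 'k ^ 'n)" for r b
      by (simp add: vec_eq_iff axis_def)
    show ?thesis unfolding coord_proj_def
      by (subst sum.reindex) (auto simp: inj_on_def axis_eq_axis inner_axis ax)
  qed
  also have "\<dots> = axis i (\<Sum>b\<in>Basis. (y $ i \<bullet> b) *\<^sub>R b)"
    by (simp add: vec_eq_iff axis_def)
  finally show ?thesis by (simp add: euclidean_representation)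
qed

lemma norm_diff_axis: "norm (y - axis i (y $ i)) = sqrt ((norm y)\<^sup>2 - (norm (y $ i))\<^sup>2)" for y :: "'k ^ 'n"
proof -
  have "(norm (y - axis i (y $ i)))\<^sup>2 = (\<Sum>k\<in>UNIV. if k = i then 0 else (norm (y $ k))\<^sup>2)"
    unfolding norm_vec_power2 by (intro sum.cong) (auto simp: axis_def)
  also have "\<dots> = (\<Sum>k\<in>UNIV - {i}. (norm (y $ k))\<^sup>2)"
    by (simp add: sum.If_cases Diff_eq)
  also have "\<dots> = (norm y)\<^sup>2 - (norm (y $ i))\<^sup>2"
    unfolding norm_vec_power2[of y] by (subst (2) sum.remove[of _ i]) auto
  finally show ?thesis by (metis norm_ge_zero real_sqrt_unique)
qed

text \<open>The left-hand side is an average over a uniform point of the unit sphere of the orthogonal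
  complement of the \<open>i\<close>-th axis, so this identifies the kernel of \<open>T\<^sup>2\<close>.\<close>

lemma coordinate_law:
  assumes ij: "i \<noteq> j" and card: "CARD('n) \<ge> 3"
  shows "\<exists>C>0. \<forall>\<phi>\<in>borel_measurable borel.
     (\<integral>y. \<phi> (y $ j /\<^sub>R sqrt (1 - (norm (y $ i))\<^sup>2)) \<partial>S) = (\<integral>y. \<phi> (y $ j) * (C * wt (y $ j) :: real) \<partial>S)"
proof -
  define J where "J = (\<lambda>i. axis i ` Basis :: ('k ^ 'n) set)"
  have Jc: "card (J i) = DIM('k)" for i
    unfolding J_def by (rule card_image) (auto simp: inj_on_def axis_eq_axis)
  have JB: "J i \<subseteq> Basis" for i unfolding J_def by auto
  have Jd: "J i \<inter> J j = {}" using ij by (auto simp: J_def axis_eq_axis)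
  have "card (J i \<union> J j) \<le> 2 * DIM('k)" using card_Un_le[of "J i" "J j"] Jc by simp
  \<comment> \<open>At least three scalar coordinates leave a nonempty third block, whose norm
    supplies the radial variable of the comparison.\<close>
  also have "\<dots> < DIM('k ^ 'n)" using card by simp
  finally have JU: "J i \<union> J j \<noteq> Basis" by auto
  have cJ: "card (J i) = card (J j)" by (simp add: Jc)
  obtain c :: real and h :: "real \<Rightarrow> ennreal" where c: "c > 0" and [measurable]: "h \<in> borel_measurable borel"
    and comp: "\<forall>\<Phi>\<in>borel_measurable borel.
      (\<integral>\<^sup>+y. \<Phi> (coord_proj (J j) y /\<^sub>R norm (y - coord_proj (J i) y)) * indicator {..1} (norm y) \<partial>lborel) =
      ennreal c * (\<integral>\<^sup>+y. \<Phi> (coord_proj (J j) y /\<^sub>R norm y) *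
         ennreal ((norm y / norm (y - coord_proj (J j) y)) ^ card (J j)) * h (norm y) \<partial>lborel)"
    using block_law_comparison[OF JB JB Jd JU cJ] by blast
  define V where "V = emeasure lborel (cball (0::'k ^ 'n) 1)"
  define a where "a = ennreal c * (\<integral>\<^sup>+y. h (norm y) \<partial>(lborel :: ('k ^ 'n) measure))"
  \<comment> \<open>The block comparison for Lebesgue measure descends to S by splitting off the
    radial factor on both sides with \<open>nn_integral_polar\<close>.\<close>
  have key: "V * (\<integral>\<^sup>+y. \<phi> (y $ j /\<^sub>R sqrt (1 - (norm (y $ i))\<^sup>2)) \<partial>S) = a * (\<integral>\<^sup>+y. \<phi> (y $ j) * ennreal (wt (y $ j)) \<partial>S)"
    if [measurable]: "\<phi> \<in> borel_measurable borel" for \<phi> :: "'k \<Rightarrow> ennreal"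
  proof -
    let ?F1 = "\<lambda>y::'k^'n. \<phi> (y $ j /\<^sub>R norm (y - axis i (y $ i)))"
    let ?F2 = "\<lambda>y::'k^'n. \<phi> (y $ j) * ennreal (inverse (norm (y - axis j (y $ j))) ^ DIM('k))"
    have ax [measurable]: "(\<lambda>y::'k^'n. axis i (y $ i)) \<in> borel_measurable borel" for i
      unfolding coord_proj_axis[symmetric] by measurable
    have sc: "sgn y - axis i (sgn y $ i) = (y - axis i (y $ i)) /\<^sub>R norm y" for i and y :: "'k ^ 'n"
      by (simp add: vec_eq_iff axis_def sgn_div_norm scaleR_diff_right)
    have nc: "norm y * a * inverse (norm y) = a" if "y \<noteq> 0" for y :: "'k ^ 'n" and a :: real
      using that by simp
    have "V * (\<integral>\<^sup>+y. ?F1 y \<partial>S) = (\<integral>\<^sup>+y. ?F1 (sgn y) * indicator {..1} (norm y) \<partial>lborel)"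
      by (subst nn_integral_polar) (auto simp: unit_ball_integral V_def)
    also have "\<dots> = (\<integral>\<^sup>+y. \<phi> ((coord_proj (J j) y /\<^sub>R norm (y - coord_proj (J i) y)) $ j) * indicator {..1} (norm y) \<partial>lborel)"
    proof (rule nn_integral_cong_AE)
      have "AE y::'k^'n in lborel. y \<noteq> 0" by (rule AE_lborel_singleton)
      then show "AE y in lborel. ?F1 (sgn y) * indicator {..1} (norm y) =
         \<phi> ((coord_proj (J j) y /\<^sub>R norm (y - coord_proj (J i) y)) $ j) * indicator {..1} (norm y)"
        unfolding sc by eventually_elim (simp add: J_def coord_proj_axis sgn_div_norm nc)
    qed
    also have "\<dots> = ennreal c * (\<integral>\<^sup>+y. \<phi> ((coord_proj (J j) y /\<^sub>R norm y) $ j) *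
         ennreal ((norm y / norm (y - coord_proj (J j) y)) ^ card (J j)) * h (norm y) \<partial>lborel)"
      by (rule comp[THEN bspec]) measurable
    also have "(\<integral>\<^sup>+y. \<phi> ((coord_proj (J j) y /\<^sub>R norm y) $ j) *
         ennreal ((norm y / norm (y - coord_proj (J j) y)) ^ card (J j)) * h (norm y) \<partial>lborel) =
       (\<integral>\<^sup>+y. ?F2 (sgn y) * h (norm y) \<partial>lborel)"
    proof (rule nn_integral_cong_AE)
      have "AE y::'k^'n in lborel. y \<noteq> 0" by (rule AE_lborel_singleton)
      then show "AE y in lborel. \<phi> ((coord_proj (J j) y /\<^sub>R norm y) $ j) *
         ennreal ((norm y / norm (y - coord_proj (J j) y)) ^ card (J j)) * h (norm y) = ?F2 (sgn y) * h (norm y)"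
        unfolding sc Jc by eventually_elim (simp add: J_def coord_proj_axis sgn_div_norm divide_inverse)
    qed
    also have "\<dots> = (\<integral>\<^sup>+y. h (norm y) \<partial>(lborel :: ('k ^ 'n) measure)) * (\<integral>\<^sup>+y. ?F2 y \<partial>S)"
      by (rule nn_integral_polar) measurable
    finally have "V * (\<integral>\<^sup>+y. ?F1 y \<partial>S) = a * (\<integral>\<^sup>+y. ?F2 y \<partial>S)" by (simp add: a_def mult.assoc)
    moreover have "(\<integral>\<^sup>+y. ?F1 y \<partial>S) = (\<integral>\<^sup>+y. \<phi> (y $ j /\<^sub>R sqrt (1 - (norm (y $ i))\<^sup>2)) \<partial>S)"
      by (rule nn_integral_cong_AE, use AE_norm_S in eventually_elim) (simp add: norm_diff_axis)
    moreover have "(\<integral>\<^sup>+y. ?F2 y \<partial>S) = (\<integral>\<^sup>+y. \<phi> (y $ j) * ennreal (wt (y $ j)) \<partial>S)"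
      by (rule nn_integral_cong_AE, use AE_norm_S in eventually_elim) (simp add: norm_diff_axis wt_def)
    ultimately show ?thesis by simp
  qed
  define W where "W = (\<integral>\<^sup>+y. ennreal (wt (y $ j)) \<partial>S)"
  \<comment> \<open>The test function 1 yields V = a W with V finite and nonzero, so a and W are
    finite and nonzero too; therefore C = 1 / W normalizes the weight.\<close>
  have VaW: "V = a * W" using key[of "\<lambda>_. 1"] by (simp add: W_def S.emeasure_space_1[unfolded space_S])
  have V: "V \<noteq> 0" "V \<noteq> \<infinity>" using emeasure_unit_ball by (auto simp: V_def)
  then have aW: "a \<noteq> 0" "W \<noteq> 0" "a \<noteq> \<infinity>" "W \<noteq> \<infinity>"
    using VaW by (auto simp: ennreal_mult_eq_top_iff ennreal_top_mult ennreal_mult_top)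
  define C where "C = inverse (enn2real W)"
  have W': "ennreal (enn2real W) = W" using aW by (simp add: less_top)
  have W0: "enn2real W > 0" using aW by (simp add: enn2real_positive_iff less_top zero_less_iff_neq_zero)
  have C: "C > 0" using W0 by (simp add: C_def)
  have CW: "ennreal C * W = 1"
    using W0 by (subst W'[symmetric], subst ennreal_mult[symmetric]) (auto simp: C_def)
  have CV: "ennreal C * V = a" using CW VaW by (simp add: mult.left_commute)
  have wt0: "wt (y $ j) \<ge> 0" if "norm y = 1" for y :: "'k ^ 'n"
    using Finite_Cartesian_Product.norm_nth_le[of y j] that by (auto simp: wt_def power_le_one)
  have key2: "(\<integral>\<^sup>+y. \<phi> (y $ j /\<^sub>R sqrt (1 - (norm (y $ i))\<^sup>2)) \<partial>S) = (\<integral>\<^sup>+y. ennreal (C * wt (y $ j)) * \<phi> (y $ j) \<partial>S)"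
    if [measurable]: "\<phi> \<in> borel_measurable borel" for \<phi> :: "'k \<Rightarrow> ennreal"
  proof -
    have "V * (\<integral>\<^sup>+y. \<phi> (y $ j /\<^sub>R sqrt (1 - (norm (y $ i))\<^sup>2)) \<partial>S) =
       V * (ennreal C * (\<integral>\<^sup>+y. \<phi> (y $ j) * ennreal (wt (y $ j)) \<partial>S))"
      unfolding key[OF that] CV[symmetric] by (simp add: mult_ac)
    then have "(\<integral>\<^sup>+y. \<phi> (y $ j /\<^sub>R sqrt (1 - (norm (y $ i))\<^sup>2)) \<partial>S) = ennreal C * (\<integral>\<^sup>+y. \<phi> (y $ j) * ennreal (wt (y $ j)) \<partial>S)"
      using V by (simp add: ennreal_mult_cancel_left)
    also have "\<dots> = (\<integral>\<^sup>+y. ennreal C * (\<phi> (y $ j) * ennreal (wt (y $ j))) \<partial>S)"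
      by (rule nn_integral_cmult[symmetric]) measurable
    also have "\<dots> = (\<integral>\<^sup>+y. ennreal (C * wt (y $ j)) * \<phi> (y $ j) \<partial>S)"
      using C wt0 by (intro nn_integral_cong_AE, use AE_norm_S in eventually_elim) (simp add: ennreal_mult mult_ac)
    finally show ?thesis .
  qed
  \<comment> \<open>Equality of measures, rather than of nonnegative integrals, lets the Bochner
    integral be transferred for every measurable \<phi>, whatever its sign.\<close>
  have law: "distr S borel (\<lambda>y. y $ j /\<^sub>R sqrt (1 - (norm (y $ i))\<^sup>2)) =
      distr (density S (\<lambda>y. ennreal (C * wt (y $ j)))) borel (\<lambda>y. y $ j)"
  proof (rule measure_eqI)
    fix A assume "A \<in> sets (distr S borel (\<lambda>y. y $ j /\<^sub>R sqrt (1 - (norm (y $ i))\<^sup>2)))"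
    then have [measurable]: "A \<in> sets borel" by simp
    have "emeasure (distr S borel (\<lambda>y. y $ j /\<^sub>R sqrt (1 - (norm (y $ i))\<^sup>2))) A =
        (\<integral>\<^sup>+y. indicator A (y $ j /\<^sub>R sqrt (1 - (norm (y $ i))\<^sup>2)) \<partial>S)"
      by (subst nn_integral_indicator[symmetric], simp, subst nn_integral_distr) auto
    also have "\<dots> = (\<integral>\<^sup>+y. ennreal (C * wt (y $ j)) * indicator A (y $ j) \<partial>S)"
      by (rule key2) measurable
    also have "\<dots> = emeasure (distr (density S (\<lambda>y. ennreal (C * wt (y $ j)))) borel (\<lambda>y. y $ j)) A"
      by (subst nn_integral_indicator[symmetric], simp, subst nn_integral_distr) (auto simp: nn_integral_density)
    finally show "emeasure (distr S borel (\<lambda>y. y $ j /\<^sub>R sqrt (1 - (norm (y $ i))\<^sup>2))) A =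
        emeasure (distr (density S (\<lambda>y. ennreal (C * wt (y $ j)))) borel (\<lambda>y. y $ j)) A" .
  qed simp
  show ?thesis
  proof (intro exI[of _ C] conjI C ballI)
    fix \<phi> :: "'k \<Rightarrow> real" assume [measurable]: "\<phi> \<in> borel_measurable borel"
    have "(\<integral>y. \<phi> (y $ j /\<^sub>R sqrt (1 - (norm (y $ i))\<^sup>2)) \<partial>S) =
        integral\<^sup>L (distr S borel (\<lambda>y. y $ j /\<^sub>R sqrt (1 - (norm (y $ i))\<^sup>2))) \<phi>"
      by (rule integral_distr[symmetric]) measurable
    also have "\<dots> = (\<integral>y. \<phi> (y $ j) \<partial>density S (\<lambda>y. ennreal (C * wt (y $ j))))"
      unfolding law by (rule integral_distr) measurable
    also have "\<dots> = (\<integral>y. (C * wt (y $ j)) *\<^sub>R \<phi> (y $ j) \<partial>S)"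
      by (rule integral_density) (use AE_norm_S C wt0 in \<open>auto elim!: eventually_mono\<close>)
    finally show "(\<integral>y. \<phi> (y $ j /\<^sub>R sqrt (1 - (norm (y $ i))\<^sup>2)) \<partial>S) = (\<integral>y. \<phi> (y $ j) * (C * wt (y $ j)) \<partial>S)"
      by (simp add: mult.commute)
  qed
qed

end

section \<open>Fourth moments\<close>

text \<open>A bound at every point makes integrability automatic; for this reason kernels and test
  functions below are bounded on the whole space and not just on the sphere.\<close>

lemma (in pair_prob_space) bounded_Fubini:
  fixes f :: "'a \<Rightarrow> 'b \<Rightarrow> real"
  assumes "(\<lambda>(x, y). f x y) \<in> borel_measurable (M1 \<Otimes>\<^sub>M M2)" "\<And>x y. \<bar>f x y\<bar> \<le> B"
  shows "(\<integral>y. (\<integral>x. f x y \<partial>M1) \<partial>M2) = (\<integral>x. (\<integral>y. f x y \<partial>M2) \<partial>M1)"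
proof (rule Fubini_integral)
  show "integrable (M1 \<Otimes>\<^sub>M M2) (\<lambda>(x, y). f x y)"
    by (rule P.integrable_const_bound[of _ B]) (use assms in auto)
qed

context haar_rotation
begin

lemma integral_right_invariant:
  fixes f :: "'k ^ 'n ^ 'n \<Rightarrow> real"
  assumes "U \<in> isometry_group" and [measurable]: "f \<in> borel_measurable borel"
  shows "(\<integral>R. f (R ** U) \<partial>N) = (\<integral>R. f R \<partial>N)"
  by (subst (2) right_invariant[OF assms(1), symmetric], subst integral_distr) auto

lemma integrable_S:
  fixes f :: "'k ^ 'n \<Rightarrow> real"
  assumes "f \<in> borel_measurable borel" "\<And>y. norm y = 1 \<Longrightarrow> \<bar>f y\<bar> \<le> B"
  shows "integrable S f"
  by (rule S.integrable_const_bound[of _ B])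
     (use assms AE_norm_S in \<open>auto elim!: eventually_mono\<close>)

text \<open>Substitution of the isometry that takes a to b and fixes z and z'. One moving vector and
  two fixed ones suffice for all symmetries of moments used below.\<close>

lemma integral_exchange:
  fixes a b z z' :: "'k ^ 'n" and F :: "'k \<Rightarrow> 'k \<Rightarrow> 'k \<Rightarrow> real"
  assumes "norm a = 1" "norm b = 1" "herm z a = herm z b" "herm z' a = herm z' b"
    and m: "(\<lambda>y. F (herm y b) (herm y z) (herm y z')) \<in> borel_measurable borel"
  shows "(\<integral>y. F (herm y a) (herm y z) (herm y z') \<partial>S) = (\<integral>y. F (herm y b) (herm y z) (herm y z') \<partial>S)"
proof -
  obtain U where U: "U \<in> isometry_group" "U *v a = b" "\<And>z. herm z a = herm z b \<Longrightarrow> U *v z = z"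
    using isometry_exchanging[OF assms(1,2)] by metis
  have "herm (U *v y) b = herm y a" "herm (U *v y) z = herm y z" "herm (U *v y) z' = herm y z'" for y
    using herm_isometry[OF U(1), of y a] herm_isometry[OF U(1), of y z] herm_isometry[OF U(1), of y z']
      U(2) U(3)[OF assms(3)] U(3)[OF assms(4)] by simp_all
  then show ?thesis using integral_S_mult_vec[OF U(1) m] by simp
qed

text \<open>Vanishing of a coordinate is scale invariant, so by \<open>nn_integral_polar\<close> the
  Lebesgue null hyperplane cuts the sphere in an S-null set.\<close>

lemma AE_coordinate_nonzero: "AE y in S. y $ j \<noteq> 0"
proof -
  obtain b :: 'k where b: "b \<in> Basis" using SOME_Basis by blast
  have "negligible {y::'k ^ 'n. axis j b \<bullet> y = 0}"
    using nonzero_Basis[OF b] by (intro negligible_hyperplane) auto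
  then have "{y::'k ^ 'n. axis j b \<bullet> y = 0} \<in> null_sets lborel"
    by (simp add: negligible_iff_null_sets null_sets_completion_iff closed_hyperplane borel_closed)
  then have "AE y::'k ^ 'n in lborel. axis j b \<bullet> y \<noteq> 0"
    by (auto dest: AE_not_in)
  then have ae: "AE y::'k ^ 'n in lborel. y $ j \<noteq> 0"
    by eventually_elim (auto simp: inner_axis')
  have "emeasure lborel (cball (0::'k ^ 'n) 1) * (\<integral>\<^sup>+y. indicator {y. y $ j = 0} y \<partial>S) =
      (\<integral>\<^sup>+y. indicator {y. y $ j = 0} (sgn y) * indicator {..1} (norm y) \<partial>(lborel :: ('k ^ 'n) measure))"
    by (subst nn_integral_polar) (auto simp: unit_ball_integral)
  also have "\<dots> = (\<integral>\<^sup>+y. 0 \<partial>(lborel :: ('k ^ 'n) measure))"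
    by (rule nn_integral_cong_AE, use ae in eventually_elim) (auto simp: sgn_div_norm indicator_def)
  finally have "(\<integral>\<^sup>+y. indicator {y. y $ j = 0} y \<partial>S) = 0"
    using emeasure_unit_ball by simp
  then have "AE y in S. indicator {y. y $ j = 0} y = (0::ennreal)"
    by (subst (asm) nn_integral_0_iff_AE) auto
  then show ?thesis by eventually_elim (auto simp: indicator_def)
qed

lemma norm_coordinate_le: "norm y = 1 \<Longrightarrow> (norm (y $ i))\<^sup>2 \<le> 1" for y :: "'k ^ 'n"
  using Finite_Cartesian_Product.norm_nth_le[of y i] by (simp add: power_le_one)

lemma AE_coordinate_less_1:
  assumes "i \<noteq> j"
  shows "AE y in S. norm y = 1 \<and> (norm (y $ i))\<^sup>2 < 1"
  using AE_norm_S AE_coordinate_nonzero[of j]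
proof eventually_elim
  fix y :: "'k ^ 'n" assume y: "norm y = 1" "y $ j \<noteq> 0"
  have "(norm (y $ i))\<^sup>2 + (norm (y $ j))\<^sup>2 = (\<Sum>k\<in>{i, j}. (norm (y $ k))\<^sup>2)" using assms by simp
  also have "\<dots> \<le> (norm y)\<^sup>2" unfolding norm_vec_power2 by (intro sum_mono2) auto
  finally have "(norm (y $ i))\<^sup>2 + (norm (y $ j))\<^sup>2 \<le> 1" using y by simp
  moreover have "(norm (y $ j))\<^sup>2 > 0" using y by simp
  ultimately show "norm y = 1 \<and> (norm (y $ i))\<^sup>2 < 1" using y by linarith
qed

text \<open>The \<open>q k\<close> for k other than i are the squared moduli of the coordinates of
  the normalized projection off axis i: exchangeable and summing to 1. This gives (d - 1) E q = 1
  and E q = M2 + (d - 2) M11. A rotation by 45 degrees adds M2 <= 3 M11, an equality over the reals,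
  and together (d + 1) M2 <= 3 E q.\<close>

lemma fourth_moment:
  assumes ij: "i \<noteq> j" and card: "CARD('n) \<ge> 3"
  shows "(\<integral>y. ((norm (y $ j))\<^sup>2 / (1 - (norm (y $ i))\<^sup>2))\<^sup>2 \<partial>S) \<le> 3 / ((real CARD('n) - 1) * (real CARD('n) + 1))"
proof -
  define d where "d = real CARD('n)"
  have d: "d \<ge> 3" using card by (simp add: d_def)
  define q where "q = (\<lambda>k (y::'k ^ 'n). (norm (y $ k))\<^sup>2 / (1 - (norm (y $ i))\<^sup>2))"
  have q_meas [measurable]: "q k \<in> borel_measurable borel" for k unfolding q_def by measurable
  have q0: "q k y \<ge> 0" if "norm y = 1" for k y using norm_coordinate_le[OF that, of i] by (simp add: q_def)
  have sumq: "(\<Sum>k\<in>UNIV - {i}. q k y) = 1" if "norm y = 1" "(norm (y $ i))\<^sup>2 < 1" for y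
  proof -
    have "(\<Sum>k\<in>UNIV - {i}. (norm (y $ k))\<^sup>2) = (norm y)\<^sup>2 - (norm (y $ i))\<^sup>2"
      unfolding norm_vec_power2[of y] by (subst (2) sum.remove[of _ i]) auto
    then show ?thesis using that by (simp add: q_def sum_divide_distrib[symmetric])
  qed
  have q1: "q k y \<le> 1" if "norm y = 1" "k \<noteq> i" for k y
  proof (cases "(norm (y $ i))\<^sup>2 < 1")
    case True
    have "q k y \<le> (\<Sum>k\<in>UNIV - {i}. q k y)"
      by (rule member_le_sum) (use that q0 in auto)
    then show ?thesis using sumq[OF that(1) True] by simp
  next
    \<comment> \<open>On this null set the denominator vanishes and \<open>q k y\<close> is 0 by
      convention, so the bound holds at every unit vector.\<close>
    case False
    then have "(norm (y $ i))\<^sup>2 = 1" using norm_coordinate_le[OF that(1), of i] by linarith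
    then show ?thesis by (simp add: q_def)
  qed
  have q_int: "integrable S (q k)" if "k \<noteq> i" for k
    by (rule integrable_S[where B = 1]) (use q0 q1 that in \<open>auto simp: abs_le_iff order_trans[OF _ zero_le_one] intro: order_trans[of _ 0]\<close>)
  have qq_int: "integrable S (\<lambda>y. q k y * q l y)" if "k \<noteq> i" "l \<noteq> i" for k l
    by (rule integrable_S[where B = 1]) (use q0 q1 that in \<open>auto simp: abs_mult mult_le_one\<close>)
  have ax: "herm (axis k 1) (axis l 1) = 0" if "k \<noteq> l" for k l :: 'n
    using that by (simp add: herm_axis_right) (simp add: axis_def)
  have m1: "(\<integral>y. q k y \<partial>S) = (\<integral>y. q j y \<partial>S)" if "k \<noteq> i" for k
    using integral_exchange[of "axis k 1" "axis j 1" "axis i 1" "axis i 1"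
      "\<lambda>s t u. (norm s)\<^sup>2 / (1 - (norm t)\<^sup>2)"] that ij ax[of i k] ax[of i j]
    by (simp add: herm_axis_right q_def)
  have m11: "(\<integral>y. q j y * q k y \<partial>S) = (\<integral>y. q j y * q l y \<partial>S)" if "k \<noteq> i" "l \<noteq> i" "k \<noteq> j" "l \<noteq> j" for k l
    using integral_exchange[of "axis k 1" "axis l 1" "axis i 1" "axis j 1"
      "\<lambda>s t u. (norm u)\<^sup>2 / (1 - (norm t)\<^sup>2) * ((norm s)\<^sup>2 / (1 - (norm t)\<^sup>2))"] that ij ax[of i k] ax[of i l] ax[of j k] ax[of j l]
    by (simp add: herm_axis_right q_def)
  have cardi: "real (card (UNIV - {i})) = d - 1" "real (card (UNIV - {i, j})) = d - 2"
    using card ij by (simp_all add: card_Diff_subset d_def of_nat_diff)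
  have "(d - 1) * (\<integral>y. q j y \<partial>S) = (\<Sum>k\<in>UNIV - {i}. (\<integral>y. q k y \<partial>S))"
    using m1 cardi by simp
  also have "\<dots> = (\<integral>y. (\<Sum>k\<in>UNIV - {i}. q k y) \<partial>S)"
    using q_int by (subst Bochner_Integration.integral_sum) auto
  also have "\<dots> = (\<integral>y. 1 \<partial>S)"
  proof (rule integral_cong_AE)
    show "AE y in S. (\<Sum>k\<in>UNIV - {i}. q k y) = 1"
      using AE_coordinate_less_1[OF ij] by eventually_elim (simp add: sumq)
  qed auto
  finally have M1: "(d - 1) * (\<integral>y. q j y \<partial>S) = 1" using S.prob_space by simp
  have "CARD('n) > card {i, j}" using card ij by simp
  then have "{i, j} \<noteq> UNIV" by auto
  then obtain k where k: "k \<noteq> i" "k \<noteq> j" by auto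
  define M2 where "M2 = (\<integral>y. q j y * q j y \<partial>S)"
  define M11 where "M11 = (\<integral>y. q j y * q k y \<partial>S)"
  have "(\<integral>y. q j y \<partial>S) = (\<integral>y. (\<Sum>l\<in>UNIV - {i}. q j y * q l y) \<partial>S)"
  proof (rule integral_cong_AE)
    show "AE y in S. q j y = (\<Sum>l\<in>UNIV - {i}. q j y * q l y)"
      using AE_coordinate_less_1[OF ij] by eventually_elim (simp add: sumq sum_distrib_left[symmetric])
  qed auto
  also have "\<dots> = (\<Sum>l\<in>UNIV - {i}. (\<integral>y. q j y * q l y \<partial>S))"
    using qq_int ij by (subst Bochner_Integration.integral_sum) auto
  also have "\<dots> = M2 + (\<Sum>l\<in>UNIV - {i} - {j}. (\<integral>y. q j y * q l y \<partial>S))"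
    unfolding M2_def using ij by (subst sum.remove[of _ j]) auto
  also have "UNIV - {i} - {j} = UNIV - {i, j}" by auto
  also have "(\<Sum>l\<in>UNIV - {i, j}. (\<integral>y. q j y * q l y \<partial>S)) = (\<Sum>l\<in>UNIV - {i, j}. M11)"
    unfolding M11_def using k by (intro sum.cong refl m11) auto
  also have "\<dots> = (d - 2) * M11" using cardi by simp
  finally have M: "(\<integral>y. q j y \<partial>S) = M2 + (d - 2) * M11" .
  have M2_le: "M2 \<le> 3 * M11"
  proof -
    \<comment> \<open>The two diagonals of the coordinate plane of j and k. They are unit vectors
      orthogonal to axis i, so they have the same fourth moment M2 as axis j.\<close>
    define a where "a = (\<lambda>t. (1 / sqrt 2) *\<^sub>R (axis j 1 + t *\<^sub>R axis k 1) :: 'k ^ 'n)"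
    have "1 / sqrt 2 * (2 * (1 / sqrt 2)) = (1::real)" by (simp add: field_simps)
    from arg_cong[OF this, of "of_real :: real \<Rightarrow> 'k"]
    have two: "of_real (1 / sqrt 2) * (2 * of_real (1 / sqrt 2)) = (1::'k)"
      by (simp only: of_real_mult of_real_numeral of_real_1)
    have na: "norm (a t) = 1" if "t = 1 \<or> t = -1" for t
    proof (rule norm_eq_1_if_herm_self)
      show "herm (a t) (a t) = 1"
        unfolding a_def herm_scaleR_left herm_scaleR_right herm_add_left herm_add_right
        using that k ax[of j k] ax[of k j] by (auto simp: herm_self two simp del: of_real_divide)
    qed
    define Q where "Q = (\<lambda>t (y::'k ^ 'n). ((norm (y $ j + t *\<^sub>R y $ k))\<^sup>2 / 2 / (1 - (norm (y $ i))\<^sup>2))\<^sup>2)"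
    have ha: "herm y (a t) = (1 / sqrt 2) *\<^sub>R (y $ j + t *\<^sub>R y $ k)" for y t
      by (simp add: a_def herm_scaleR_right herm_add_right herm_axis_right scaleR_conv_of_real[where 'a='k])
    have QM: "(\<integral>y. Q t y \<partial>S) = M2" if t: "t = 1 \<or> t = -1" for t
    proof -
      have "herm (axis i 1) (a t) = 0"
        using k ij by (simp add: ha) (simp add: axis_def)
      then show ?thesis
        using integral_exchange[of "a t" "axis j 1" "axis i 1" "axis i 1"
          "\<lambda>s t u. ((norm s)\<^sup>2 / (1 - (norm t)\<^sup>2))\<^sup>2"] na[OF t] ij ax[of i j]
        by (simp add: herm_axis_right ha Q_def M2_def q_def power_divide power_mult_distrib power2_eq_square)
    qed
    \<comment> \<open>Terms linear in the inner product e cancel between the two diagonals, and e^2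
      is bounded by Cauchy-Schwarz. Integrating gives 2 M2 <= (2 M2 + 6 M11) / 2.\<close>
    have Qle: "Q 1 y + Q (-1) y \<le> (q j y * q j y + q k y * q k y + 6 * (q j y * q k y)) / 2" for y
    proof -
      define A B e u where "A = (norm (y $ j))\<^sup>2" and "B = (norm (y $ k))\<^sup>2" and "e = y $ j \<bullet> y $ k"
        and "u = inverse (1 - (norm (y $ i))\<^sup>2)"
      have n: "(norm (y $ j + y $ k))\<^sup>2 = A + B + 2 * e" "(norm (y $ j - y $ k))\<^sup>2 = A + B - 2 * e"
        by (simp_all add: A_def B_def e_def power2_norm_eq_inner inner_add inner_diff inner_commute)
      have e: "e\<^sup>2 \<le> A * B"
        using Cauchy_Schwarz_ineq[of "y $ j" "y $ k"] by (simp add: A_def B_def e_def power2_norm_eq_inner)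
      have "Q 1 y + Q (-1) y = (A + B + 2 * e)\<^sup>2 / 4 * u\<^sup>2 + (A + B - 2 * e)\<^sup>2 / 4 * u\<^sup>2"
      proof -
        have X: "(X / 2 / (1 - (norm (y $ i))\<^sup>2))\<^sup>2 = X\<^sup>2 / 4 * u\<^sup>2" for X
          unfolding u_def divide_inverse power_mult_distrib by (simp add: power2_eq_square)
        show ?thesis unfolding Q_def X by (simp add: n)
      qed
      also have "\<dots> = ((A + B)\<^sup>2 + 4 * e\<^sup>2) / 2 * u\<^sup>2" by (simp add: power2_eq_square field_simps)
      also have "\<dots> \<le> ((A + B)\<^sup>2 + 4 * (A * B)) / 2 * u\<^sup>2"
        using e by (intro mult_right_mono divide_right_mono) auto
      also have "\<dots> = (q j y * q j y + q k y * q k y + 6 * (q j y * q k y)) / 2"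
      proof -
        have "q j y = A * u" "q k y = B * u"
          by (simp_all add: q_def A_def B_def u_def divide_inverse)
        then show ?thesis by (simp add: power2_eq_square field_simps)
      qed
      finally show ?thesis .
    qed
    have Mk: "(\<integral>y. q k y * q k y \<partial>S) = M2"
      using integral_exchange[of "axis k 1" "axis j 1" "axis i 1" "axis i 1"
        "\<lambda>s t u. (norm s)\<^sup>2 / (1 - (norm t)\<^sup>2) * ((norm s)\<^sup>2 / (1 - (norm t)\<^sup>2))"] k ij ax[of i k] ax[of i j]
      by (simp add: herm_axis_right q_def M2_def)
    have R_int: "integrable S (\<lambda>y. (q j y * q j y + q k y * q k y + 6 * (q j y * q k y)) / 2)"
      using qq_int k ij by (intro integrable_divide integrable_add integrable_mult_right) auto
    have Q0: "Q t y \<ge> 0" for t y by (simp add: Q_def)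
    have Q_int: "integrable S (Q t)" if "t = 1 \<or> t = -1" for t
    proof (rule Bochner_Integration.integrable_bound[OF R_int])
      show "Q t \<in> borel_measurable S" unfolding Q_def by measurable
      have "norm (Q t y) \<le> norm ((q j y * q j y + q k y * q k y + 6 * (q j y * q k y)) / 2)" for y
        using Qle[of y] Q0[of 1 y] Q0[of "-1" y] that by auto
      then show "AE y in S. norm (Q t y) \<le> norm ((q j y * q j y + q k y * q k y + 6 * (q j y * q k y)) / 2)" by simp
    qed
    have "M2 + M2 = (\<integral>y. Q 1 y + Q (-1) y \<partial>S)"
      using QM Q_int by simp
    also have "\<dots> \<le> (\<integral>y. (q j y * q j y + q k y * q k y + 6 * (q j y * q k y)) / 2 \<partial>S)"
      using Qle Q_int by (intro integral_mono R_int) auto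
    also have "\<dots> = (M2 + M2 + 6 * M11) / 2"
      using qq_int k ij Mk by (simp add: M2_def M11_def)
    finally show ?thesis by simp
  qed
  have "M2 * (d + 1) \<le> 3 * (M2 + (d - 2) * M11)"
    using mult_left_mono[OF M2_le, of "d - 2"] d by (simp add: algebra_simps)
  then have "M2 * (d + 1) * (d - 1) \<le> 3 * ((d - 1) * (M2 + (d - 2) * M11))"
    using d mult_right_mono[of "M2 * (d + 1)" "3 * (M2 + (d - 2) * M11)" "d - 1"] by (simp add: mult_ac)
  then have "M2 * ((d - 1) * (d + 1)) \<le> 3"
    unfolding M1[unfolded M] by (simp only: mult_ac mult_1_right)
  then have "M2 \<le> 3 / ((d - 1) * (d + 1))" using d by (subst pos_le_divide_eq) auto
  then show ?thesis by (simp add: M2_def q_def d_def power2_eq_square)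
qed

text \<open>The first-order Taylor remainder of the weight in p = |s|^2, factored exactly through u
  = sqrt (1 - p). The upper bound keeps the factor \<open>wt s\<close>, singular at p = 1, on
  purpose: under the law with density C \<open>wt\<close> the mean of p^2 is the fourth moment
  already bounded.\<close>

lemma weight_bounds:
  assumes "(norm s)\<^sup>2 < 1"
  shows "1 \<le> wt s" "0 \<le> wt s - 1 - real DIM('k) / 2 * (norm s)\<^sup>2"
    "wt s - 1 - real DIM('k) / 2 * (norm s)\<^sup>2 \<le> ((norm s)\<^sup>2)\<^sup>2 * wt s"
proof -
  define u where "u = sqrt (1 - (norm s)\<^sup>2)"
  have u: "u > 0" "u \<le> 1" and p: "(norm s)\<^sup>2 = 1 - u\<^sup>2" using assms by (auto simp: u_def)
  have "DIM('k) = 1 \<or> DIM('k) = 2" using DIM_le_2 DIM_positive[where 'a='k] by linarith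
  then have "0 \<le> wt s - 1 - real DIM('k) / 2 * (norm s)\<^sup>2 \<and>
    wt s - 1 - real DIM('k) / 2 * (norm s)\<^sup>2 \<le> ((norm s)\<^sup>2)\<^sup>2 * wt s"
  proof
    assume D: "DIM('k) = 1"
    have w: "wt s = inverse u" by (simp add: wt_def u_def D)
    have 1: "inverse u - 1 - 1 / 2 * (1 - u\<^sup>2) = (1 - u)\<^sup>2 * (2 + u) / 2 * inverse u"
      using u by (simp add: field_simps power2_eq_square)
    have 2: "(1 - u\<^sup>2)\<^sup>2 = (1 - u)\<^sup>2 * (1 + u)\<^sup>2" by (simp add: power2_eq_square algebra_simps)
    have "(2 + u) / 2 \<le> (1 + u)\<^sup>2" using u by (simp add: power2_eq_square algebra_simps)
    then have "(1 - u)\<^sup>2 * ((2 + u) / 2) \<le> (1 - u)\<^sup>2 * (1 + u)\<^sup>2" by (rule mult_left_mono) simp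
    then have "(1 - u)\<^sup>2 * ((2 + u) / 2) * inverse u \<le> (1 - u)\<^sup>2 * (1 + u)\<^sup>2 * inverse u"
      using u by (intro mult_right_mono) auto
    moreover have "0 \<le> (1 - u)\<^sup>2 * (2 + u) / 2 * inverse u" using u by simp
    moreover have "wt s - 1 - real DIM('k) / 2 * (norm s)\<^sup>2 = (1 - u)\<^sup>2 * ((2 + u) / 2) * inverse u"
      unfolding D w p using 1 by simp
    moreover have "((norm s)\<^sup>2)\<^sup>2 * wt s = (1 - u)\<^sup>2 * (1 + u)\<^sup>2 * inverse u"
      unfolding w p 2 ..
    ultimately show ?thesis by simp
  next
    assume D: "DIM('k) = 2"
    have w: "wt s = inverse (u\<^sup>2)" by (simp add: wt_def u_def D power_inverse)
    have 1: "inverse (u\<^sup>2) - 1 - (1 - u\<^sup>2) = (1 - u\<^sup>2)\<^sup>2 * inverse (u\<^sup>2)"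
      using u by (simp add: field_simps power2_eq_square)
    show ?thesis unfolding D w p using 1 by simp
  qed
  moreover have "0 \<le> real DIM('k) / 2 * (norm s)\<^sup>2" by simp
  ultimately show "1 \<le> wt s" "0 \<le> wt s - 1 - real DIM('k) / 2 * (norm s)\<^sup>2"
    "wt s - 1 - real DIM('k) / 2 * (norm s)\<^sup>2 \<le> ((norm s)\<^sup>2)\<^sup>2 * wt s" by linarith+
qed

end

section \<open>Correlation at orthogonal points\<close>

lemma le_if_le_average: "x \<le> (a + b) / 2 \<Longrightarrow> b \<le> x \<Longrightarrow> x \<le> a" for a b x :: real
  by (simp add: field_simps)

context haar_rotation
begin

text \<open>Cauchy-Schwarz, read off a single coordinate after moving y to an axis.\<close>

lemma norm_herm_le:
  assumes "norm x = 1" "norm y = 1"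
  shows "norm (herm x y) \<le> 1"
proof -
  obtain U where U: "U \<in> isometry_group" "U *v y = axis undefined 1"
    using isometry_exchanging[OF assms(2) norm_axis_one] by metis
  have "herm x y = (U *v x) $ undefined"
    using herm_isometry[OF U(1), of x y] U(2) by (simp add: herm_axis_right)
  then show ?thesis
    using Finite_Cartesian_Product.norm_nth_le[of "U *v x" undefined] norm_isometry[OF U(1), of x] assms by simp
qed

lemma norm_coordinate_le1: "norm y = 1 \<Longrightarrow> norm (y $ i) \<le> 1" for y :: "'k ^ 'n"
  using Finite_Cartesian_Product.norm_nth_le[of y i] by simp

text \<open>The truncation only matters off the unit sphere, where it keeps integrands bounded.\<close>

definition overlap :: "'k ^ 'n \<Rightarrow> 'k ^ 'n \<Rightarrow> real" where
  "overlap x y = min 1 ((norm (herm x y))\<^sup>2)"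

lemma overlap_unit: "norm x = 1 \<Longrightarrow> norm y = 1 \<Longrightarrow> overlap x y = (norm (herm x y))\<^sup>2"
  using power_le_one[OF norm_ge_zero norm_herm_le[of x y], of 2] by (simp add: overlap_def min_absorb2)

lemma overlap_bounds: "0 \<le> overlap x y" "overlap x y \<le> 1" "\<bar>overlap x y\<bar> \<le> 1"
  by (auto simp: overlap_def)

lemma overlap_isometry: "U \<in> isometry_group \<Longrightarrow> overlap (U *v x) (U *v y) = overlap x y"
  by (simp add: overlap_def herm_isometry)

lemma overlap_commute: "overlap x y = overlap y x"
  by (metis cj_herm norm_cj overlap_def)

lemma borel_measurable_overlap [measurable (raw)]:
  assumes [measurable]: "f \<in> borel_measurable M" "g \<in> borel_measurable M"
  shows "(\<lambda>x. overlap (f x) (g x)) \<in> borel_measurable M"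
  unfolding overlap_def by measurable

lemma overlap_axis: "norm y = 1 \<Longrightarrow> overlap y (axis j 1) = (norm (y $ j))\<^sup>2"
  by (simp add: overlap_unit herm_axis_right)

text \<open>For norm s <= 1 this is a unit vector with inner product s with axis i. Together with
  that axis it is the standard representative of all pairs of unit vectors with inner product
  s.\<close>

definition pair_vec :: "'n \<Rightarrow> 'n \<Rightarrow> 'k \<Rightarrow> 'k ^ 'n" where
  "pair_vec i j s = s *s axis i 1 + sqrt (1 - (norm s)\<^sup>2) *\<^sub>R axis j 1"

lemma norm_pair_vec:
  assumes "i \<noteq> j" "norm s \<le> 1"
  shows "norm (pair_vec i j s) = 1"
proof -
  have "(norm (pair_vec i j s))\<^sup>2 = (\<Sum>k\<in>UNIV. if k = i then (norm s)\<^sup>2 else if k = j then 1 - (norm s)\<^sup>2 else 0)"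
    unfolding norm_vec_power2 pair_vec_def
    using assms by (intro sum.cong) (auto simp: axis_def power_le_one)
  also have "\<dots> = (\<Sum>k\<in>{i, j}. if k = i then (norm s)\<^sup>2 else if k = j then 1 - (norm s)\<^sup>2 else 0)"
    by (rule sum.mono_neutral_right) auto
  also have "\<dots> = 1" using assms by simp
  finally show ?thesis by (metis norm_ge_zero power2_eq_1_iff le_minus_one_simps(3))
qed

lemma herm_pair_vec: "herm (pair_vec i j s) x = s * cj (x $ i) + of_real (sqrt (1 - (norm s)\<^sup>2)) * cj (x $ j)"
proof -
  have "herm (axis k 1) x = cj (x $ k)" for k using cj_herm[of x "axis k 1"] by (simp add: herm_axis_right)
  then show ?thesis by (simp add: pair_vec_def herm_add_left herm_scale_left herm_scaleR_left)
qed

text \<open>Modulo constants the overlap kernel composed with itself is a multiple of itself, so on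
  functions of mean zero its operator P satisfies P^2 = (m2 - m11) P. An isometry brings the pair to
  standard position, where the square expands into coordinate moments.\<close>

lemma overlap_convolution:
  assumes ij: "i \<noteq> j" and y: "norm y = 1" and z: "norm z = 1"
  shows "(\<integral>x. overlap y x * overlap z x \<partial>S) =
     (\<integral>x. (norm (x $ j))\<^sup>2 * (norm (x $ i))\<^sup>2 \<partial>S) +
     ((\<integral>x. ((norm (x $ j))\<^sup>2)\<^sup>2 \<partial>S) - (\<integral>x. (norm (x $ j))\<^sup>2 * (norm (x $ i))\<^sup>2 \<partial>S)) * overlap z y"
proof -
  define s where "s = herm z y"
  have s: "norm s \<le> 1" using norm_herm_le z y by (simp add: s_def)
  have s2: "(norm s)\<^sup>2 \<le> 1" using s by (simp add: power_le_one)
  define \<gamma> where "\<gamma> = sqrt (1 - (norm s)\<^sup>2)"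
  have \<gamma>: "\<gamma>\<^sup>2 = 1 - (norm s)\<^sup>2" using s2 by (simp add: \<gamma>_def)
  let ?v = "pair_vec j i s"
  have ji: "j \<noteq> i" using ij by simp
  have v: "norm ?v = 1" using norm_pair_vec[OF ji s] .
  have "herm z y = herm ?v (axis j 1)"
    using ij by (simp add: herm_axis_right s_def) (simp add: pair_vec_def axis_def)
  then obtain U where U: "U \<in> isometry_group" "U *v z = ?v" "U *v y = axis j 1"
    using isometry_pair[OF z y v norm_axis_one] by metis
  define t where "t = (\<lambda>x::'k ^ 'n. (norm (x $ j))\<^sup>2 * ((s * cj (x $ j)) \<bullet> cj (x $ i)))"
  have int: "integrable S (\<lambda>x. ((norm (x $ j))\<^sup>2)\<^sup>2)" "integrable S (\<lambda>x. (norm (x $ j))\<^sup>2 * (norm (x $ i))\<^sup>2)"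
    using norm_coordinate_le1 by (intro integrable_S[where B = 1]; simp add: power_le_one mult_le_one abs_mult)+
  have tint: "integrable S t"
  proof (rule integrable_S[where B = 1])
    fix x :: "'k ^ 'n" assume x: "norm x = 1"
    have 1: "norm (x $ k) \<le> 1" for k using Finite_Cartesian_Product.norm_nth_le[of x k] x by simp
    have "\<bar>(s * cj (x $ j)) \<bullet> cj (x $ i)\<bar> \<le> norm (s * cj (x $ j)) * norm (cj (x $ i))"
      by (rule Cauchy_Schwarz_ineq2)
    also have "\<dots> \<le> 1" using s 1 by (simp add: norm_mult mult_le_one)
    finally show "\<bar>t x\<bar> \<le> 1" using norm_coordinate_le[OF x, of j] by (simp add: t_def abs_mult mult_le_one)
  qed (simp add: t_def)
  \<comment> \<open>The cross term is odd under the change of sign of coordinate i, an exchange of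
    axis i with its negative that fixes axis j.\<close>
  have t0: "(\<integral>x. t x \<partial>S) = 0"
  proof -
    have "(\<integral>x. - t x \<partial>S) = (\<integral>x. t x \<partial>S)"
      using integral_exchange[of "- axis i 1" "axis i 1" "axis j 1" "axis j 1"
        "\<lambda>a b c. (norm b)\<^sup>2 * ((s * cj b) \<bullet> cj a)"] ij
        herm_scaleR_right[of _ "-1" "axis i 1"]
      by (simp add: herm_axis_right t_def cj_minus) (simp add: axis_def)
    then show ?thesis by simp
  qed
  have "(\<integral>x. overlap y x * overlap z x \<partial>S) = (\<integral>x. overlap y (adj U *v x) * overlap z (adj U *v x) \<partial>S)"
    by (rule integral_S_mult_vec[OF adj_mem_isometry_group[OF U(1)], symmetric]) measurable
  also have "\<dots> = (\<integral>x. overlap (axis j 1) x * overlap ?v x \<partial>S)"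
  proof (rule Bochner_Integration.integral_cong[OF refl])
    fix x
    have "overlap w (adj U *v x) = overlap (U *v w) x" for w
      using overlap_isometry[OF U(1), of w "adj U *v x"] mult_vec_adj_cancel[OF U(1)] by simp
    then show "overlap y (adj U *v x) * overlap z (adj U *v x) = overlap (axis j 1) x * overlap ?v x"
      by (simp add: U)
  qed
  also have "\<dots> = (\<integral>x. (norm s)\<^sup>2 * ((norm (x $ j))\<^sup>2)\<^sup>2 + \<gamma>\<^sup>2 * ((norm (x $ j))\<^sup>2 * (norm (x $ i))\<^sup>2) + 2 * \<gamma> * t x \<partial>S)"
  proof (rule integral_cong_AE)
    show "AE x in S. overlap (axis j 1) x * overlap ?v x = (norm s)\<^sup>2 * ((norm (x $ j))\<^sup>2)\<^sup>2 + \<gamma>\<^sup>2 * ((norm (x $ j))\<^sup>2 * (norm (x $ i))\<^sup>2) + 2 * \<gamma> * t x"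
      using AE_norm_S
    proof eventually_elim
      fix x :: "'k ^ 'n" assume x: "norm x = 1"
      have "overlap ?v x = (norm (s * cj (x $ j) + \<gamma> *\<^sub>R cj (x $ i)))\<^sup>2"
        using x v by (simp add: overlap_unit herm_pair_vec \<gamma>_def scaleR_conv_of_real[where 'a='k])
      also have "\<dots> = (norm (s * cj (x $ j)))\<^sup>2 + \<gamma>\<^sup>2 * (norm (x $ i))\<^sup>2 + 2 * \<gamma> * ((s * cj (x $ j)) \<bullet> cj (x $ i))"
        unfolding norm_cj[of "x $ i", symmetric] power2_norm_eq_inner
        by (simp add: inner_add inner_commute power2_eq_square)
      finally have "overlap ?v x = (norm s)\<^sup>2 * (norm (x $ j))\<^sup>2 + \<gamma>\<^sup>2 * (norm (x $ i))\<^sup>2 + 2 * \<gamma> * ((s * cj (x $ j)) \<bullet> cj (x $ i))"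
        by (simp add: norm_mult power_mult_distrib)
      moreover have "overlap (axis j 1) x = (norm (x $ j))\<^sup>2" using x by (simp add: overlap_commute[of "axis j 1"] overlap_axis)
      ultimately show "overlap (axis j 1) x * overlap ?v x = (norm s)\<^sup>2 * ((norm (x $ j))\<^sup>2)\<^sup>2 + \<gamma>\<^sup>2 * ((norm (x $ j))\<^sup>2 * (norm (x $ i))\<^sup>2) + 2 * \<gamma> * t x"
        by (simp add: t_def power2_eq_square[of "(norm (x $ j))\<^sup>2"] distrib_left mult_ac)
    qed
  qed (auto simp: t_def)
  also have "\<dots> = (norm s)\<^sup>2 * (\<integral>x. ((norm (x $ j))\<^sup>2)\<^sup>2 \<partial>S) + \<gamma>\<^sup>2 * (\<integral>x. (norm (x $ j))\<^sup>2 * (norm (x $ i))\<^sup>2 \<partial>S) + 2 * \<gamma> * (\<integral>x. t x \<partial>S)"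
    using int tint by simp
  finally show ?thesis
    using overlap_unit[OF z y] by (simp add: t0 \<gamma> s_def[symmetric] algebra_simps)
qed

section \<open>Correlations of a bounded function of mean zero under a random isometry\<close>

context
  fixes g :: "'k ^ 'n \<Rightarrow> real"
  assumes g_meas [measurable]: "g \<in> borel_measurable borel"
    and g_bound: "\<And>y. \<bar>g y\<bar> \<le> 1"
    and g_mean: "(\<integral>y. g y \<partial>S) = 0"
begin

lemma g_mult_bound: "\<bar>g x * g y\<bar> \<le> 1"
  using g_bound by (simp add: abs_mult mult_le_one)

text \<open>On unit vectors this depends only on \<open>herm x y\<close> by \<open>corr_eq\<close>.
  Its value at inner product 0 is wanted, while only its integrals can be estimated
  directly.\<close>

definition corr :: "'k ^ 'n \<Rightarrow> 'k ^ 'n \<Rightarrow> real" where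
  "corr x y = (\<integral>R. g (R *v x) * g (R *v y) \<partial>N)"

lemma borel_measurable_corr [measurable (raw)]:
  assumes [measurable]: "f \<in> borel_measurable M" "f' \<in> borel_measurable M"
  shows "(\<lambda>x. corr (f x) (f' x)) \<in> borel_measurable M"
  unfolding corr_def by measurable

lemma corr_isometry: "U \<in> isometry_group \<Longrightarrow> corr (U *v x) (U *v y) = corr x y"
  unfolding corr_def
  using integral_right_invariant[of U "\<lambda>R. g (R *v x) * g (R *v y)"]
  by (simp add: matrix_vector_mul_assoc)

lemma corr_eq:
  assumes "norm x = 1" "norm y = 1" "norm x' = 1" "norm y' = 1" "herm x y = herm x' y'"
  shows "corr x y = corr x' y'"
  using isometry_pair[OF assms] corr_isometry by metis

lemma integrable_N:
  fixes f :: "'k ^ 'n ^ 'n \<Rightarrow> real"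
  assumes "f \<in> borel_measurable borel" "\<And>R. \<bar>f R\<bar> \<le> B"
  shows "integrable N f"
  by (rule integrable_const_bound[of _ B]) (use assms in auto)

lemma corr_bound:
  assumes "norm x = 1" "norm y = 1"
  shows "\<bar>corr x y\<bar> \<le> (\<integral>y. (g y)\<^sup>2 \<partial>S)"
proof -
  have sq: "\<bar>(g y)\<^sup>2\<bar> \<le> 1" for y using g_bound[of y] by (simp add: abs_square_le_1)
  have int: "integrable N (\<lambda>R. (g (R *v z))\<^sup>2)" for z
    by (rule integrable_N[where B = 1]) (use sq in auto)
  have "\<bar>corr x y\<bar> \<le> (\<integral>R. \<bar>g (R *v x) * g (R *v y)\<bar> \<partial>N)"
    unfolding corr_def by (rule integral_abs_bound)
  also have "\<dots> \<le> (\<integral>R. ((g (R *v x))\<^sup>2 + (g (R *v y))\<^sup>2) / 2 \<partial>N)"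
  proof (rule integral_mono)
    show "integrable N (\<lambda>R. \<bar>g (R *v x) * g (R *v y)\<bar>)"
      by (rule integrable_N[where B = 1]) (use g_mult_bound in auto)
    fix R
    show "\<bar>g (R *v x) * g (R *v y)\<bar> \<le> ((g (R *v x))\<^sup>2 + (g (R *v y))\<^sup>2) / 2"
      using sum_squares_bound[of "\<bar>g (R *v x)\<bar>" "\<bar>g (R *v y)\<bar>"] by (simp add: abs_mult)
  qed (use int in auto)
  also have "\<dots> = (\<integral>y. (g y)\<^sup>2 \<partial>S)"
    using int integral_mult_vec[OF assms(1), of "\<lambda>y. (g y)\<^sup>2"] integral_mult_vec[OF assms(2), of "\<lambda>y. (g y)\<^sup>2"]
    by simp
  finally show ?thesis .
qed

text \<open>For fixed R the inner integral is the mean of g, by left invariance. This removes the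
  constant term of the expansion.\<close>

lemma integral_corr: "(\<integral>y. corr x y \<partial>S) = 0"
proof -
  have "(\<integral>y. corr x y \<partial>S) = (\<integral>R. (\<integral>y. g (R *v x) * g (R *v y) \<partial>S) \<partial>N)"
    unfolding corr_def by (rule NS.bounded_Fubini[where B = 1]) (measurable, rule g_mult_bound)
  also have "\<dots> = (\<integral>R. 0 \<partial>N)"
  proof (rule integral_cong_AE)
    show "AE R in N. (\<integral>y. g (R *v x) * g (R *v y) \<partial>S) = 0"
      using AE_isometry by eventually_elim (use integral_S_mult_vec[OF _ g_meas] g_mean in auto)
  qed auto
  finally show ?thesis by simp
qed

text \<open>With P the overlap operator and q = P g, the left-hand side is Q = <g, P g>. By
  \<open>overlap_convolution\<close> the squared norm of q is (m2 - m11) Q <= L Q for positive Q, so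
  Cauchy-Schwarz bounds Q by L \<sigma>.\<close>

lemma integral_corr_overlap:
  assumes ij: "i \<noteq> j" and card: "CARD('n) \<ge> 3"
  shows "(\<integral>y. corr (axis j 1) y * overlap y (axis j 1) \<partial>S) \<le>
    3 / ((real CARD('n) - 1) * (real CARD('n) + 1)) * (\<integral>y. (g y)\<^sup>2 \<partial>S)"
proof -
  define L where "L = 3 / ((real CARD('n) - 1) * (real CARD('n) + 1))"
  have L: "L > 0" using card by (simp add: L_def)
  define \<sigma> where "\<sigma> = (\<integral>y. (g y)\<^sup>2 \<partial>S)"
  have \<sigma>: "\<sigma> \<ge> 0" by (simp add: \<sigma>_def)
  define q where "q = (\<lambda>x. \<integral>y. g y * overlap y x \<partial>S)"
  define Q where "Q = (\<integral>y. corr (axis j 1) y * overlap y (axis j 1) \<partial>S)"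
  have go: "\<bar>g y * overlap x z\<bar> \<le> 1" for x y z
    using g_bound[of y] overlap_bounds(3)[of x z] by (simp add: abs_mult mult_le_one)
  have goi: "integrable S (\<lambda>y. g y * overlap y x)" for x
    by (rule integrable_S[where B = 1]) (use go in auto)
  have q [measurable]: "q \<in> borel_measurable borel" unfolding q_def by measurable
  have q1: "\<bar>q x\<bar> \<le> 1" for x
  proof -
    have "\<bar>q x\<bar> \<le> (\<integral>y. \<bar>g y * overlap y x\<bar> \<partial>S)" unfolding q_def by (rule integral_abs_bound)
    also have "\<dots> \<le> (\<integral>y. 1 \<partial>S)" using go goi by (intro integral_mono) auto
    finally show ?thesis using S.prob_space by simp
  qed
  have Q: "Q = (\<integral>x. g x * q x \<partial>S)"
  proof -
    have "Q = (\<integral>y. (\<integral>R. g (R *v axis j 1) * g (R *v y) * overlap y (axis j 1) \<partial>N) \<partial>S)"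
      unfolding Q_def corr_def by simp
    also have "\<dots> = (\<integral>R. (\<integral>y. g (R *v axis j 1) * g (R *v y) * overlap y (axis j 1) \<partial>S) \<partial>N)"
    proof (rule NS.bounded_Fubini[where B = 1])
      show "\<bar>g (R *v axis j 1) * g (R *v y) * overlap y (axis j 1)\<bar> \<le> 1" for R y
        using g_mult_bound[of "R *v axis j 1" "R *v y"] overlap_bounds(3)[of y "axis j 1"]
        unfolding abs_mult[of "_ * _"] by (intro mult_le_one) auto
    qed measurable
    also have "\<dots> = (\<integral>R. g (R *v axis j 1) * q (R *v axis j 1) \<partial>N)"
    proof (rule integral_cong_AE)
      show "AE R in N. (\<integral>y. g (R *v axis j 1) * g (R *v y) * overlap y (axis j 1) \<partial>S) = g (R *v axis j 1) * q (R *v axis j 1)"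
        using AE_isometry
      proof eventually_elim
        fix R :: "'k ^ 'n ^ 'n" assume R: "R \<in> isometry_group"
        have "q (R *v axis j 1) = (\<integral>y. g (R *v y) * overlap (R *v y) (R *v axis j 1) \<partial>S)"
          unfolding q_def by (rule integral_S_mult_vec[OF R, symmetric]) measurable
        then show "(\<integral>y. g (R *v axis j 1) * g (R *v y) * overlap y (axis j 1) \<partial>S) = g (R *v axis j 1) * q (R *v axis j 1)"
          by (simp add: overlap_isometry[OF R] mult.assoc)
      qed
    qed auto
    also have "\<dots> = (\<integral>x. g x * q x \<partial>S)"
      by (rule integral_mult_vec) auto
    finally show ?thesis .
  qed
  define m2 where "m2 = (\<integral>x. ((norm (x $ j))\<^sup>2)\<^sup>2 \<partial>S)"
  define m11 where "m11 = (\<integral>x. (norm (x $ j))\<^sup>2 * (norm (x $ i))\<^sup>2 \<partial>S)"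
  have m11: "m11 \<ge> 0" unfolding m11_def by (intro integral_nonneg_AE) auto
  \<comment> \<open>Dividing by 1 - |y_i|^2 only enlarges the integrand, so the moment on the full
    sphere inherits the bound from the sphere of one dimension less.\<close>
  have m2: "m2 \<le> L"
  proof -
    have "m2 \<le> (\<integral>y. ((norm (y $ j))\<^sup>2 / (1 - (norm (y $ i))\<^sup>2))\<^sup>2 \<partial>S)"
      unfolding m2_def
    proof (rule integral_mono_AE)
      show "integrable S (\<lambda>y. ((norm (y $ j))\<^sup>2)\<^sup>2)"
        using norm_coordinate_le1 by (intro integrable_S[where B = 1]; simp add: power_le_one)
      show "integrable S (\<lambda>y. ((norm (y $ j))\<^sup>2 / (1 - (norm (y $ i))\<^sup>2))\<^sup>2)"
      proof (rule integrable_S[where B = 1])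
        fix y :: "'k ^ 'n" assume y: "norm y = 1"
        have "(norm (y $ i))\<^sup>2 + (norm (y $ j))\<^sup>2 = (\<Sum>k\<in>{i, j}. (norm (y $ k))\<^sup>2)" using ij by simp
        also have "\<dots> \<le> (norm y)\<^sup>2" unfolding norm_vec_power2 by (intro sum_mono2) auto
        finally have "(norm (y $ j))\<^sup>2 \<le> 1 - (norm (y $ i))\<^sup>2" using y by simp
        then have "(norm (y $ j))\<^sup>2 / (1 - (norm (y $ i))\<^sup>2) \<le> 1" "0 \<le> (norm (y $ j))\<^sup>2 / (1 - (norm (y $ i))\<^sup>2)"
          using norm_coordinate_le[OF y, of i] by (auto simp: divide_le_eq_1)
        then show "\<bar>((norm (y $ j))\<^sup>2 / (1 - (norm (y $ i))\<^sup>2))\<^sup>2\<bar> \<le> 1" by (simp add: power_le_one)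
      qed measurable
      show "AE y in S. ((norm (y $ j))\<^sup>2)\<^sup>2 \<le> ((norm (y $ j))\<^sup>2 / (1 - (norm (y $ i))\<^sup>2))\<^sup>2"
        using AE_coordinate_less_1[OF ij]
      proof eventually_elim
        fix y :: "'k ^ 'n" assume "norm y = 1 \<and> (norm (y $ i))\<^sup>2 < 1"
        then have "(norm (y $ j))\<^sup>2 \<le> (norm (y $ j))\<^sup>2 / (1 - (norm (y $ i))\<^sup>2)"
          by (simp add: le_divide_eq mult_left_le)
        then show "((norm (y $ j))\<^sup>2)\<^sup>2 \<le> ((norm (y $ j))\<^sup>2 / (1 - (norm (y $ i))\<^sup>2))\<^sup>2"
          by (rule power_mono) simp
      qed
    qed
    also have "\<dots> \<le> L" unfolding L_def by (rule fourth_moment[OF ij card])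
    finally show ?thesis .
  qed
  have qq: "(\<integral>x. (q x)\<^sup>2 \<partial>S) = (m2 - m11) * Q"
  proof -
    have b1: "\<bar>g y * overlap y x * (g z * overlap z x)\<bar> \<le> 1" for x y z
      using go[of y y x] go[of z z x] unfolding abs_mult[of "_ * _" "_ * _"] by (intro mult_le_one) auto
    have "(\<integral>x. (q x)\<^sup>2 \<partial>S) = (\<integral>x. (\<integral>y. g y * overlap y x * q x \<partial>S) \<partial>S)"
      by (simp add: power2_eq_square q_def)
    also have "\<dots> = (\<integral>y. (\<integral>x. g y * overlap y x * q x \<partial>S) \<partial>S)"
    proof (rule SS.bounded_Fubini[where B = 1])
      show "\<bar>g y * overlap y x * q x\<bar> \<le> 1" for x y
        using go[of y y x] q1[of x] unfolding abs_mult[of "_ * _"] by (intro mult_le_one) auto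
    qed measurable
    also have "\<dots> = (\<integral>y. g y * (m2 - m11) * q y \<partial>S)"
    proof (rule integral_cong_AE)
      show "AE y in S. (\<integral>x. g y * overlap y x * q x \<partial>S) = g y * (m2 - m11) * q y"
        using AE_norm_S
      proof eventually_elim
        fix y :: "'k ^ 'n" assume y: "norm y = 1"
        have "(\<integral>x. g y * overlap y x * q x \<partial>S) = (\<integral>x. (\<integral>z. g y * overlap y x * (g z * overlap z x) \<partial>S) \<partial>S)"
          by (simp add: q_def)
        also have "\<dots> = (\<integral>z. (\<integral>x. g y * overlap y x * (g z * overlap z x) \<partial>S) \<partial>S)"
          by (rule SS.bounded_Fubini[where B = 1]) (measurable, rule b1)
        also have "\<dots> = (\<integral>z. g y * (m11 * g z + (m2 - m11) * (g z * overlap z y)) \<partial>S)"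
        proof (rule integral_cong_AE)
          show "AE z in S. (\<integral>x. g y * overlap y x * (g z * overlap z x) \<partial>S) = g y * (m11 * g z + (m2 - m11) * (g z * overlap z y))"
            using AE_norm_S
          proof eventually_elim
            fix z :: "'k ^ 'n" assume z: "norm z = 1"
            have "(\<integral>x. g y * overlap y x * (g z * overlap z x) \<partial>S) = (\<integral>x. g y * g z * (overlap y x * overlap z x) \<partial>S)"
              by (simp add: mult_ac)
            also have "\<dots> = g y * g z * (m11 + (m2 - m11) * overlap z y)"
              using overlap_convolution[OF ij y z] by (simp add: m2_def m11_def)
            finally show "(\<integral>x. g y * overlap y x * (g z * overlap z x) \<partial>S) = g y * (m11 * g z + (m2 - m11) * (g z * overlap z y))"
              by (simp add: algebra_simps)
          qed
        qed auto
        also have "\<dots> = g y * (m11 * (\<integral>z. g z \<partial>S) + (m2 - m11) * q y)"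
          using goi integrable_S[of g 1] g_bound by (simp add: q_def)
        finally show "(\<integral>x. g y * overlap y x * q x \<partial>S) = g y * (m2 - m11) * q y"
          by (simp add: g_mean)
      qed
    qed auto
    also have "\<dots> = (m2 - m11) * Q"
      unfolding Q by (simp add: mult_ac flip: integral_mult_right_zero)
    finally show ?thesis .
  qed
  show ?thesis
  \<comment> \<open>Positivity of Q is what allows replacing m2 - m11 by L; otherwise the claim is
    trivial.\<close>
  proof (cases "Q \<le> 0")
    case True
    then show ?thesis using L \<sigma> unfolding L_def[symmetric] \<sigma>_def[symmetric] Q_def[symmetric]
      by (meson mult_nonneg_nonneg less_imp_le order_trans)
  next
    case False
    have i1: "integrable S (\<lambda>y. (g y)\<^sup>2)" "integrable S (\<lambda>y. (q y)\<^sup>2)"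
      by (rule integrable_S[where B = 1]; use g_bound q1 in \<open>auto simp: abs_square_le_1\<close>)+
    \<comment> \<open>Cauchy-Schwarz in the form 2 g q <= L g^2 + q^2 / L; with this weight the
      second term contributes at most Q / 2 and is absorbed on the left.\<close>
    have "Q \<le> (\<integral>x. (L * (g x)\<^sup>2 + (q x)\<^sup>2 / L) / 2 \<partial>S)"
      unfolding Q
    proof (rule integral_mono)
      show "integrable S (\<lambda>x. g x * q x)"
        by (rule integrable_S[where B = 1]) (use g_bound q1 in \<open>auto simp: abs_mult mult_le_one\<close>)
      fix x
      have "0 \<le> (L * g x - q x)\<^sup>2 / L" using L by simp
      also have "\<dots> = L * (g x)\<^sup>2 + (q x)\<^sup>2 / L - 2 * (g x * q x)"
        using L by (simp add: power2_eq_square field_simps)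
      finally show "g x * q x \<le> (L * (g x)\<^sup>2 + (q x)\<^sup>2 / L) / 2" by simp
    qed (use i1 in auto)
    also have "\<dots> = (L * \<sigma> + (m2 - m11) * Q / L) / 2"
      using i1 by (simp add: qq \<sigma>_def)
    finally have "Q \<le> (L * \<sigma> + (m2 - m11) * Q / L) / 2" .
    moreover have "(m2 - m11) * Q / L \<le> Q"
      using m2 m11 L False by (simp add: divide_le_eq mult.commute[of Q] mult_right_mono)
    ultimately show ?thesis
      unfolding L_def[symmetric] \<sigma>_def[symmetric] Q_def[symmetric] by (rule le_if_le_average)
  qed
qed

text \<open>A single inner product is invisible to integrals over S. Writing \<kappa> 0 as the mean
  of \<open>g (R *v axis i 1) * D R\<close> and applying Cauchy-Schwarz reduces the claim to the
  second moment of D, which is an integral of \<kappa> against the density C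
  \<open>wt\<close>.\<close>

lemma corr_orthogonal_le:
  assumes card: "CARD('n) \<ge> 3" and b: "norm b = 1" "norm b' = 1" "herm b b' = 0"
  shows "corr b b' \<le> 3 / (real CARD('n) - 1) * (\<integral>y. (g y)\<^sup>2 \<partial>S)"
proof -
  have "card {undefined :: 'n} \<noteq> CARD('n)" using card by simp
  then have "{undefined :: 'n} \<noteq> UNIV" by metis
  then obtain i j :: 'n where ij: "i \<noteq> j" by auto
  define d where "d = real CARD('n)"
  have d: "d \<ge> 3" using card by (simp add: d_def)
  define L where "L = 3 / ((d - 1) * (d + 1))"
  have L: "L > 0" using d by (simp add: L_def)
  define \<sigma> where "\<sigma> = (\<integral>y. (g y)\<^sup>2 \<partial>S)"
  have \<sigma>: "\<sigma> \<ge> 0" by (simp add: \<sigma>_def)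
  \<comment> \<open>The normalized projection off axis i turns a uniform point of the sphere into a
    random unit vector orthogonal to that axis.\<close>
  define v where "v = (\<lambda>y::'k ^ 'n. sgn (y - axis i (y $ i)))"
  have ax [measurable]: "(\<lambda>y::'k ^ 'n. axis i (y $ i)) \<in> borel_measurable borel"
    unfolding coord_proj_axis[symmetric] by measurable
  have v_meas [measurable]: "v \<in> borel_measurable borel" unfolding v_def by measurable
  have v: "AE y in S. norm (v y) = 1 \<and> herm (axis i 1) (v y) = 0 \<and> v y $ j = y $ j /\<^sub>R sqrt (1 - (norm (y $ i))\<^sup>2)"
    using AE_coordinate_less_1[OF ij]
  proof eventually_elim
    fix y :: "'k ^ 'n" assume y: "norm y = 1 \<and> (norm (y $ i))\<^sup>2 < 1"
    have n: "norm (y - axis i (y $ i)) = sqrt (1 - (norm (y $ i))\<^sup>2)" using y by (simp add: norm_diff_axis)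
    then have "norm (v y) = 1" using y by (auto simp: v_def norm_sgn)
    moreover have "v y $ i = 0" by (simp add: v_def sgn_div_norm)
    then have "herm (axis i 1) (v y) = 0" using cj_herm[of "v y" "axis i 1"] by (simp add: herm_axis_right)
    moreover have "v y $ j = y $ j /\<^sub>R sqrt (1 - (norm (y $ i))\<^sup>2)"
      using ij by (simp add: v_def sgn_div_norm n) (simp add: axis_def)
    ultimately show "norm (v y) = 1 \<and> herm (axis i 1) (v y) = 0 \<and> v y $ j = y $ j /\<^sub>R sqrt (1 - (norm (y $ i))\<^sup>2)" by simp
  qed
  \<comment> \<open>The correlation as a function of the inner product s, evaluated at the standard
    pair; boundedness is claimed only for norm s <= 1.\<close>
  define \<kappa> where "\<kappa> = (\<lambda>s. corr (axis j 1) (pair_vec j i s))"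
  have \<kappa>_meas [measurable]: "\<kappa> \<in> borel_measurable borel"
    unfolding \<kappa>_def pair_vec_def by measurable
  have corr_\<kappa>: "corr x y = \<kappa> (herm y x)" if "norm x = 1" "norm y = 1" for x y
    unfolding \<kappa>_def
  proof (rule corr_eq[OF that norm_axis_one norm_pair_vec])
    show "j \<noteq> i" using ij by simp
    show "norm (herm y x) \<le> 1" using that by (intro norm_herm_le)
    have "herm (pair_vec j i (herm y x)) (axis j 1) = herm y x"
      using ij by (simp add: herm_axis_right) (simp add: pair_vec_def axis_def)
    then show "herm x y = herm (axis j 1) (pair_vec j i (herm y x))"
      by (metis cj_herm)
  qed
  have \<kappa>_bound: "\<bar>\<kappa> s\<bar> \<le> \<sigma>" if "norm s \<le> 1" for s
    unfolding \<kappa>_def \<sigma>_def using that ij by (intro corr_bound norm_pair_vec) auto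
  have k0: "corr b b' = \<kappa> 0"
    using corr_\<kappa>[OF b(1,2)] b(3) cj_herm[of b b'] by simp
  \<comment> \<open>\<open>D R = (T g) (R e\<^sub>i)\<close>, since \<open>v y\<close> is uniform on the unit sphere orthogonal to \<open>e\<^sub>i\<close>.\<close>
  define D where "D = (\<lambda>R. \<integral>y. g (R *v v y) \<partial>S)"
  have D_meas [measurable]: "D \<in> borel_measurable borel" unfolding D_def by measurable
  have gi: "integrable S (\<lambda>y. g (R *v v y))" for R
    by (rule integrable_S[where B = 1]) (use g_bound in auto)
  have D1: "\<bar>D R\<bar> \<le> 1" for R
  proof -
    have "\<bar>D R\<bar> \<le> (\<integral>y. \<bar>g (R *v v y)\<bar> \<partial>S)" unfolding D_def by (rule integral_abs_bound)
    also have "\<dots> \<le> (\<integral>y. 1 \<partial>S)" using g_bound gi by (intro integral_mono) auto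
    finally show ?thesis using S.prob_space by simp
  qed
  have gD: "\<bar>g x * D R\<bar> \<le> 1" for x R using g_bound[of x] D1[of R] by (simp add: abs_mult mult_le_one)
  have k0D: "\<kappa> 0 = (\<integral>R. g (R *v axis i 1) * D R \<partial>N)"
  proof -
    have "\<kappa> 0 = (\<integral>y. \<kappa> 0 \<partial>S)" using S.prob_space by simp
    also have "\<dots> = (\<integral>y. corr (axis i 1) (v y) \<partial>S)"
    proof (rule integral_cong_AE)
      show "AE y in S. \<kappa> 0 = corr (axis i 1) (v y)"
        using v
      proof eventually_elim
        fix y :: "'k ^ 'n" assume y: "norm (v y) = 1 \<and> herm (axis i 1) (v y) = 0 \<and> v y $ j = y $ j /\<^sub>R sqrt (1 - (norm (y $ i))\<^sup>2)"
        then show "\<kappa> 0 = corr (axis i 1) (v y)"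
          using corr_\<kappa>[of "axis i 1" "v y"] cj_herm[of "axis i 1" "v y"] by simp
      qed
    qed auto
    also have "\<dots> = (\<integral>R. (\<integral>y. g (R *v axis i 1) * g (R *v v y) \<partial>S) \<partial>N)"
      unfolding corr_def by (rule NS.bounded_Fubini[where B = 1]) (measurable, rule g_mult_bound)
    finally show ?thesis by (simp add: D_def)
  qed
  have X: "(\<integral>R. (D R)\<^sup>2 \<partial>N) = (\<integral>y. \<kappa> (y $ j /\<^sub>R sqrt (1 - (norm (y $ i))\<^sup>2)) \<partial>S)"
  proof -
    have "(\<integral>R. (D R)\<^sup>2 \<partial>N) = (\<integral>R. (\<integral>y. g (R *v v y) * D R \<partial>S) \<partial>N)"
      by (simp add: power2_eq_square D_def)
    also have "\<dots> = (\<integral>y. (\<integral>R. g (R *v v y) * D R \<partial>N) \<partial>S)"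
      by (rule NS.bounded_Fubini[where B = 1, symmetric]) (measurable, rule gD)
    also have "\<dots> = (\<integral>y. (\<integral>y'. \<kappa> (y' $ j /\<^sub>R sqrt (1 - (norm (y' $ i))\<^sup>2)) \<partial>S) \<partial>S)"
    proof (rule integral_cong_AE)
      show "AE y in S. (\<integral>R. g (R *v v y) * D R \<partial>N) = (\<integral>y'. \<kappa> (y' $ j /\<^sub>R sqrt (1 - (norm (y' $ i))\<^sup>2)) \<partial>S)"
        using v
      proof eventually_elim
        fix y :: "'k ^ 'n" assume y: "norm (v y) = 1 \<and> herm (axis i 1) (v y) = 0 \<and> v y $ j = y $ j /\<^sub>R sqrt (1 - (norm (y $ i))\<^sup>2)"
        have "herm (axis i 1) (axis j 1) = herm (axis i 1) (v y)"
          using y ij by (simp add: herm_axis_right) (simp add: axis_def)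
        \<comment> \<open>U stabilizes axis i and hence commutes with v. Carrying axis j to
          \<open>v y\<close>, it makes the integral over y' independent of y.\<close>
        then obtain U where U: "U \<in> isometry_group" "U *v axis i 1 = axis i 1" "U *v axis j 1 = v y"
          using isometry_pair[OF norm_axis_one norm_axis_one norm_axis_one] y by metis
        have axs: "axis i s = s *s (axis i 1 :: 'k ^ 'n)" for s by (simp add: vec_eq_iff axis_def)
        have vU: "v (U *v y') = U *v v y'" for y'
        proof -
          have "(U *v y') $ i = y' $ i"
            using herm_isometry[OF U(1), of y' "axis i 1"] by (simp add: U(2) herm_axis_right)
          then have "U *v y' - axis i ((U *v y') $ i) = U *v (y' - axis i (y' $ i))"
            unfolding axs[of "_ $ _"] by (simp add: matrix_vector_mult_diff_distrib vector_scalar_commute U(2))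
          then show ?thesis
            unfolding v_def sgn_div_norm by (simp add: norm_isometry[OF U(1)] mult_vec_scaleR)
        qed
        have "(\<integral>R. g (R *v v y) * D R \<partial>N) = (\<integral>R. (\<integral>y'. g (R *v v y) * g (R *v v y') \<partial>S) \<partial>N)"
          by (simp add: D_def)
        also have "\<dots> = (\<integral>y'. corr (v y) (v y') \<partial>S)"
          unfolding corr_def by (rule NS.bounded_Fubini[where B = 1, symmetric]) (measurable, rule g_mult_bound)
        also have "\<dots> = (\<integral>y'. corr (v y) (v (U *v y')) \<partial>S)"
          by (rule integral_S_mult_vec[OF U(1), symmetric]) measurable
        also have "\<dots> = (\<integral>y'. corr (axis j 1) (v y') \<partial>S)"
          unfolding vU U(3)[symmetric] corr_isometry[OF U(1)] ..
        also have "\<dots> = (\<integral>y'. \<kappa> (y' $ j /\<^sub>R sqrt (1 - (norm (y' $ i))\<^sup>2)) \<partial>S)"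
        proof (rule integral_cong_AE)
          show "AE y' in S. corr (axis j 1) (v y') = \<kappa> (y' $ j /\<^sub>R sqrt (1 - (norm (y' $ i))\<^sup>2))"
            using v by eventually_elim (simp add: corr_\<kappa> herm_axis_right)
        qed auto
        finally show "(\<integral>R. g (R *v v y) * D R \<partial>N) = (\<integral>y'. \<kappa> (y' $ j /\<^sub>R sqrt (1 - (norm (y' $ i))\<^sup>2)) \<partial>S)" .
      qed
    qed auto
    finally show ?thesis using S.prob_space by simp
  qed
  obtain C where C: "C > 0" and law: "\<forall>\<phi>\<in>borel_measurable borel.
     (\<integral>y. \<phi> (y $ j /\<^sub>R sqrt (1 - (norm (y $ i))\<^sup>2)) \<partial>S) = (\<integral>y. \<phi> (y $ j) * (C * wt (y $ j) :: real) \<partial>S)"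
    using coordinate_law[OF ij card] by blast
  have w1: "(\<integral>y. C * wt (y $ j) \<partial>S) = 1"
    using law[THEN bspec, of "\<lambda>_. 1"] S.prob_space by simp
  \<comment> \<open>A non-integrable function has Bochner integral 0, so the value 1 in
    \<open>w1\<close> already forces integrability of the unbounded weight.\<close>
  have wi: "integrable S (\<lambda>y. C * wt (y $ j))"
    using w1 not_integrable_integral_eq by force
  have ji: "j \<noteq> i" using ij by simp
  note less1 = AE_coordinate_less_1[OF ji]
  have C1: "C \<le> 1"
  proof -
    have "(\<integral>y. C \<partial>S) \<le> (\<integral>y. C * wt (y $ j) \<partial>S)"
    proof (rule integral_mono_AE)
      show "AE y in S. C \<le> C * wt (y $ j)"
        using less1 by eventually_elim (use weight_bounds(1) C in auto)
    qed (use wi in auto)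
    then show ?thesis using w1 S.prob_space by simp
  qed
  \<comment> \<open>The coefficient of p in the expansion of \<open>wt\<close>: 1/2 over the reals,
    1 over the complex numbers.\<close>
  define \<beta> where "\<beta> = real DIM('k) / 2"
  have \<beta>: "0 \<le> \<beta>" "\<beta> \<le> 1" using DIM_le_2 by (auto simp: \<beta>_def)
  define r where "r = (\<lambda>y::'k ^ 'n. wt (y $ j) - 1 - \<beta> * (norm (y $ j))\<^sup>2)"
  have r_meas [measurable]: "r \<in> borel_measurable borel" unfolding r_def by measurable
  \<comment> \<open>The coordinate law is read backwards here: the weighted mean of p^2 is the
    fourth moment on the orthogonal complement.\<close>
  have Cwj: "(\<integral>y. ((norm (y $ j))\<^sup>2)\<^sup>2 * (C * wt (y $ j)) \<partial>S) \<le> L"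
  proof -
    have "(\<integral>y. ((norm (y $ j))\<^sup>2)\<^sup>2 * (C * wt (y $ j)) \<partial>S) =
        (\<integral>y. ((norm (y $ j /\<^sub>R sqrt (1 - (norm (y $ i))\<^sup>2)))\<^sup>2)\<^sup>2 \<partial>S)"
      by (rule law[THEN bspec, of "\<lambda>s. ((norm s)\<^sup>2)\<^sup>2", symmetric]) measurable
    also have "\<dots> = (\<integral>y. ((norm (y $ j))\<^sup>2 / (1 - (norm (y $ i))\<^sup>2))\<^sup>2 \<partial>S)"
    proof (rule integral_cong_AE)
      show "AE y in S. ((norm (y $ j /\<^sub>R sqrt (1 - (norm (y $ i))\<^sup>2)))\<^sup>2)\<^sup>2 = ((norm (y $ j))\<^sup>2 / (1 - (norm (y $ i))\<^sup>2))\<^sup>2"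
        using AE_coordinate_less_1[OF ij]
        by eventually_elim (simp add: power_mult_distrib power_inverse divide_inverse mult.commute)
    qed auto
    also have "\<dots> \<le> L" unfolding L_def d_def by (rule fourth_moment[OF ij card])
    finally show ?thesis .
  qed
  have bi: "integrable S (\<lambda>y. \<phi> y * (C * wt (y $ j)))"
    if "\<phi> \<in> borel_measurable borel" "\<And>y. norm y = 1 \<Longrightarrow> \<bar>\<phi> y\<bar> \<le> B" for \<phi> B
  proof (rule Bochner_Integration.integrable_bound)
    show "integrable S (\<lambda>y. B * (C * wt (y $ j)))" using wi by simp
    show "AE y in S. norm (\<phi> y * (C * wt (y $ j))) \<le> norm (B * (C * wt (y $ j)))"
      using AE_norm_S
    proof eventually_elim
      fix y :: "'k ^ 'n" assume "norm y = 1"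
      then have "\<bar>\<phi> y\<bar> \<le> \<bar>B\<bar>" using that(2)[of y] by linarith
      then show "norm (\<phi> y * (C * wt (y $ j))) \<le> norm (B * (C * wt (y $ j)))"
        unfolding real_norm_def abs_mult[of _ "C * wt (y $ j)"] by (intro mult_right_mono) auto
    qed
  qed (use that in auto)
  have p1: "\<bar>(norm (y $ j))\<^sup>2\<bar> \<le> 1" "\<bar>((norm (y $ j))\<^sup>2)\<^sup>2\<bar> \<le> 1" "\<bar>\<kappa> (y $ j)\<bar> \<le> \<sigma>"
    "\<bar>\<kappa> (y $ j) * (norm (y $ j))\<^sup>2\<bar> \<le> \<sigma>" if "norm y = 1" for y :: "'k ^ 'n"
  proof -
    have 1: "norm (y $ j) \<le> 1" using norm_coordinate_le1[OF that] .
    then show "\<bar>(norm (y $ j))\<^sup>2\<bar> \<le> 1" "\<bar>((norm (y $ j))\<^sup>2)\<^sup>2\<bar> \<le> 1" by (simp_all add: power_le_one)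
    show 2: "\<bar>\<kappa> (y $ j)\<bar> \<le> \<sigma>" using \<kappa>_bound[OF 1] .
    show "\<bar>\<kappa> (y $ j) * (norm (y $ j))\<^sup>2\<bar> \<le> \<sigma>"
      using mult_mono[OF 2, of "(norm (y $ j))\<^sup>2" 1] 1 \<sigma> by (simp add: abs_mult power_le_one)
  qed
  have \<kappa>i: "integrable S (\<lambda>y. \<kappa> (y $ j))" "integrable S (\<lambda>y. \<kappa> (y $ j) * (norm (y $ j))\<^sup>2)"
    by (rule integrable_S[where B = \<sigma>]; use p1 in auto)+
  have \<kappa>w: "integrable S (\<lambda>y. \<kappa> (y $ j) * (C * wt (y $ j)))"
    by (rule bi[of _ \<sigma>]) (use p1 in auto)
  have Cr: "integrable S (\<lambda>y. C * r y)"
  proof -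
    have "integrable S (\<lambda>y. (norm (y $ j))\<^sup>2)" by (rule integrable_S[where B = 1]) (use p1 in auto)
    then have "integrable S (\<lambda>y. C * wt (y $ j) - C - C * \<beta> * (norm (y $ j))\<^sup>2)" using wi by auto
    then show ?thesis by (simp add: r_def algebra_simps)
  qed
  have r_le: "(\<integral>y. C * r y \<partial>S) \<le> L"
  proof -
    have "(\<integral>y. C * r y \<partial>S) \<le> (\<integral>y. ((norm (y $ j))\<^sup>2)\<^sup>2 * (C * wt (y $ j)) \<partial>S)"
    proof (rule integral_mono_AE[OF Cr])
      show "integrable S (\<lambda>y. ((norm (y $ j))\<^sup>2)\<^sup>2 * (C * wt (y $ j)))"
        by (rule bi[of _ 1]) (use p1 in auto)
      show "AE y in S. C * r y \<le> ((norm (y $ j))\<^sup>2)\<^sup>2 * (C * wt (y $ j))"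
        using less1
      proof eventually_elim
        fix y :: "'k ^ 'n" assume "norm y = 1 \<and> (norm (y $ j))\<^sup>2 < 1"
        then have "r y \<le> ((norm (y $ j))\<^sup>2)\<^sup>2 * wt (y $ j)"
          unfolding r_def \<beta>_def by (intro weight_bounds(3)) simp
        then show "C * r y \<le> ((norm (y $ j))\<^sup>2)\<^sup>2 * (C * wt (y $ j))"
          using C mult_left_mono[of "r y" _ C] by (simp add: mult_ac)
      qed
    qed
    then show ?thesis using Cwj by simp
  qed
  have XL: "(\<integral>R. (D R)\<^sup>2 \<partial>N) \<le> 2 * L * \<sigma>"
  proof -
    have unit_corr: "AE y in S. \<kappa> (y $ j) = corr (axis j 1) y"
      using AE_norm_S by eventually_elim (simp add: corr_\<kappa> herm_axis_right)
    have \<kappa>0: "(\<integral>y. \<kappa> (y $ j) \<partial>S) = 0"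
      unfolding integral_corr[of "axis j 1", symmetric] by (rule integral_cong_AE) (use unit_corr in auto)
    have "(\<integral>y. \<kappa> (y $ j) * (norm (y $ j))\<^sup>2 \<partial>S) = (\<integral>y. corr (axis j 1) y * overlap y (axis j 1) \<partial>S)"
    proof (rule integral_cong_AE)
      show "AE y in S. \<kappa> (y $ j) * (norm (y $ j))\<^sup>2 = corr (axis j 1) y * overlap y (axis j 1)"
        using unit_corr AE_norm_S by eventually_elim (simp add: overlap_axis)
    qed auto
    also have "\<dots> \<le> L * \<sigma>"
      unfolding L_def d_def \<sigma>_def by (rule integral_corr_overlap[OF ij card])
    finally have \<kappa>1: "(\<integral>y. \<kappa> (y $ j) * (norm (y $ j))\<^sup>2 \<partial>S) \<le> L * \<sigma>" .
    have \<kappa>r: "integrable S (\<lambda>y. \<kappa> (y $ j) * (C * r y))"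
    proof -
      have "integrable S (\<lambda>y. \<kappa> (y $ j) * (C * wt (y $ j)) - C * \<kappa> (y $ j) - C * \<beta> * (\<kappa> (y $ j) * (norm (y $ j))\<^sup>2))"
        using \<kappa>i \<kappa>w by auto
      then show ?thesis by (simp add: r_def algebra_simps)
    qed
    have "(\<integral>R. (D R)\<^sup>2 \<partial>N) = (\<integral>y. \<kappa> (y $ j) * (C * wt (y $ j)) \<partial>S)"
      unfolding X by (rule law[THEN bspec]) measurable
    \<comment> \<open>Three terms of the expansion: the constant one integrates to 0, the linear one
      costs L \<sigma> since C \<beta> <= 1, and the remainder costs \<sigma> L since it is
      nonnegative and |\<kappa>| <= \<sigma>.\<close>
    also have "\<dots> = (\<integral>y. C * \<kappa> (y $ j) + C * \<beta> * (\<kappa> (y $ j) * (norm (y $ j))\<^sup>2) + \<kappa> (y $ j) * (C * r y) \<partial>S)"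
      by (rule Bochner_Integration.integral_cong[OF refl]) (simp add: r_def algebra_simps)
    also have "\<dots> = C * \<beta> * (\<integral>y. \<kappa> (y $ j) * (norm (y $ j))\<^sup>2 \<partial>S) + (\<integral>y. \<kappa> (y $ j) * (C * r y) \<partial>S)"
      using \<kappa>i \<kappa>r \<kappa>0 by simp
    also have "\<dots> \<le> L * \<sigma> + \<sigma> * L"
    proof (rule add_mono)
      have "C * \<beta> * (\<integral>y. \<kappa> (y $ j) * (norm (y $ j))\<^sup>2 \<partial>S) \<le> C * \<beta> * (L * \<sigma>)"
        using \<kappa>1 C \<beta> by (intro mult_left_mono) auto
      also have "\<dots> \<le> 1 * (L * \<sigma>)"
        using C C1 \<beta> L \<sigma> by (intro mult_right_mono mult_le_one) auto
      finally show "C * \<beta> * (\<integral>y. \<kappa> (y $ j) * (norm (y $ j))\<^sup>2 \<partial>S) \<le> L * \<sigma>" by simp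
      have "(\<integral>y. \<kappa> (y $ j) * (C * r y) \<partial>S) \<le> (\<integral>y. \<sigma> * (C * r y) \<partial>S)"
      proof (rule integral_mono_AE[OF \<kappa>r])
        show "AE y in S. \<kappa> (y $ j) * (C * r y) \<le> \<sigma> * (C * r y)"
          using less1
        proof eventually_elim
          fix y :: "'k ^ 'n" assume y: "norm y = 1 \<and> (norm (y $ j))\<^sup>2 < 1"
          then have "r y \<ge> 0" unfolding r_def \<beta>_def by (intro weight_bounds(2)) simp
          moreover have "\<kappa> (y $ j) \<le> \<sigma>" using p1(3)[of y] y by simp
          ultimately show "\<kappa> (y $ j) * (C * r y) \<le> \<sigma> * (C * r y)" using C by (intro mult_right_mono) auto
        qed
      qed (use Cr in auto)
      also have "\<dots> = \<sigma> * (\<integral>y. C * r y \<partial>S)" by (rule integral_mult_right_zero)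
      also have "\<dots> \<le> \<sigma> * L" using r_le \<sigma> by (rule mult_left_mono)
      finally show "(\<integral>y. \<kappa> (y $ j) * (C * r y) \<partial>S) \<le> \<sigma> * L" .
    qed
    finally show ?thesis by simp
  qed
  \<comment> \<open>The largest bound the variance count can afford. Its square dominates 2 L,
    because 6 <= 9 and d - 1 <= d + 1.\<close>
  define \<Lambda> where "\<Lambda> = 3 / (d - 1)"
  have \<Lambda>: "\<Lambda> > 0" using d by (simp add: \<Lambda>_def)
  have "6 / ((d - 1) * (d + 1)) \<le> 9 / ((d - 1) * (d - 1))"
    using d by (intro frac_le mult_left_mono) auto
  then have "2 * L \<le> \<Lambda> * \<Lambda>"
    by (simp add: L_def \<Lambda>_def)
  then have X\<Lambda>: "(\<integral>R. (D R)\<^sup>2 \<partial>N) / \<Lambda> \<le> \<Lambda> * \<sigma>"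
    using XL \<Lambda> mult_right_mono[of "2 * L" "\<Lambda> * \<Lambda>" \<sigma>] \<sigma> by (simp add: divide_le_eq mult_ac)
  have gi2: "integrable N (\<lambda>R. (g (R *v axis i 1))\<^sup>2)" "integrable N (\<lambda>R. (D R)\<^sup>2)"
    by (rule integrable_N[where B = 1]; use g_bound D1 in \<open>auto simp: abs_square_le_1\<close>)+
  have "\<kappa> 0 \<le> (\<integral>R. (\<Lambda> * (g (R *v axis i 1))\<^sup>2 + (D R)\<^sup>2 / \<Lambda>) / 2 \<partial>N)"
    unfolding k0D
  proof (rule integral_mono)
    show "integrable N (\<lambda>R. g (R *v axis i 1) * D R)"
      by (rule integrable_N[where B = 1]) (use gD in auto)
    fix R
    have "0 \<le> (\<Lambda> * g (R *v axis i 1) - D R)\<^sup>2 / \<Lambda>" using \<Lambda> by simp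
    also have "\<dots> = \<Lambda> * (g (R *v axis i 1))\<^sup>2 + (D R)\<^sup>2 / \<Lambda> - 2 * (g (R *v axis i 1) * D R)"
      using \<Lambda> by (simp add: power2_eq_square field_simps)
    finally show "g (R *v axis i 1) * D R \<le> (\<Lambda> * (g (R *v axis i 1))\<^sup>2 + (D R)\<^sup>2 / \<Lambda>) / 2" by simp
  qed (use gi2 in auto)
  also have "\<dots> = (\<Lambda> * \<sigma> + (\<integral>R. (D R)\<^sup>2 \<partial>N) / \<Lambda>) / 2"
    using gi2 integral_mult_vec[OF norm_axis_one, of "\<lambda>y. (g y)\<^sup>2" i] by (simp add: \<sigma>_def)
  also have "\<dots> \<le> \<Lambda> * \<sigma>" using X\<Lambda> by simp
  finally show ?thesis unfolding k0 \<Lambda>_def \<sigma>_def d_def .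
qed

end

end

section \<open>Frequencies of orthonormal bases\<close>

context conjugation
begin

lemma isometry_group_borel [measurable]: "(isometry_group :: ('k ^ 'n ^ 'n) set) \<in> sets borel"
  unfolding isometry_group_def by measurable

text \<open>\<open>normalized_haar\<close> provides left invariance only, on the trace of the Borel
  sets. The push-forward along the identity moves the measure to all matrices. Invariance under the
  inverse \<open>adj\<close> converts left into right invariance, and later also trades
  \<open>R\<close> for its inverse in the count of basis vectors.\<close>

lemma
  fixes \<mu> :: "('k ^ 'n ^ 'n) measure"
  assumes haar: "normalized_haar isometry_group \<mu>" and dim: "DIM('k) \<le> 2"
  shows haar_rotation_normalized_haar: "haar_rotation cj (distr \<mu> borel (\<lambda>R. R))"
    and distr_adj_normalized_haar: "distr (distr \<mu> borel (\<lambda>R. R)) borel adj = distr \<mu> borel (\<lambda>R. R)"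
proof -
  define N where "N = distr \<mu> borel (\<lambda>R. R)"
  have sets: "sets \<mu> = sets (restrict_space borel isometry_group)" and prob: "prob_space \<mu>"
    and left: "\<And>U. U \<in> isometry_group \<Longrightarrow> distr \<mu> \<mu> (\<lambda>R. U ** R) = \<mu>"
    using haar by (auto simp: normalized_haar_def)
  have space: "space \<mu> = isometry_group"
    using sets_eq_imp_space_eq[OF sets] by (simp add: space_restrict_space)
  have mb: "f \<in> borel_measurable \<mu>" if "f \<in> borel_measurable borel" for f :: "_ \<Rightarrow> 'k ^ 'n ^ 'n"
    unfolding measurable_cong_sets[OF sets refl] by (rule measurable_restrict_space1[OF that])
  have idm: "(\<lambda>R. R) \<in> borel_measurable \<mu>" by (rule mb) measurable
  interpret N: prob_space N unfolding N_def by (rule prob_space.prob_space_distr[OF prob idm])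
  have sets_N [measurable_cong, simp]: "sets N = sets borel" by (simp add: N_def)
  have AE_N: "AE R in N. R \<in> isometry_group"
    unfolding N_def by (subst AE_distr_iff) (use idm isometry_group_borel AE_space[of \<mu>] in \<open>auto simp: space\<close>)
  have left_N: "distr N borel (\<lambda>R. U ** R) = N" if U: "U \<in> isometry_group" for U
  proof -
    have m: "(\<lambda>R. U ** R) \<in> \<mu> \<rightarrow>\<^sub>M \<mu>"
      unfolding measurable_cong_sets[OF refl sets]
      by (rule measurable_restrict_space2) (auto simp: space intro!: mult_mem_isometry_group[OF U] mb)
    have "distr N borel (\<lambda>R. U ** R) = distr \<mu> borel (\<lambda>R. U ** R)"
      unfolding N_def using idm by (subst distr_distr) (auto simp: comp_def)
    also have "\<dots> = distr (distr \<mu> \<mu> (\<lambda>R. U ** R)) borel (\<lambda>R. R)"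
      using m idm by (subst distr_distr) (auto simp: comp_def)
    finally show ?thesis by (simp add: left[OF U] N_def)
  qed
  \<comment> \<open>\<open>\<nu>\<close> is right invariant, so averaging over a product of independent \<open>\<nu>\<close>- and
    \<open>N\<close>-distributed factors yields both \<open>\<nu>\<close> and \<open>N\<close>.\<close>
  define \<nu> where "\<nu> = distr N borel adj"
  interpret \<nu>: prob_space \<nu> unfolding \<nu>_def by (rule N.prob_space_distr) measurable
  have sets_\<nu> [measurable_cong, simp]: "sets \<nu> = sets borel" by (simp add: \<nu>_def)
  have AE_\<nu>: "AE R in \<nu>. R \<in> isometry_group"
    unfolding \<nu>_def
  proof (subst AE_distr_iff)
    show "AE R in N. adj R \<in> isometry_group"
      using AE_N by eventually_elim (rule adj_mem_isometry_group)
  qed auto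
  have right_\<nu>: "distr \<nu> borel (\<lambda>R. R ** U) = \<nu>" if U: "U \<in> isometry_group" for U
  proof -
    have "distr \<nu> borel (\<lambda>R. R ** U) = distr N borel (\<lambda>R. adj (adj U ** R))"
      unfolding \<nu>_def by (subst distr_distr) (auto simp: comp_def adj_mult)
    also have "\<dots> = distr (distr N borel (\<lambda>R. adj U ** R)) borel adj"
      by (subst distr_distr) (auto simp: comp_def)
    finally show ?thesis by (simp add: left_N[OF adj_mem_isometry_group[OF U]] \<nu>_def)
  qed
  interpret P: pair_sigma_finite \<nu> N ..
  have \<nu>N: "\<nu> = N"
  proof (rule measure_eqI)
    fix A assume "A \<in> sets \<nu>"
    then have A [measurable]: "A \<in> sets borel" by simp
    have "emeasure N A = (\<integral>\<^sup>+V. emeasure N A \<partial>\<nu>)" by (simp add: \<nu>.emeasure_space_1)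
    also have "\<dots> = (\<integral>\<^sup>+V. (\<integral>\<^sup>+R. indicator A (V ** R) \<partial>N) \<partial>\<nu>)"
    proof (rule nn_integral_cong_AE, use AE_\<nu> in eventually_elim)
      fix V :: "'k ^ 'n ^ 'n" assume V: "V \<in> isometry_group"
      have "emeasure N A = (\<integral>\<^sup>+R. indicator A R \<partial>distr N borel (\<lambda>R. V ** R))"
        unfolding left_N[OF V] by simp
      also have "\<dots> = (\<integral>\<^sup>+R. indicator A (V ** R) \<partial>N)" by (rule nn_integral_distr) measurable
      finally show "emeasure N A = (\<integral>\<^sup>+R. indicator A (V ** R) \<partial>N)" .
    qed
    also have "\<dots> = (\<integral>\<^sup>+R. (\<integral>\<^sup>+V. indicator A (V ** R) \<partial>\<nu>) \<partial>N)"
      by (rule P.Fubini'[symmetric]) measurable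
    also have "\<dots> = (\<integral>\<^sup>+R. emeasure \<nu> A \<partial>N)"
    proof (rule nn_integral_cong_AE, use AE_N in eventually_elim)
      fix R :: "'k ^ 'n ^ 'n" assume R: "R \<in> isometry_group"
      have "emeasure \<nu> A = (\<integral>\<^sup>+V. indicator A V \<partial>distr \<nu> borel (\<lambda>V. V ** R))"
        unfolding right_\<nu>[OF R] by simp
      also have "\<dots> = (\<integral>\<^sup>+V. indicator A (V ** R) \<partial>\<nu>)" by (rule nn_integral_distr) measurable
      finally show "(\<integral>\<^sup>+V. indicator A (V ** R) \<partial>\<nu>) = emeasure \<nu> A" ..
    qed
    finally show "emeasure \<nu> A = emeasure N A" by (simp add: N.emeasure_space_1)
  qed simp
  show "haar_rotation cj (distr \<mu> borel (\<lambda>R. R))"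
    unfolding N_def[symmetric]
  proof unfold_locales
    show "sets N = sets borel" "AE R in N. R \<in> isometry_group" "DIM('k) \<le> 2" by fact+
    show "distr N borel (\<lambda>R. U ** R) = N" "distr N borel (\<lambda>R. R ** U) = N" if "U \<in> isometry_group" for U
      using left_N[OF that] right_\<nu>[OF that] by (simp_all add: \<nu>N)
  qed
  show "distr (distr \<mu> borel (\<lambda>R. R)) borel adj = distr \<mu> borel (\<lambda>R. R)"
    using \<nu>N by (simp add: \<nu>_def N_def)
qed

end

text \<open>The diagonal contributes at most d \<sigma> to the double sum and the off-diagonal pairs
  at most 3 d \<sigma>, so the variance is at most 4 \<sigma> / d <= 1 / d; Chebyshev then asks for
  1 / (d \<delta>^2) <= \<epsilon>, which is the assumption on d.\<close>

lemma (in haar_rotation) orthonormal_frequency: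
  fixes B :: "('k ^ 'n) set" and A :: "('k ^ 'n) set"
  assumes card: "CARD('n) \<ge> 3" and B: "finite B" "card B = CARD('n)"
    and orth: "\<And>x y. x \<in> B \<Longrightarrow> y \<in> B \<Longrightarrow> herm x y = (if x = y then 1 else 0)"
    and A [measurable]: "A \<in> sets borel"
    and eps: "\<epsilon> > 0" and delta: "\<delta> > 0" and d: "real CARD('n) \<ge> inverse (\<delta>\<^sup>2) * inverse \<epsilon>"
  shows "prob {R. \<bar>(\<Sum>b\<in>B. indicator A (R *v b)) / real (card B) - measure S A\<bar> \<le> \<delta>} \<ge> 1 - \<epsilon>"
proof -
  define d where "d = real CARD('n)"
  have d3: "d \<ge> 3" using card by (simp add: d_def)
  define u where "u = measure S A"
  have u: "0 \<le> u" "u \<le> 1" by (simp_all add: u_def)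
  define g where "g = (\<lambda>y. indicator A y - u)"
  have g_meas [measurable]: "g \<in> borel_measurable borel" unfolding g_def by measurable
  have g_bound: "\<bar>g y\<bar> \<le> 1" for y using u by (auto simp: g_def indicator_def)
  have ind: "integrable S (indicator A :: _ \<Rightarrow> real)"
    by (rule integrable_S[where B = 1]) (auto simp: indicator_def)
  have g_mean: "(\<integral>y. g y \<partial>S) = 0"
    using ind S.prob_space by (simp add: g_def u_def)
  define \<sigma> where "\<sigma> = (\<integral>y. (g y)\<^sup>2 \<partial>S)"
  \<comment> \<open>An indicator is its own square; this makes \<sigma> = u (1 - u), the Bernoulli
    variance, hence at most 1 / 4.\<close>
  have "(g y)\<^sup>2 = (1 - 2 * u) * indicator A y + u\<^sup>2" for y
    by (auto simp: g_def indicator_def power2_eq_square algebra_simps)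
  then have "\<sigma> = (1 - 2 * u) * u + u\<^sup>2"
    using ind S.prob_space by (simp add: \<sigma>_def u_def)
  then have "1 / 4 - \<sigma> = (u - 1 / 2)\<^sup>2" by (simp add: power2_eq_square algebra_simps)
  then have \<sigma>: "\<sigma> \<le> 1 / 4" by (metis diff_ge_0_iff_ge zero_le_power2)
  have unit: "norm b = 1" if "b \<in> B" for b
    using orth[OF that that] by (intro norm_eq_1_if_herm_self) simp
  define f where "f = (\<lambda>R. (\<Sum>b\<in>B. indicator A (R *v b)) / real (card B) :: real)"
  have f_meas [measurable]: "f \<in> borel_measurable borel" unfolding f_def by measurable
  have fg: "f R - u = (\<Sum>b\<in>B. g (R *v b)) / d" for R
    using B d3 by (simp add: f_def g_def d_def sum_subtractf diff_divide_distrib)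
  have f_bound: "\<bar>f R\<bar> \<le> 2" for R
  proof -
    have "\<bar>\<Sum>b\<in>B. g (R *v b)\<bar> \<le> (\<Sum>b\<in>B. 1)"
      by (rule order_trans[OF sum_abs]) (rule sum_mono, rule g_bound)
    then have "\<bar>f R - u\<bar> \<le> 1" unfolding fg using B d3 by (simp add: d_def)
    then show ?thesis using u by linarith
  qed
  have fi: "integrable N f" "integrable N (\<lambda>R. (f R)\<^sup>2)"
  proof -
    have "\<bar>(f R)\<^sup>2\<bar> \<le> 4" for R using power_mono[OF f_bound[of R], of 2] by simp
    then show "integrable N f" "integrable N (\<lambda>R. (f R)\<^sup>2)"
      using f_bound by (auto intro!: integrable_const_bound[of f 2] integrable_const_bound[of "\<lambda>R. (f R)\<^sup>2" 4])
  qed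
  have gi: "integrable N (\<lambda>R. g (R *v b))" for b
    by (rule integrable_const_bound[of _ 1]) (use g_bound in auto)
  have ggi: "integrable N (\<lambda>R. g (R *v b) * g (R *v b'))" for b b'
    by (rule integrable_const_bound[of _ 1]) (use g_bound in \<open>auto simp: abs_mult mult_le_one\<close>)
  have "expectation f - u = (\<integral>R. f R - u \<partial>N)" using fi prob_space by simp
  also have "\<dots> = (\<Sum>b\<in>B. (\<integral>R. g (R *v b) \<partial>N)) / d"
    unfolding fg using gi by (simp add: Bochner_Integration.integral_sum)
  also have "\<dots> = 0"
    using integral_mult_vec[OF unit g_meas] g_mean by simp
  finally have Ef: "expectation f = u" by simp
  have "variance f = (\<integral>R. ((\<Sum>b\<in>B. g (R *v b)) / d)\<^sup>2 \<partial>N)" unfolding Ef fg ..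
  also have "\<dots> = (\<integral>R. (\<Sum>b\<in>B. \<Sum>b'\<in>B. g (R *v b) * g (R *v b')) / d\<^sup>2 \<partial>N)"
    by (simp add: power_divide power2_eq_square sum_product)
  also have "\<dots> = (\<Sum>b\<in>B. \<Sum>b'\<in>B. corr g b b') / d\<^sup>2"
    using ggi by (simp add: Bochner_Integration.integral_sum corr_def[OF g_meas g_bound g_mean])
  also have "\<dots> \<le> (\<Sum>b\<in>B. \<Sum>b'\<in>B. (if b = b' then \<sigma> else 0) + 3 / (d - 1) * \<sigma> * (if b = b' then 0 else 1)) / d\<^sup>2"
  proof (intro divide_right_mono sum_mono)
    fix b b' assume b: "b \<in> B" "b' \<in> B"
    show "corr g b b' \<le> (if b = b' then \<sigma> else 0) + 3 / (d - 1) * \<sigma> * (if b = b' then 0 else 1)"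
    proof (cases "b = b'")
      case True
      have "corr g b b \<le> \<sigma>"
        using corr_bound[OF g_meas g_bound g_mean unit unit, of b b] b unfolding \<sigma>_def by simp
      then show ?thesis using True by simp
    next
      case False
      then show ?thesis
        using corr_orthogonal_le[OF g_meas g_bound g_mean card unit[OF b(1)] unit[OF b(2)]] orth[OF b]
        unfolding \<sigma>_def d_def by simp
    qed
  qed simp
  also have "(\<Sum>b\<in>B. \<Sum>b'\<in>B. (if b = b' then \<sigma> else 0) + 3 / (d - 1) * \<sigma> * (if b = b' then 0 else 1)) = 4 * d * \<sigma>"
  proof -
    have "(\<Sum>b'\<in>B. (if b = b' then \<sigma> else 0) + 3 / (d - 1) * \<sigma> * (if b = b' then 0 else 1)) = 4 * \<sigma>" if b: "b \<in> B" for b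
    proof -
      have "(\<Sum>b'\<in>B. if b = b' then 0 else 1) = (\<Sum>b'\<in>B - {b}. 1::real)"
        using B by (intro sum.mono_neutral_cong_right) auto
      also have "\<dots> = d - 1" using B b card by (simp add: d_def of_nat_diff)
      finally have off: "(\<Sum>b'\<in>B. if b = b' then 0 else 1) = d - 1" .
      show ?thesis
        unfolding sum.distrib sum_distrib_left[symmetric] off using B b d3 by simp
    qed
    then show ?thesis using B by (simp add: d_def)
  qed
  also have "4 * d * \<sigma> / d\<^sup>2 = 4 * \<sigma> / d" using d3 by (simp add: power2_eq_square)
  also have "\<dots> \<le> 1 / d" using \<sigma> d3 by (intro divide_right_mono) auto
  finally have var: "variance f \<le> 1 / d" .
  have "prob {R\<in>space N. \<delta> \<le> \<bar>f R - expectation f\<bar>} \<le> variance f / \<delta>\<^sup>2"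
    by (rule Chebyshev_inequality) (use fi delta in auto)
  also have "\<dots> \<le> 1 / d / \<delta>\<^sup>2" using var by (rule divide_right_mono) simp
  also have "\<dots> \<le> \<epsilon>"
    using d eps delta d3 unfolding d_def[symmetric] by (simp add: field_simps)
  finally have tail: "prob {R. \<delta> \<le> \<bar>f R - u\<bar>} \<le> \<epsilon>" by (simp add: Ef)
  have "1 - prob {R. \<bar>f R - u\<bar> \<le> \<delta>} = prob (UNIV - {R. \<bar>f R - u\<bar> \<le> \<delta>})"
    using prob_compl[of "{R. \<bar>f R - u\<bar> \<le> \<delta>}"] by simp
  also have "\<dots> \<le> prob {R. \<delta> \<le> \<bar>f R - u\<bar>}"
    by (rule finite_measure_mono) auto
  finally show ?thesis using tail by (simp add: f_def u_def)
qed

text \<open>A basis vector b lies in the image of A under R exactly when \<open>adj R *v b\<close>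
  lies in A, so the count is the frequency for \<open>adj R\<close>, which has the same law as
  R.\<close>

lemma (in conjugation) eps_delta_uniform_orthonormal:
  fixes B :: "('k ^ 'n) set" and \<mu> :: "('k ^ 'n ^ 'n) measure"
  assumes haar: "normalized_haar isometry_group \<mu>" and dim: "DIM('k) \<le> 2"
    and card: "CARD('n) \<ge> 3" and B: "finite B" "card B = CARD('n)"
    and orth: "\<And>x y. x \<in> B \<Longrightarrow> y \<in> B \<Longrightarrow> herm x y = (if x = y then 1 else 0)"
    and eps: "\<epsilon> > 0" and delta: "\<delta> > 0" and d: "real CARD('n) \<ge> inverse (\<delta>\<^sup>2) * inverse \<epsilon>"
  shows "eps_delta_uniform \<mu> \<epsilon> \<delta> B"
  unfolding eps_delta_uniform_def
proof (intro conjI allI impI)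
  define N where "N = distr \<mu> borel (\<lambda>R. R)"
  interpret haar_rotation cj N unfolding N_def by (rule haar_rotation_normalized_haar[OF haar dim])
  have adjN: "distr N borel adj = N" unfolding N_def by (rule distr_adj_normalized_haar[OF haar dim])
  have sets: "sets \<mu> = sets (restrict_space borel isometry_group)"
    using haar by (auto simp: normalized_haar_def)
  have space: "space \<mu> = isometry_group"
    using sets_eq_imp_space_eq[OF sets] by (simp add: space_restrict_space)
  have id: "(\<lambda>R. R) \<in> borel_measurable \<mu>"
    unfolding measurable_cong_sets[OF sets refl] by (rule measurable_restrict_space1) measurable
  show "finite B" by fact
  show "B \<subseteq> sphere 0 1"
    using orth by (auto intro!: norm_eq_1_if_herm_self)
  fix A :: "('k ^ 'n) set" assume A [measurable]: "A \<in> sets borel" and sub: "A \<subseteq> sphere 0 1"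
  define E where "E = {R. \<bar>(\<Sum>b\<in>B. indicator A (R *v b)) / real (card B) - measure S A\<bar> \<le> \<delta>}"
  have E [measurable]: "E \<in> sets borel" unfolding E_def by measurable
  have count: "real (card (B \<inter> (\<lambda>x. R *v x) ` A)) = (\<Sum>b\<in>B. indicator A (adj R *v b))"
    if R: "R \<in> isometry_group" for R
  proof -
    have "b \<in> (\<lambda>x. R *v x) ` A \<longleftrightarrow> adj R *v b \<in> A" for b
      by (auto simp: adj_mult_vec_cancel[OF R] mult_vec_adj_cancel[OF R] intro!: image_eqI[of _ _ "adj R *v b"])
    then have "B \<inter> (\<lambda>x. R *v x) ` A = {b\<in>B. adj R *v b \<in> A}" by auto
    then show ?thesis using B(1) by (simp add: indicator_def sum.If_cases Int_def)
  qed
  have "{R \<in> space \<mu>. \<bar>real (card (B \<inter> (\<lambda>x. R *v x) ` A)) / real (card B) - measure uniform_sphere A\<bar> \<le> \<delta>}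
      = (\<lambda>R. R) -` (adj -` E) \<inter> space \<mu>"
    unfolding space measure_uniform_sphere[OF A sub] by (auto simp: E_def count)
  moreover have "adj -` E \<in> sets borel" by (rule measurable_sets_borel[OF borel_measurable_adj E])
  ultimately have "measure \<mu> {R \<in> space \<mu>. \<bar>real (card (B \<inter> (\<lambda>x. R *v x) ` A)) / real (card B) - measure uniform_sphere A\<bar> \<le> \<delta>}
      = measure N (adj -` E)"
    unfolding N_def by (subst measure_distr[OF id]) auto
  also have "\<dots> = measure (distr N borel adj) E"
    by (subst measure_distr) auto
  also have "\<dots> \<ge> 1 - \<epsilon>"
    unfolding adjN E_def by (rule orthonormal_frequency[OF card B orth A eps delta d])
  finally show "1 - \<epsilon> \<le> measure \<mu> {R \<in> space \<mu>. \<bar>real (card (B \<inter> (\<lambda>x. R *v x) ` A)) / real (card B) - measure uniform_sphere A\<bar> \<le> \<delta>}" .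
qed

section \<open>Specialization to real and complex scalars\<close>

lemma conjugation_real: "conjugation (\<lambda>x::real. x)"
  by standard (simp_all add: power2_eq_square)

lemma conjugation_complex: "conjugation cnj"
  by standard (simp_all only: complex_norm_square complex_cnj_add complex_cnj_mult complex_cnj_cnj)

lemma orthogonal_group_eq: "orthogonal_group = conjugation.isometry_group (\<lambda>x::real. x)"
  unfolding orthogonal_group_def orthogonal_matrix_def transpose_def
    conjugation.isometry_group_def[OF conjugation_real] conjugation.adj_def[OF conjugation_real] ..

lemma unitary_group_eq: "unitary_group = conjugation.isometry_group cnj"
  unfolding unitary_group_def unitary_matrix_def conj_transpose_def
    conjugation.isometry_group_def[OF conjugation_complex] conjugation.adj_def[OF conjugation_complex] ..

theorem theorem1:
  fixes \<epsilon> \<delta> :: real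
  assumes "\<epsilon> > 0" and "\<delta> > 0"
    and "CARD('n::finite) \<ge> 4"
    and "real CARD('n) \<ge> inverse (\<delta>\<^sup>2) * inverse \<epsilon>"
  shows "(\<forall>(uG :: (real ^ 'n ^ 'n) measure) B.
            normalized_haar orthogonal_group uG \<longrightarrow> real_orthonormal_basis B \<longrightarrow>
            eps_delta_uniform uG \<epsilon> \<delta> B) \<and>
         (\<forall>(uG :: (complex ^ 'n ^ 'n) measure) B.
            normalized_haar unitary_group uG \<longrightarrow> complex_orthonormal_basis B \<longrightarrow>
            eps_delta_uniform uG \<epsilon> \<delta> B)"
proof (intro conjI allI impI)
  have card: "CARD('n) \<ge> 3" using assms(3) by simp
  fix uG :: "(real ^ 'n ^ 'n) measure" and B :: "(real ^ 'n) set"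
  assume haar: "normalized_haar orthogonal_group uG" and B: "real_orthonormal_basis B"
  have fin: "finite B" "card B = CARD('n)"
    using B dim_eq_card[of B UNIV] independent_imp_finite[of B] by (auto simp: real_orthonormal_basis_def)
  have orth: "conjugation.herm (\<lambda>x. x) x y = (if x = y then 1 else 0)" if "x \<in> B" "y \<in> B" for x y
    using B that unfolding conjugation.herm_def[OF conjugation_real] real_orthonormal_basis_def inner_vec_def
    by (simp add: inner_real_def)
  show "eps_delta_uniform uG \<epsilon> \<delta> B"
    by (rule conjugation.eps_delta_uniform_orthonormal[OF conjugation_real haar[unfolded orthogonal_group_eq]])
      (use card fin orth assms in auto)
next
  have card: "CARD('n) \<ge> 3" using assms(3) by simp
  fix uG :: "(complex ^ 'n ^ 'n) measure" and B :: "(complex ^ 'n) set"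
  assume haar: "normalized_haar unitary_group uG" and B: "complex_orthonormal_basis B"
  have fin: "finite B" "card B = CARD('n)"
    using B vec.dim_eq_card[of B UNIV] vec.finiteI_independent[of B]
    by (auto simp: complex_orthonormal_basis_def card_cart_basis)
  have orth: "conjugation.herm cnj x y = (if x = y then 1 else 0)" if "x \<in> B" "y \<in> B" for x y
    using B that unfolding conjugation.herm_def[OF conjugation_complex] complex_orthonormal_basis_def hermitian_inner_def
    by simp
  show "eps_delta_uniform uG \<epsilon> \<delta> B"
    by (rule conjugation.eps_delta_uniform_orthonormal[OF conjugation_complex haar[unfolded unitary_group_eq]])
      (use card fin orth assms in auto)
qed

end
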